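(* Let $\mu$ be any probability measure on $\mathbb{C}$ and let $\{z_i\}_{i\ge1}$ be a log-Cesàro bounded, $\mu$-distributed sequence of complex numbers. Let $k\in\mathbb{N}$ and let $X_1,\dots,X_k$ be independent complex-valued random variables with bounded densities $\nu_1,\dots,\nu_k$ on $\mathbb{C}$, respectively. For each $n\in\mathbb{N}$ let $$P_n(z):=(z-z_1)\cdots(z-z_n)(z-X_1)\cdots(z-X_k).$$ Then, as $n\to\infty$, $\mathcal{M}(P_n)\to\mu$ in probability and $\mathcal{M}(P_n^{(\ell)})\to\mu$ in probability for any $1\le\ell\le k$.
   Context: A sequence $\{z_n\}_{n\ge1}$ of complex numbers is $\mu$-distributed if $\frac1n\sum_{i=1}^n\delta_{z_i}$ converges weakly to the probability measure $\mu$. It is log-Cesàro bounded if the sequence $\{\frac1n\sum_{i=1}^n\log_+|z_i|\}_{n\ge1}$ is bounded, where $\log_+x=\max(\log x,0)$ (and $\log_+0=0$). Densities are with respect to Lebesgue measure on $\mathbb{C}$. For a non-constant polynomial $P$, $\mathcal{M}(P)$ denotes the uniform probability measure on the multiset of zeros of $P$ (zeros counted with multiplicity). $P_n^{(\ell)}$ is the $\ell$-th derivative. Convergence in probability of random probability measures is with respect to the topology of weak convergence of probability measures on $\mathbb{C}$. *)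

theory Defs
  imports
    "HOL-Probability.Probability"
    "HOL-Computational_Algebra.Computational_Algebra"
begin

definition borel_prob_measures :: "'a::topological_space measure set" where
  "borel_prob_measures = {N. prob_space N \<and> sets N = sets borel}"

text \<open>The topology of weak convergence on the Borel probability measures: the coarsest topology
  for which integration of every bounded continuous real function is continuous.\<close>

definition weak_topology :: "'a::topological_space measure topology" where
  "weak_topology = topology_generated_by
     {{N \<in> borel_prob_measures. (\<integral>x. f x \<partial>N) \<in> V} | (f :: 'a \<Rightarrow> real) V.
        continuous_on UNIV f \<and> bounded (range f) \<and> open V}"

lemma topspace_weak_topology [simp]: "topspace weak_topology = borel_prob_measures"
proof -
  have "borel_prob_measures \<in> {{N \<in> borel_prob_measures. (\<integral>x. f x \<partial>N) \<in> V} | (f :: 'a \<Rightarrow> real) V.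
        continuous_on UNIV f \<and> bounded (range f) \<and> open V}"
    by (intro CollectI exI[of _ "\<lambda>_. 0"] exI[of _ UNIV]) auto
  then show ?thesis
    unfolding weak_topology_def topology_generated_by_topspace by blast
qed

lemma limitin_weak_topology_iff:
  fixes N :: "'a::topological_space measure"
  assumes Ns: "\<forall>\<^sub>F n in F. Ns n \<in> borel_prob_measures" and N: "N \<in> borel_prob_measures"
  shows "limitin weak_topology Ns N F \<longleftrightarrow>
    (\<forall>f :: 'a \<Rightarrow> real. continuous_on UNIV f \<longrightarrow> bounded (range f) \<longrightarrow>
       ((\<lambda>n. \<integral>x. f x \<partial>Ns n) \<longlongrightarrow> (\<integral>x. f x \<partial>N)) F)" (is "_ \<longleftrightarrow> ?R")
proof
  assume L: "limitin weak_topology Ns N F"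
  show ?R
  proof (intro allI impI topological_tendstoI)
    fix f :: "'a \<Rightarrow> real" and V
    assume f: "continuous_on UNIV f" "bounded (range f)" and V: "open V" "(\<integral>x. f x \<partial>N) \<in> V"
    have "openin weak_topology {N \<in> borel_prob_measures. (\<integral>x. f x \<partial>N) \<in> V}"
      unfolding weak_topology_def using f V by (intro topology_generated_by_Basis) blast
    with L N V have "\<forall>\<^sub>F n in F. Ns n \<in> {N \<in> borel_prob_measures. (\<integral>x. f x \<partial>N) \<in> V}"
      unfolding limitin_def by blast
    then show "\<forall>\<^sub>F n in F. (\<integral>x. f x \<partial>Ns n) \<in> V"
      by eventually_elim auto
  qed
next
  assume R: ?R
  have "N \<in> U \<Longrightarrow> \<forall>\<^sub>F n in F. Ns n \<in> U" if "openin weak_topology U" for U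
    using that[unfolded weak_topology_def openin_topology_generated_by_iff]
  proof (induction rule: generate_topology_on.induct)
    case (Basis S)
    then obtain f :: "'a \<Rightarrow> real" and V where
      S: "S = {N \<in> borel_prob_measures. (\<integral>x. f x \<partial>N) \<in> V}"
      and f: "continuous_on UNIV f" "bounded (range f)" and V: "open V" by blast
    have "\<forall>\<^sub>F n in F. (\<integral>x. f x \<partial>Ns n) \<in> V"
      using R f V Basis.prems S by (auto dest: topological_tendstoD)
    with Ns show ?case unfolding S by eventually_elim auto
  next
    case (UN K)
    then obtain k where "k \<in> K" "\<forall>\<^sub>F n in F. Ns n \<in> k" by blast
    then show ?case by (auto elim: eventually_mono)
  qed (auto intro: eventually_conj)
  with N show "limitin weak_topology Ns N F"
    unfolding limitin_def by simp
qed

text \<open>\<open>uniform_mset A\<close> is the normalised sum of Dirac measures over the elements of \<open>A\<close>, with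
  multiplicity, as a Borel measure; it is meaningful only for nonempty \<open>A\<close>, because
  \<open>pmf_of_multiset\<close> is unspecified on the empty multiset.\<close>

definition uniform_mset :: "'a::topological_space multiset \<Rightarrow> 'a measure" where
  "uniform_mset A = distr (measure_pmf (pmf_of_multiset A)) borel (\<lambda>x. x)"

lemma uniform_mset_in_borel_prob_measures: "uniform_mset A \<in> borel_prob_measures"
  unfolding borel_prob_measures_def uniform_mset_def
  by (auto intro!: prob_space.prob_space_distr measure_pmf.prob_space_axioms)

lemma measure_uniform_mset:
  assumes "A \<noteq> {#}" and "S \<in> sets borel"
  shows "measure (uniform_mset A) S = size (filter_mset (\<lambda>x. x \<in> S) A) / size A"
proof -
  have "measure (uniform_mset A) S = measure_pmf.prob (pmf_of_multiset A) S"
    unfolding uniform_mset_def using assms by (subst measure_distr) auto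
  also have "\<dots> = measure_pmf.prob (pmf_of_multiset A) (S \<inter> set_mset A)"
    using measure_Int_set_pmf[of "pmf_of_multiset A" S] assms by (simp add: set_pmf_of_multiset)
  also have "\<dots> = (\<Sum>x\<in>S \<inter> set_mset A. count A x / size A)"
    using assms by (subst measure_measure_pmf_finite) auto
  also have "\<dots> = (\<Sum>x\<in>S \<inter> set_mset A. count A x) / size A"
    by (simp add: sum_divide_distrib)
  also have "(\<Sum>x\<in>S \<inter> set_mset A. count A x) = size (filter_mset (\<lambda>x. x \<in> S) A)"
    unfolding size_multiset_overloaded_eq by (intro sum.cong) auto
  finally show ?thesis .
qed

definition zeros_measure :: "complex poly \<Rightarrow> complex measure" where
  "zeros_measure P = uniform_mset (proots P)"

definition log_plus :: "real \<Rightarrow> real" where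
  "log_plus x = (if x = 0 then 0 else max (ln x) 0)"

text \<open>Sequences are indexed from 1; the value at 0 is never used.\<close>

definition mu_distributed :: "complex measure \<Rightarrow> (nat \<Rightarrow> complex) \<Rightarrow> bool" where
  "mu_distributed \<mu> z \<longleftrightarrow>
     limitin weak_topology (\<lambda>n. uniform_mset (image_mset z (mset_set {1..n}))) \<mu> sequentially"

definition log_Cesaro_bounded :: "(nat \<Rightarrow> complex) \<Rightarrow> bool" where
  "log_Cesaro_bounded z \<longleftrightarrow>
     bounded ((\<lambda>n. (\<Sum>i=1..n. log_plus (norm (z i))) / real n) ` {1..})"

text \<open>Convergence in probability, in a topology \<open>T\<close>, of random elements to a constant \<open>c\<close>.
  It is stated as convergence of probabilities to 1 (not of the complements to 0) since \<open>measure\<close>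
  is 0 on nonmeasurable sets, so that failure of measurability cannot make it hold.\<close>

definition tendsto_in_prob ::
    "'w measure \<Rightarrow> 'b topology \<Rightarrow> (nat \<Rightarrow> 'w \<Rightarrow> 'b) \<Rightarrow> 'b \<Rightarrow> bool" where
  "tendsto_in_prob M T Y c \<longleftrightarrow> c \<in> topspace T \<and>
     (\<forall>U. openin T U \<and> c \<in> U \<longrightarrow> (\<lambda>n. measure M {\<omega> \<in> space M. Y n \<omega> \<in> U}) \<longlonglongrightarrow> 1)"

definition random_poly ::
    "(nat \<Rightarrow> complex) \<Rightarrow> nat \<Rightarrow> (nat \<Rightarrow> 'w \<Rightarrow> complex) \<Rightarrow> nat \<Rightarrow> 'w \<Rightarrow> complex poly" where
  "random_poly z k X n \<omega> = (\<Prod>i=1..n. [:- z i, 1:]) * (\<Prod>j=1..k. [:- X j \<omega>, 1:])"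

end

theory Submission
  imports Defs "HOL-Complex_Analysis.Complex_Analysis" "HOL-Real_Asymp.Real_Asymp"
begin

text \<open>Write \<open>N = n + k\<close>, \<open>P\<close> for the random polynomial and \<open>Q\<close> for its \<open>l\<close>-th derivative. A
  logarithmic potential \<open>\<psi> w = \<integral> G z ln \<bar>z - w\<bar> dz\<close>, \<open>G\<close> bounded with support in a disc \<open>D\<close>,
  satisfies \<open>\<Sum> \<psi> = \<integral> G z ln \<bar>P z\<bar> dz\<close> over the zeros of a monic \<open>P\<close>, and every continuous
  function with compact support is a uniform limit of such potentials. So it suffices that the
  integral of \<open>\<bar>ln \<bar>Q / P\<bar>\<bar>\<close> over \<open>D\<close> is \<open>o(n)\<close> in probability. From above, \<open>Q / P\<close> is a product
  of \<open>l\<close> logarithmic derivatives, each \<open>O(N)\<close> times an average of the functions \<open>1 / (z - w)\<close>,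
  which are uniformly integrable over \<open>D\<close>. From below, removing the factors \<open>z - X j\<close> one after
  the other writes \<open>Q / P\<close> as \<open>l!\<close> times a product of \<open>l\<close> terms \<open>1 / (z - X j) + c\<close> with \<open>c\<close>
  independent of \<open>X j\<close>; since \<open>X j\<close> has a bounded density, the expected negative part of the
  logarithm of such a term is bounded, up to a term depending on the size of \<open>X j\<close> alone.\<close>

section \<open>Lebesgue measure on the plane\<close>

text \<open>The obstacle is the lower bound on \<open>\<bar>Q / P\<bar>\<close>. The position of the
  roots alone does not control the critical points: \<open>z ^ n - 1\<close> has its roots
  equidistributed on the unit circle and all its critical points at 0. Randomness has to exclude
  this, and each derivative uses up one random root, whence \<open>l \<le> k\<close>. The upper
  bound, in contrast, holds for every outcome. Since everything is integrated over a disc,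
  convergence of \<open>ln \<bar>P z\<bar> / n\<close> at single points never enters: the potentials
  of \<open>P\<close> and \<open>Q\<close> are compared with each other, and \<open>\<mu>\<close>
  appears only through the averages over the \<open>z i\<close>. Apart from the approximation of the
  test function, the errors are bounded, of order \<open>ln n\<close> or of order
  \<open>sqrt n\<close>, and vanish after division by \<open>n\<close>. Test functions of compact
  support suffice because \<open>\<mu>\<close> has mass 1, so that no mass can escape to infinity.
  As \<open>measure\<close> is 0 on nonmeasurable sets, the events themselves must be shown to be
  measurable; continuity of the roots serves this purpose.\<close>

lemma ball_in_sets_borel [measurable]: "ball (x :: 'a::metric_space) r \<in> sets borel"
  by simp

lemma distr_lborel_reflect:
  "distr lborel borel (\<lambda>x::'a::euclidean_space. c - x) = lborel"
  using lborel_affine[of "-1" c] by (simp add: density_1 one_ennreal_def[symmetric])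

lemma nn_integral_lborel_translate:
  fixes h :: "'a::euclidean_space \<Rightarrow> ennreal"
  assumes [measurable]: "h \<in> borel_measurable borel"
  shows "(\<integral>\<^sup>+x. h (c + x) \<partial>lborel) = (\<integral>\<^sup>+x. h x \<partial>lborel)"
  by (subst (2) lborel_distr_plus[of c, symmetric]) (simp add: nn_integral_distr)

lemma nn_integral_lborel_reflect:
  fixes h :: "'a::euclidean_space \<Rightarrow> ennreal"
  assumes [measurable]: "h \<in> borel_measurable borel"
  shows "(\<integral>\<^sup>+x. h (c - x) \<partial>lborel) = (\<integral>\<^sup>+x. h x \<partial>lborel)"
  by (subst (2) distr_lborel_reflect[of c, symmetric]) (simp add: nn_integral_distr)

lemma integral_lborel_translate:
  fixes h :: "'a::euclidean_space \<Rightarrow> real"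
  assumes [measurable]: "h \<in> borel_measurable borel"
  shows "(\<integral>x. h (c + x) \<partial>lborel) = (\<integral>x. h x \<partial>lborel)"
  by (subst (2) lborel_distr_plus[of c, symmetric]) (simp add: integral_distr)

lemma integral_lborel_reflect:
  fixes h :: "'a::euclidean_space \<Rightarrow> real"
  assumes [measurable]: "h \<in> borel_measurable borel"
  shows "(\<integral>x. h (c - x) \<partial>lborel) = (\<integral>x. h x \<partial>lborel)"
  by (subst (2) distr_lborel_reflect[of c, symmetric]) (simp add: integral_distr)

text \<open>The proof is the one of the uniqueness of Haar measure: Tonelli's theorem and translation
  invariance give \<open>\<nu> A * \<lambda> B = \<lambda> A * \<nu> B\<close> for \<open>\<nu>\<close> the image of Lebesgue measure \<open>\<lambda>\<close>, and the
  unit ball \<open>B\<close> has \<open>\<nu> B = \<lambda> B\<close>.\<close>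

lemma distr_lborel_orthogonal:
  fixes f :: "'a::euclidean_space \<Rightarrow> 'a"
  assumes f: "orthogonal_transformation f"
  shows "distr lborel borel f = lborel"
proof (rule measure_eqI)
  have lin: "linear f" and nf: "\<And>x. norm (f x) = norm x"
    using f by (auto simp: orthogonal_transformation)
  have [measurable]: "f \<in> borel_measurable borel"
    using lin by (intro borel_measurable_continuous_onI linear_continuous_on) (simp add:
        linear_linear)
  fix A assume "A \<in> sets (distr lborel borel f)"
  then have [measurable]: "A \<in> sets borel" by simp
  define G :: "'a \<Rightarrow> ennreal" where "G = indicator (ball 0 1)"
  define a :: "'a \<Rightarrow> ennreal" where "a = indicator A"
  have [measurable]: "G \<in> borel_measurable borel" "a \<in> borel_measurable borel"
    unfolding G_def a_def by (auto intro!: borel_measurable_indicator)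
  have Gf: "G (f x) = G x" for x by (auto simp: G_def nf indicator_def)
  have "(\<integral>\<^sup>+x. a (f x) \<partial>lborel) * (\<integral>\<^sup>+y. G y \<partial>lborel) = (\<integral>\<^sup>+x. \<integral>\<^sup>+y. a (f x) * G (f x + y) \<partial>lborel
      \<partial>lborel)"
    by (simp add: nn_integral_cmult nn_integral_multc nn_integral_lborel_translate)
  also have "\<dots> = (\<integral>\<^sup>+y. \<integral>\<^sup>+x. a (f x) * G (f x + y) \<partial>lborel \<partial>lborel)"
    by (rule lborel_pair.Fubini') measurable
  also have "\<dots> = (\<integral>\<^sup>+y. \<integral>\<^sup>+x. a (f x - y) * G (f x) \<partial>lborel \<partial>lborel)"
  proof (rule nn_integral_cong)
    fix y :: 'a
    \<comment> \<open>By linearity, shifting \<open>x\<close> by \<open>s\<close> shifts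
      \<open>f x\<close> by \<open>y\<close>, so invariance under translations applies inside
      \<open>f\<close>.\<close>
    obtain s where s: "f s = y" using orthogonal_transformation_surj[OF f] by (metis surjD)
    have "(\<integral>\<^sup>+x. a (f x) * G (f x + y) \<partial>lborel) = (\<integral>\<^sup>+x. a (f ((- s) + x)) * G (f ((- s) + x) + y)
        \<partial>lborel)"
      by (rule nn_integral_lborel_translate[symmetric]) measurable
    also have "\<dots> = (\<integral>\<^sup>+x. a (f x - y) * G (f x) \<partial>lborel)"
      by (simp add: linear_diff[OF lin] s)
    finally show "(\<integral>\<^sup>+x. a (f x) * G (f x + y) \<partial>lborel) = (\<integral>\<^sup>+x. a (f x - y) * G (f x) \<partial>lborel)" .
  qed
  also have "\<dots> = (\<integral>\<^sup>+x. \<integral>\<^sup>+y. a (f x - y) * G (f x) \<partial>lborel \<partial>lborel)"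
    by (rule lborel_pair.Fubini') measurable
  also have "\<dots> = (\<integral>\<^sup>+x. a x \<partial>lborel) * (\<integral>\<^sup>+y. G y \<partial>lborel)"
    by (simp add: nn_integral_cmult nn_integral_multc nn_integral_lborel_reflect Gf)
  finally have eq: "(\<integral>\<^sup>+x. a (f x) \<partial>lborel) * (\<integral>\<^sup>+y. G y \<partial>lborel)
      = (\<integral>\<^sup>+x. a x \<partial>lborel) * (\<integral>\<^sup>+y. G y \<partial>lborel)" .
  have GG: "(\<integral>\<^sup>+y. G y \<partial>lborel) = emeasure lborel (ball (0::'a) 1)"
    by (simp add: G_def)
  have "emeasure lborel (ball (0::'a) 1) < \<infinity>"
    by (simp add: emeasure_ball)
  moreover have "emeasure lborel (ball (0::'a) 1) \<noteq> 0"
    by (subst emeasure_ball) (auto simp: unit_ball_vol_pos ennreal_eq_0_iff not_le)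
  ultimately have "(\<integral>\<^sup>+x. a (f x) \<partial>lborel) = (\<integral>\<^sup>+x. a x \<partial>lborel)"
    using eq unfolding GG mult.commute[of _ "emeasure lborel _"] ennreal_mult_cancel_left by auto
  moreover have "(\<integral>\<^sup>+x. a (f x) \<partial>lborel) = emeasure (distr lborel borel f) A"
    using nn_integral_distr[of f lborel borel a] by (simp add: a_def)
  moreover have "(\<integral>\<^sup>+x. a x \<partial>lborel) = emeasure lborel A" by (simp add: a_def)
  ultimately show "emeasure (distr lborel borel f) A = emeasure lborel A" by simp
qed simp


section \<open>Local integrability of \<open>1 / \<bar>z\<bar>\<close> and of the logarithm\<close>

lemma emeasure_lborel_ball_complex: "r \<ge> 0 \<Longrightarrow> emeasure lborel (ball (c::complex) r)
    = ennreal (pi * r^2)"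
  by (simp add: emeasure_ball eval_unit_ball_vol)

lemma borel_measurable_ball_div_norm [measurable]:
  "(\<lambda>z::complex. indicator (ball 0 1) z / norm z :: real) \<in> borel_measurable borel"
  by (intro borel_measurable_divide borel_measurable_indicator) auto

text \<open>Dyadic annuli: where \<open>(1/2)^(k+1) \<le> \<bar>z\<bar> < (1/2)^k\<close> the
  integrand is at most \<open>2 * 2^k\<close>, while the disc of radius \<open>(1/2)^k\<close> has
  area \<open>pi / 4^k\<close>. The bound is a geometric series with ratio
  \<open>1/2\<close>.\<close>

lemma nn_integral_inverse_norm_ball:
  "(\<integral>\<^sup>+z. ennreal (indicator (ball 0 1) z / norm z) \<partial>(lborel :: complex measure)) < \<infinity>"
proof -
  have le: "ennreal (indicator (ball 0 1) z / norm z)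
      \<le> (\<Sum>k. ennreal (2 * 2^k) * indicator (ball 0 ((1/2)^k)) z)" for z :: complex
  proof (cases "z = 0 \<or> norm z \<ge> 1")
    case True
    then have "indicator (ball 0 1) z / norm z = (0::real)" by auto
    then show ?thesis by (simp only: ennreal_0 zero_le)
  next
    case False
    define k where "k = (LEAST j. (1/2)^Suc j \<le> norm z)"
    have ex: "\<exists>j. (1/2)^Suc j \<le> norm z"
    proof -
      obtain j where "(1/2::real)^j < norm z"
        using real_arch_pow_inv[of "norm z" "1/2"] False by auto
      moreover have "(1/2::real)^Suc j \<le> (1/2)^j" by (rule power_decreasing) auto
      ultimately have "(1/2::real)^Suc j \<le> norm z" by linarith
      then show ?thesis ..
    qed
    have k1: "(1/2)^Suc k \<le> norm z" unfolding k_def by (rule LeastI_ex[OF ex])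
    have k2: "norm z < (1/2)^k"
    proof (cases k)
      case 0 then show ?thesis using False by simp
    next
      case (Suc i)
      then have "\<not> (1/2)^Suc i \<le> norm z" unfolding k_def by (intro not_less_Least) simp
      with Suc show ?thesis by simp
    qed
    have "1 = 2 * 2^k * (1/2::real)^Suc k" by (simp add: power_divide)
    also have "\<dots> \<le> 2 * 2^k * norm z" by (rule mult_left_mono[OF k1]) simp
    finally have "1 / norm z \<le> 2 * 2^k"
      using False by (simp add: divide_le_eq)
    then have "ennreal (indicator (ball 0 1) z / norm z) \<le> ennreal (2 * 2^k) * indicator (ball 0
        ((1/2)^k)) z"
      using False k2 by (auto simp: indicator_def intro!: ennreal_leI)
    also have "\<dots> \<le> (\<Sum>k. ennreal (2 * 2^k) * indicator (ball 0 ((1/2)^k)) z)"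
      using ennreal_suminf_lessD[of "\<lambda>k. ennreal (2 * 2^k) * indicator (ball 0 ((1/2)^k)) z"]
      by (meson linorder_not_le order_less_irrefl)
    finally show ?thesis .
  qed
  have "(\<integral>\<^sup>+z. ennreal (indicator (ball 0 1) z / norm z) \<partial>(lborel :: complex measure))
      \<le> (\<integral>\<^sup>+z. (\<Sum>k. ennreal (2 * 2^k) * indicator (ball 0 ((1/2)^k)) z) \<partial>(lborel :: complex
          measure))"
    by (intro nn_integral_mono le)
  also have "\<dots> = (\<Sum>k. ennreal (2 * 2^k) * ennreal (pi * ((1/2)^k)^2))"
  proof (subst nn_integral_suminf)
    show "(\<lambda>z::complex. ennreal (2 * 2^i) * indicator (ball 0 ((1/2)^i)) z)
        \<in> borel_measurable lborel" for i
      by measurable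
  qed (simp add: nn_integral_cmult_indicator emeasure_lborel_ball_complex)
  also have "\<dots> = (\<Sum>k. ennreal (2 * pi * (1/2)^k))"
  proof (intro suminf_cong)
    fix k :: nat
    have "ennreal (2 * 2^k) * ennreal (pi * ((1/2)^k)^2) = ennreal ((2 * 2^k) * (pi * ((1/2)^k)^2))"
      by (rule ennreal_mult'[symmetric]) simp
    also have "(2 * 2^k) * (pi * ((1/2)^k)^2) = 2 * pi * (1/2)^k"
      by (simp add: power_divide power2_eq_square)
    finally show "ennreal (2 * 2^k) * ennreal (pi * ((1/2)^k)^2) = ennreal (2 * pi * (1/2)^k)" .
  qed
  also have "\<dots> < \<infinity>"
    by (subst suminf_ennreal_eq[OF _ sums_mult[OF geometric_sums]]) auto
  finally show ?thesis .
qed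

text \<open>The convention \<open>ln 0 = 0\<close> makes the value at \<open>u = 0\<close> equal to
  0 instead of infinity: the pole is seen near the point, not at it.\<close>

definition log_minus :: "complex \<Rightarrow> real" where
  "log_minus u = max 0 (- ln (norm u))"

lemma log_minus_nonneg [simp]: "log_minus u \<ge> 0"
  by (simp add: log_minus_def)

lemma log_minus_measurable [measurable]: "log_minus \<in> borel_measurable borel"
  unfolding log_minus_def by measurable

text \<open>This is \<open>ln r \<le> r - 1\<close> at \<open>r = 1 / \<bar>u\<bar>\<close>.
  Logarithms and logarithmic derivatives are thereby controlled by one and the same
  singularity.\<close>

lemma log_minus_le: "log_minus u \<le> indicator (ball 0 1) u / norm u"
proof (cases "u = 0 \<or> norm u \<ge> 1")
  case False
  then have "- ln (norm u) \<le> 1 / norm u"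
    using ln_le_minus_one[of "1 / norm u"] by (simp add: ln_div)
  then show ?thesis using False by (auto simp: log_minus_def indicator_def)
qed (auto simp: log_minus_def indicator_def)

lemma abs_ln_norm_le: "\<bar>ln (norm u)\<bar> \<le> norm u + log_minus u"
proof (cases "u = 0")
  case False
  then have "ln (norm u) \<le> norm u" using ln_le_minus_one[of "norm u"] by simp
  then show ?thesis by (simp add: log_minus_def abs_if max_def)
qed (auto simp: log_minus_def)

text \<open>Its value is \<open>2 * pi\<close>; the estimates only need a finite constant.\<close>

definition inv_norm_const :: real where
  "inv_norm_const = enn2real (\<integral>\<^sup>+z. ennreal (indicator (ball 0 1) z / norm z) \<partial>(lborel :: complex
      measure))"

lemma inv_norm_const_nonneg [simp]: "inv_norm_const \<ge> 0"
  by (simp add: inv_norm_const_def)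

lemma inv_norm_const_eq:
  "(\<integral>\<^sup>+z. ennreal (indicator (ball 0 1) (z - w) / norm (z - w)) \<partial>(lborel :: complex measure))
      = ennreal inv_norm_const"
  using nn_integral_lborel_translate[of "\<lambda>z. ennreal (indicator (ball 0 1) z / norm z)" "-w"]
    nn_integral_inverse_norm_ball by (simp add: inv_norm_const_def less_top)

lemma nn_integral_log_minus_le:
  "(\<integral>\<^sup>+z. ennreal (log_minus (z - w)) \<partial>lborel) \<le> ennreal inv_norm_const"
  unfolding inv_norm_const_eq[of w, symmetric]
  by (intro nn_integral_mono ennreal_leI log_minus_le)

text \<open>Later \<open>w\<close> runs over zeros of derivatives, about whose position nothing is
  known, so uniformity in \<open>w\<close> is essential. At distance 1 or more from \<open>w\<close>
  the integrand is at most 1.\<close>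

lemma nn_integral_inverse_norm_le:
  assumes [measurable]: "D \<in> sets borel"
  shows "(\<integral>\<^sup>+z. ennreal (inverse (norm (z - w))) * indicator D z \<partial>(lborel :: complex measure))
    \<le> ennreal inv_norm_const + emeasure lborel D"
proof -
  have "ennreal (inverse (norm (z - w))) * indicator D z
      \<le> ennreal (indicator (ball 0 1) (z - w) / norm (z - w)) + indicator D z" for z
  proof (cases "norm (z - w) < 1")
    case False
    then have "inverse (norm (z - w)) \<le> 1" by (simp add: inverse_le_1_iff)
    then have "ennreal (inverse (norm (z - w))) \<le> 1" by (simp add: ennreal_le_1)
    then show ?thesis using False by (auto simp: indicator_def)
  qed (auto simp: indicator_def field_simps)
  then have "(\<integral>\<^sup>+z. ennreal (inverse (norm (z - w))) * indicator D z \<partial>(lborel :: complex measure))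
    \<le> (\<integral>\<^sup>+z. ennreal (indicator (ball 0 1) (z - w) / norm (z - w)) + indicator D z \<partial>lborel)"
    by (intro nn_integral_mono)
  also have "\<dots> = ennreal inv_norm_const + emeasure lborel D"
    using measurable_compose[OF _ borel_measurable_ball_div_norm, of "\<lambda>z. z - w" lborel]
    by (subst nn_integral_add) (auto simp: inv_norm_const_eq)
  finally show ?thesis .
qed

text \<open>On the support, \<open>\<bar>ln \<bar>u\<bar>\<bar> \<le> \<bar>u\<bar> + log_minus
  u\<close> with \<open>u = z - w\<close>; the first term is at most
  \<open>R + \<bar>w\<bar>\<close> on a disc of area \<open>pi * R^2\<close>, the second costs a
  constant. The bound depends on \<open>w\<close> through its modulus only, which gives the
  integrability that Fubini's theorem requires later.\<close>

lemma nn_integral_potential_le: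
  fixes g :: "complex \<Rightarrow> real"
  assumes [measurable]: "g \<in> borel_measurable borel"
    and B: "\<And>z. \<bar>g z\<bar> \<le> B" and R: "\<And>z. norm z \<ge> R \<Longrightarrow> g z = 0" and "R \<ge> 0"
  shows "(\<integral>\<^sup>+z. ennreal (norm (g z * ln (norm (z - w)))) \<partial>lborel)
    \<le> ennreal (B * ((R + norm w) * (pi * R^2) + inv_norm_const))"
proof -
  have B0: "B \<ge> 0" using B[of 0] by linarith
  have em: "emeasure lborel (ball (0::complex) R) = ennreal (pi * R^2)"
    by (rule emeasure_lborel_ball_complex[OF \<open>R \<ge> 0\<close>])
  have "norm (g z * ln (norm (z - w))) \<le> B * (R + norm w) * indicator (ball 0 R) z + B * log_minus
      (z - w)" for z
  proof (cases "norm z < R")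
    case True
    have "\<bar>ln (norm (z - w))\<bar> \<le> norm (z - w) + log_minus (z - w)" by (rule abs_ln_norm_le)
    also have "\<dots> \<le> (R + norm w) + log_minus (z - w)" using norm_triangle_ineq4[of z w] True by simp
    finally have "\<bar>g z\<bar> * \<bar>ln (norm (z - w))\<bar> \<le> B * ((R + norm w) + log_minus (z - w))"
      by (intro mult_mono B B0) auto
    then show ?thesis using True by (simp add: abs_mult algebra_simps)
  next
    case False then show ?thesis using R[of z] B0 by (simp add: indicator_def)
  qed
  then have "(\<integral>\<^sup>+z. ennreal (norm (g z * ln (norm (z - w)))) \<partial>lborel)
     \<le> (\<integral>\<^sup>+z. ennreal (B * (R + norm w)) * indicator (ball 0 R) z + ennreal B * ennreal (log_minus
         (z - w)) \<partial>lborel)"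
  proof (intro nn_integral_mono)
    fix z
    assume le: "\<And>z. norm (g z * ln (norm (z - w))) \<le> B * (R + norm w) * indicator (ball 0 R) z + B
        * log_minus (z - w)"
    have "ennreal (norm (g z * ln (norm (z - w)))) \<le> ennreal (B * (R + norm w) * indicator (ball 0
        R) z + B * log_minus (z - w))"
      by (rule ennreal_leI[OF le])
    also have "\<dots> = ennreal (B * (R + norm w)) * indicator (ball 0 R) z + ennreal B * ennreal
        (log_minus (z - w))"
      using B0 \<open>R \<ge> 0\<close> by (subst ennreal_plus) (auto simp: ennreal_mult' ennreal_indicator)
    finally show "ennreal (norm (g z * ln (norm (z - w)))) \<le> \<dots>" .
  qed
  also have "\<dots> = ennreal (B * (R + norm w)) * ennreal (pi * R^2) + ennreal B * (\<integral>\<^sup>+z. ennreal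
      (log_minus (z - w)) \<partial>lborel)"
    by (subst nn_integral_add) (measurable, simp add: nn_integral_cmult
        nn_integral_cmult_indicator em)
  also have "\<dots> \<le> ennreal (B * (R + norm w)) * ennreal (pi * R^2) + ennreal B * ennreal
      inv_norm_const"
    by (intro add_mono mult_left_mono nn_integral_log_minus_le) auto
  also have "\<dots> = ennreal (B * ((R + norm w) * (pi * R^2) + inv_norm_const))"
  proof -
    have "ennreal (B * K) * ennreal x + ennreal B * ennreal y = ennreal (B * (K * x + y))"
      if "K \<ge> 0" "x \<ge> 0" "y \<ge> 0" for K x y
      using B0 that by (simp add: ennreal_mult distrib_left mult.assoc)
    then show ?thesis using \<open>R \<ge> 0\<close> by simp
  qed
  finally show ?thesis .
qed

lemma integrable_potential:
  fixes g :: "complex \<Rightarrow> real"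
  assumes "g \<in> borel_measurable borel"
    and "\<And>z. \<bar>g z\<bar> \<le> B" and "\<And>z. norm z \<ge> R \<Longrightarrow> g z = 0" and "R \<ge> 0"
  shows "integrable lborel (\<lambda>z. g z * ln (norm (z - w)))"
proof (rule integrableI_bounded)
  show "(\<lambda>z. g z * ln (norm (z - w))) \<in> borel_measurable lborel" using assms(1) by measurable
  show "(\<integral>\<^sup>+z. ennreal (norm (g z * ln (norm (z - w)))) \<partial>lborel) < \<infinity>"
    unfolding infinity_ennreal_def
    by (rule order.strict_trans1[OF nn_integral_potential_le[OF assms, of w] ennreal_less_top])
qed


section \<open>Approximation by logarithmic potentials\<close>

text \<open>The mean value property: \<open>Ln (1 - c * z)\<close> is holomorphic on the closed unit
  disc, because \<open>1 - c * z\<close> has positive real part there, and it vanishes at 0.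
  Cauchy's integral formula at the centre gives mean 0 on the circle; the claim is its real
  part.\<close>

lemma has_integral_ln_norm_circle:
  fixes c :: complex
  assumes c: "norm c < 1"
  shows "((\<lambda>t. ln (norm (1 - c * cis (2 * pi * t)))) has_integral 0) {0..1}"
proof -
  define f where "f = (\<lambda>z. Ln (1 - c * z))"
  have nz: "1 - c * z \<notin> \<real>\<^sub>\<le>\<^sub>0" if "z \<in> cball 0 1" for z
  proof -
    have "norm (c * z) < 1"
      using c that by (simp add: norm_mult) (meson le_less_trans mult_left_le norm_ge_zero)
    then have "Re (c * z) < 1" using complex_Re_le_cmod[of "c * z"] by linarith
    then show ?thesis by (auto simp: complex_nonpos_Reals_iff)
  qed
  have hol: "f holomorphic_on cball 0 1"
    unfolding f_def using nz by (intro holomorphic_intros) auto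
  have "((\<lambda>u. f u / (u - 0)) has_contour_integral (2 * of_real pi * \<i> * f 0)) (circlepath 0 1)"
    by (rule Cauchy_integral_circlepath_simple[OF hol]) simp
  then have "((\<lambda>t. f (circlepath 0 1 t) / circlepath 0 1 t * vector_derivative (circlepath 0 1)
      (at t within {0..1})) has_integral 0) {0..1}"
    by (simp add: has_contour_integral_def f_def)
  then have "((\<lambda>t. 2 * pi * \<i> * f (cis (2 * pi * t))) has_integral 0) {0..1}"
  proof (rule has_integral_eq[rotated])
    fix t :: real assume "t \<in> {0..1}"
    then show "f (circlepath 0 1 t) / circlepath 0 1 t * vector_derivative (circlepath 0 1) (at t
        within {0..1})
        = 2 * pi * \<i> * f (cis (2 * pi * t))"
      by (subst vector_derivative_circlepath01) (auto simp: circlepath cis_conv_exp mult_ac)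
  qed
  from has_integral_mult_right[OF this, of "1 / (2 * pi * \<i>)"]
  have "((\<lambda>t. 1 / (2 * pi * \<i>) * (2 * pi * \<i> * f (cis (2 * pi * t)))) has_integral 0) {0..1}"
    by (simp only: mult_zero_right)
  then have "((\<lambda>t. f (cis (2 * pi * t))) has_integral 0) {0..1}"
    by (rule back_subst[of "\<lambda>g. (g has_integral 0) {0..1}"]) (auto simp: fun_eq_iff)
  then have "((\<lambda>t. Re (f (cis (2 * pi * t)))) has_integral 0) {0..1}"
    by (drule_tac has_integral_Re) simp
  then show ?thesis
  proof (rule has_integral_eq[rotated])
    fix t :: real
    have "1 - c * cis (2 * pi * t) \<noteq> 0" using nz[of "cis (2 * pi * t)"] by auto
    then show "Re (f (cis (2 * pi * t))) = ln (norm (1 - c * cis (2 * pi * t)))"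
      by (simp add: f_def)
  qed
qed

text \<open>Newton's theorem in the plane: a uniformly charged circle acts outside like a charge at
  its centre, and its potential inside is constant. Factoring out the larger of \<open>z\<close> and
  \<open>w\<close> leaves \<open>1 - c * cis s\<close> with \<open>\<bar>c\<bar> < 1\<close>. Equal
  moduli would put the logarithmic pole on the path.\<close>

lemma integral_ln_norm_circle:
  fixes z w :: complex
  assumes ne: "norm z \<noteq> norm w"
  shows "(\<integral>t. indicator {0..1} t * ln (norm (z - cis (2 * pi * t) * w)) \<partial>lborel)
      = ln (max (norm z) (norm w))"
proof -
  have hi: "((\<lambda>t. ln (norm (z - cis (2 * pi * t) * w))) has_integral ln (max (norm z) (norm w)))
      {0..1}"
  proof (cases "norm w < norm z")
    case True
    then have z: "z \<noteq> 0" by auto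
    have c: "norm (w / z) < 1" using True z by (simp add: norm_divide)
    have "((\<lambda>t. ln (norm z) + ln (norm (1 - w / z * cis (2 * pi * t)))) has_integral ln (norm z)
        + 0) {0..1}"
      using has_integral_const_real[of "ln (norm z)" 0 1]
      by (intro has_integral_add has_integral_ln_norm_circle c) simp
    then have "((\<lambda>t. ln (norm (z - cis (2 * pi * t) * w))) has_integral ln (norm z) + 0) {0..1}"
    proof (rule has_integral_eq[rotated])
      fix t :: real
      have "norm (w / z * cis (2 * pi * t)) < 1" using c by (simp add: norm_mult norm_divide)
      then have "1 - w / z * cis (2 * pi * t) \<noteq> 0" by auto
      then have "ln (norm z) + ln (norm (1 - w / z * cis (2 * pi * t)))
          = ln (norm (z * (1 - w / z * cis (2 * pi * t))))"
        using z by (simp add: norm_mult ln_mult)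
      also have "z * (1 - w / z * cis (2 * pi * t)) = z - cis (2 * pi * t) * w"
        using z by (simp add: field_simps)
      finally show "ln (norm z) + ln (norm (1 - w / z * cis (2 * pi * t)))
          = ln (norm (z - cis (2 * pi * t) * w))" .
    qed
    then show ?thesis using True by (simp add: max_def)
  next
    case False
    with ne have lt: "norm z < norm w" by simp
    then have w: "w \<noteq> 0" by auto
    \<comment> \<open>Factoring out \<open>w\<close> leaves a \<open>cis\<close> with negative
      angle; conjugation restores the sign and preserves the modulus.\<close>
    define c where "c = cnj (z / w)"
    have c: "norm c < 1" using lt w by (simp add: norm_divide c_def)
    have "((\<lambda>t. ln (norm w) + ln (norm (1 - c * cis (2 * pi * t)))) has_integral ln (norm w)
        + 0) {0..1}"
      using has_integral_const_real[of "ln (norm w)" 0 1]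
      by (intro has_integral_add has_integral_ln_norm_circle c) simp
    then have "((\<lambda>t. ln (norm (z - cis (2 * pi * t) * w))) has_integral ln (norm w) + 0) {0..1}"
    proof (rule has_integral_eq[rotated])
      fix t :: real
      have "norm (c * cis (2 * pi * t)) < 1" using c by (simp add: norm_mult)
      then have "1 - c * cis (2 * pi * t) \<noteq> 0" by auto
      then have "ln (norm w) + ln (norm (1 - c * cis (2 * pi * t)))
          = ln (norm w * norm (1 - c * cis (2 * pi * t)))"
        using w by (simp add: ln_mult)
      moreover have "norm (1 - c * cis (2 * pi * t)) = norm (1 - z / w * cis (- (2 * pi * t)))"
        unfolding complex_mod_cnj[of "1 - c * cis (2 * pi * t)", symmetric]
            by (simp add: c_def cis_cnj)
      moreover have "norm w * norm (1 - z / w * cis (- (2 * pi * t)))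
          = norm (- cis (2 * pi * t) * w * (1 - z / w * cis (- (2 * pi * t))))"
        by (simp add: norm_mult)
      moreover have "- cis (2 * pi * t) * w * (1 - z / w * cis (- (2 * pi * t)))
          = cis (2 * pi * t) * cis (- (2 * pi * t)) * z - cis (2 * pi * t) * w"
        using w by (simp add: field_simps del: cis_mult cis_cnj)
      moreover have "cis (2 * pi * t) * cis (- (2 * pi * t)) = 1" by (simp add: cis_mult)
      ultimately show "ln (norm w) + ln (norm (1 - c * cis (2 * pi * t)))
          = ln (norm (z - cis (2 * pi * t) * w))"
        by (simp only: mult_1_left)
    qed
    then show ?thesis using lt by (simp add: max_def)
  qed
  have cont: "continuous_on {0..1} (\<lambda>t. ln (norm (z - cis (2 * pi * t) * w)))"
  proof (intro continuous_intros)
    show "\<forall>t\<in>{0..1}. norm (z - cis (2 * pi * t) * w) \<noteq> 0"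
      using ne by (auto simp: norm_mult)
  qed
  have "set_integrable lborel {0..1} (\<lambda>t. ln (norm (z - cis (2 * pi * t) * w)))"
    by (rule borel_integrable_atLeastAtMost'[OF cont])
  from set_borel_integral_eq_integral(2)[OF this] hi
  show ?thesis
    by (simp add: set_lebesgue_integral_def integral_unique)
qed

text \<open>The kernel is radial with mean zero, so its logarithmic potential \<open>bump\<close> vanishes outside
  the disc of radius \<open>\<delta>\<close>; convolving with it turns a test function into a potential.\<close>

definition kernel :: "real \<Rightarrow> complex \<Rightarrow> real" where
  "kernel \<delta> z = indicator (ball 0 \<delta>) z - 4 * indicator (ball 0 (\<delta> / 2)) z"

definition bump :: "real \<Rightarrow> complex \<Rightarrow> real" where
  "bump \<delta> w = (\<integral>z. kernel \<delta> z * ln (norm (z - w)) \<partial>lborel)"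

lemma kernel_measurable [measurable]: "kernel \<delta> \<in> borel_measurable borel"
  unfolding kernel_def by measurable

lemma kernel_bound: "\<bar>kernel \<delta> z\<bar> \<le> 4"
  by (auto simp: kernel_def indicator_def)

lemma kernel_eq_0: "norm z \<ge> \<delta> \<Longrightarrow> \<delta> > 0 \<Longrightarrow> kernel \<delta> z = 0"
  by (auto simp: kernel_def)

lemma kernel_rotate: "norm a = norm b \<Longrightarrow> kernel \<delta> a = kernel \<delta> b"
  by (auto simp: kernel_def indicator_def)

lemma measure_lborel_ball_complex: "r \<ge> 0 \<Longrightarrow> measure lborel (ball (c::complex) r) = pi * r^2"
  by (simp add: measure_def emeasure_ball eval_unit_ball_vol)

lemma integrable_indicator_ball_complex: "integrable lborel (indicator (ball (c::complex) r) ::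
    complex \<Rightarrow> real)"
  by (cases "r \<ge> 0") (auto intro!: integrable_real_indicator simp: emeasure_lborel_ball_complex
      ball_empty)

lemma integrable_kernel: "integrable lborel (kernel \<delta>)"
  unfolding kernel_def
  by (intro Bochner_Integration.integrable_diff integrable_mult_right
      integrable_indicator_ball_complex)

text \<open>The weight 4 in \<open>kernel\<close> is the ratio of the areas of the two
  discs.\<close>

lemma integral_kernel: "\<delta> > 0 \<Longrightarrow> (\<integral>z. kernel \<delta> z \<partial>lborel) = 0"
  unfolding kernel_def
  by (subst Bochner_Integration.integral_diff)
    (auto intro!: integrable_mult_right integrable_indicator_ball_complex
      simp: measure_lborel_ball_complex power2_eq_square)

lemma orthogonal_transformation_cis: "orthogonal_transformation ((*) (cis t))"
  unfolding orthogonal_transformation by (auto simp: norm_mult intro: bounded_linear.linear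
      bounded_linear_mult_right)

text \<open>A rotation of the variable of integration preserves both Lebesgue measure and the radial
  kernel, so it can be transferred to \<open>w\<close>.\<close>

lemma bump_rotate: "bump \<delta> w = (\<integral>z. kernel \<delta> z * ln (norm (z - cis t * w)) \<partial>lborel)"
proof -
  have "bump \<delta> w = (\<integral>z. kernel \<delta> z * ln (norm (z - w)) \<partial>distr lborel borel ((*) (cis (- t))))"
    unfolding bump_def by (simp add: distr_lborel_orthogonal[OF orthogonal_transformation_cis])
  also have "\<dots> = (\<integral>z. kernel \<delta> (cis (- t) * z) * ln (norm (cis (- t) * z - w)) \<partial>lborel)"
    by (subst integral_distr) auto
  also have "\<dots> = (\<integral>z. kernel \<delta> z * ln (norm (z - cis t * w)) \<partial>lborel)"
  proof (rule Bochner_Integration.integral_cong)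
    fix z
    have "norm (cis (- t) * z - w) = norm (cis t * (cis (- t) * z - w))"
      by (simp add: norm_mult)
    also have "cis t * (cis (- t) * z - w) = (cis t * cis (- t)) * z - cis t * w"
      by (simp add: algebra_simps del: cis_mult)
    also have "cis t * cis (- t) = 1" by (simp add: cis_mult)
    finally have "norm (cis (- t) * z - w) = norm (z - cis t * w)" by simp
    moreover have "kernel \<delta> (cis (- t) * z) = kernel \<delta> z"
      by (rule kernel_rotate) (simp add: norm_mult)
    ultimately show "kernel \<delta> (cis (- t) * z) * ln (norm (cis (- t) * z - w))
        = kernel \<delta> z * ln (norm (z - cis t * w))"
      by simp
  qed simp
  finally show ?thesis .
qed

text \<open>Average the rotated formula over a full turn and exchange the integrals: the logarithm
  is replaced by its mean over a circle, which is explicit off the null set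
  \<open>\<bar>z\<bar> = \<bar>w\<bar>\<close>.\<close>

lemma bump_eq:
  assumes d: "\<delta> > 0"
  shows "bump \<delta> w = (\<integral>z. kernel \<delta> z * ln (max (norm z) (norm w)) \<partial>lborel)"
proof -
  define F where "F = (\<lambda>(t::real, z). indicator {0..1} t * (kernel \<delta> z * ln (norm (z - cis (2 * pi
      * t) * w))))"
  have [measurable]: "(\<lambda>t::real. cis (2 * pi * t)) \<in> borel_measurable borel"
    by (intro borel_measurable_continuous_onI continuous_intros)
  have [measurable]: "F \<in> borel_measurable (lborel \<Otimes>\<^sub>M lborel)"
    unfolding F_def by measurable
  \<comment> \<open>The potential bound with \<open>B = 4\<close> and \<open>R = \<delta>\<close>;
    as \<open>cis (2 * pi * t) * w\<close> has the modulus of \<open>w\<close>, one constant serves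
    all \<open>t\<close>.\<close>
  define C where "C = 4 * ((\<delta> + norm w) * (pi * \<delta>^2) + inv_norm_const)"
  have le: "(\<integral>\<^sup>+z. ennreal (norm (F (t, z))) \<partial>lborel) \<le> ennreal C * indicator {0..1} t" for t
  proof (cases "t \<in> {0..1}")
    case True
    then show ?thesis
      using nn_integral_potential_le[OF kernel_measurable kernel_bound kernel_eq_0[OF _ d], where
          w = "cis (2 * pi * t) * w"] d
      by (simp add: F_def C_def norm_mult)
  qed (simp add: F_def)
  have int: "integrable (lborel \<Otimes>\<^sub>M lborel) F"
  proof (rule integrableI_bounded)
    have "(\<integral>\<^sup>+x. ennreal (norm (F x)) \<partial>(lborel \<Otimes>\<^sub>M lborel))
        = (\<integral>\<^sup>+t. \<integral>\<^sup>+z. ennreal (norm (F (t, z))) \<partial>lborel \<partial>lborel)"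
      by (rule lborel.nn_integral_fst[symmetric]) measurable
    also have "\<dots> \<le> (\<integral>\<^sup>+t. ennreal C * indicator {0..1} t \<partial>(lborel :: real measure))"
      by (intro nn_integral_mono le)
    also have "\<dots> = ennreal C" by (simp add: nn_integral_cmult_indicator)
    finally show "(\<integral>\<^sup>+x. ennreal (norm (F x)) \<partial>(lborel \<Otimes>\<^sub>M lborel)) < \<infinity>"
      unfolding infinity_ennreal_def using ennreal_less_top by (rule order.strict_trans1)
  qed measurable
  have "bump \<delta> w = (\<integral>t. indicator {0..1} t * bump \<delta> w \<partial>(lborel :: real measure))" by simp
  also have "\<dots> = (\<integral>t. (\<integral>z. F (t, z) \<partial>lborel) \<partial>lborel)"
    unfolding F_def by (simp add: bump_rotate[symmetric])
  also have "\<dots> = (\<integral>z. (\<integral>t. F (t, z) \<partial>lborel) \<partial>lborel)"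
    using lborel_pair.Fubini_integral[of "\<lambda>t z. F (t, z)"] int by simp
  also have "\<dots> = (\<integral>z. kernel \<delta> z * ln (max (norm z) (norm w)) \<partial>lborel)"
  proof (rule integral_cong_AE)
    have "sphere (0::complex) (norm w) \<in> null_sets lborel"
      using negligible_sphere[of "0::complex" "norm w"]
      by (simp add: negligible_iff_null_sets null_sets_completion_iff)
    then have "AE z in lborel. z \<notin> sphere (0::complex) (norm w)" by (rule AE_not_in)
    then show "AE z in lborel. (\<integral>t. F (t, z) \<partial>lborel) = kernel \<delta> z * ln (max (norm z) (norm w))"
    proof eventually_elim
      case (elim z)
      then have "norm z \<noteq> norm w" by simp
      then show ?case
        using integral_ln_norm_circle[of z w] by (simp add: F_def mult.left_commute)
    qed
  qed measurable
  finally show ?thesis .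
qed

lemma bump_measurable [measurable]: "bump \<delta> \<in> borel_measurable borel"
  unfolding bump_def by measurable

lemma integrable_kernel_ln_max:
  assumes "\<delta> > 0"
  shows "integrable lborel (\<lambda>z. kernel \<delta> z * ln (max (norm z) (norm w)))"
proof (rule Bochner_Integration.integrable_bound)
  show "integrable lborel (\<lambda>z. \<bar>kernel \<delta> z * ln (norm (z - 0))\<bar> + (\<bar>ln (norm w)\<bar>) * \<bar>kernel \<delta> z\<bar>)"
    by (intro Bochner_Integration.integrable_add integrable_abs integrable_mult_right
        integrable_kernel
        integrable_potential[OF kernel_measurable kernel_bound kernel_eq_0]) (use assms in auto)
  show "AE z in lborel. norm (kernel \<delta> z * ln (max (norm z) (norm w)))
      \<le> norm (\<bar>kernel \<delta> z * ln (norm (z - 0))\<bar> + \<bar>ln (norm w)\<bar> * \<bar>kernel \<delta> z\<bar>)"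
    by (auto simp: abs_mult max_def)
qed measurable

lemma bump_eq_0:
  assumes "\<delta> > 0" "norm w \<ge> \<delta>"
  shows "bump \<delta> w = 0"
proof -
  have "bump \<delta> w = (\<integral>z. kernel \<delta> z * ln (norm w) \<partial>lborel)"
    unfolding bump_eq[OF assms(1)]
  proof (rule Bochner_Integration.integral_cong)
    fix z show "kernel \<delta> z * ln (max (norm z) (norm w)) = kernel \<delta> z * ln (norm w)"
      using assms kernel_eq_0[of \<delta> z] by (cases "norm z \<ge> \<delta>") (auto simp: max_def)
  qed simp
  then show ?thesis using integral_kernel[OF assms(1)] by simp
qed

text \<open>Since the kernel has mean zero, a constant may be subtracted from the logarithm; the
  constant \<open>ln (max (\<delta>/2) (norm w))\<close> makes the integrand nonnegative, because the kernel changes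
  sign at radius \<open>\<delta>/2\<close>.\<close>

lemma bump_ge:
  assumes d: "\<delta> > 0" and c: "c \<le> ln (3 / 2)" "c = 0 \<or> norm w \<le> \<delta> / 2"
  shows "bump \<delta> w \<ge> c * (7 / 16 * pi * \<delta>^2)"
proof -
  let ?h = "\<lambda>z. kernel \<delta> z * (ln (max (norm z) (norm w)) - ln (max (\<delta> / 2) (norm w)))"
  have int: "integrable lborel ?h"
    using integrable_kernel_ln_max[OF d, of w] integrable_kernel
    by (simp add: right_diff_distrib)
  have "bump \<delta> w = (\<integral>z. ?h z \<partial>lborel)"
    unfolding bump_eq[OF d] right_diff_distrib
    using integrable_kernel_ln_max[OF d, of w] integrable_kernel integral_kernel[OF d] by simp
  \<comment> \<open>Only the annulus between the radii \<open>3 / 4 * \<delta>\<close> and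
    \<open>\<delta>\<close> is kept. For \<open>\<bar>w\<bar> \<le> \<delta> / 2\<close> the
    difference of logarithms is at least \<open>ln (3 / 2)\<close> there, since \<open>3 / 4\<close>
    is \<open>3 / 2\<close> times \<open>1 / 2\<close>. The area of the annulus accounts for
    \<open>7 / 16 = 1 - 9 / 16\<close>. Taking \<open>c = 0\<close> yields nonnegativity for every
    \<open>w\<close>.\<close>
  moreover have "(\<integral>z. c * (indicator (ball 0 \<delta>) z - indicator (ball 0 (3 / 4 * \<delta>)) z) \<partial>(lborel ::
      complex measure)) \<le> (\<integral>z. ?h z \<partial>lborel)"
  proof (rule integral_mono_AE)
    show "integrable lborel (\<lambda>z::complex. c * (indicator (ball 0 \<delta>) z - indicator (ball 0 (3 / 4
        * \<delta>)) z))"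
      by (intro integrable_mult_right Bochner_Integration.integrable_diff
          integrable_indicator_ball_complex)
    \<comment> \<open>The origin is left out because for \<open>w = 0\<close> it would lead to
      \<open>ln 0 = 0\<close>, which breaks monotonicity of the logarithm.\<close>
    show "AE z in lborel. c * (indicator (ball 0 \<delta>) z - indicator (ball 0 (3 / 4 * \<delta>)) z) \<le> ?h z"
      using AE_lborel_singleton[of "0::complex"]
    proof eventually_elim
      case (elim z)
      consider "norm z < \<delta> / 2" | "norm z \<ge> \<delta> / 2" "norm z < 3 / 4 * \<delta>"
        | "norm z \<ge> 3 / 4 * \<delta>" "norm z < \<delta>" | "norm z \<ge> \<delta>" by linarith
      then show ?case
      proof cases
        \<comment> \<open>Here the kernel is \<open>1 - 4 = -3\<close>, and the difference of
          logarithms is at most 0.\<close>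
        case 1
        have "max (norm z) (norm w) \<le> max (\<delta> / 2) (norm w)" "0 < max (norm z) (norm w)"
          using 1 elim by (auto simp: less_max_iff_disj)
        then have "ln (max (norm z) (norm w)) \<le> ln (max (\<delta> / 2) (norm w))"
          by (meson ln_le_cancel_iff order.strict_trans2)
        then show ?thesis using 1 d by (simp add: kernel_def)
      next
        case 2
        have "max (\<delta> / 2) (norm w) \<le> max (norm z) (norm w)" "0 < max (\<delta> / 2) (norm w)"
          using 2 d by auto
        then have "ln (max (\<delta> / 2) (norm w)) \<le> ln (max (norm z) (norm w))"
          by (meson ln_le_cancel_iff order.strict_trans2)
        then show ?thesis using 2 d by (simp add: kernel_def)
      next
        case 3
        have "c \<le> ln (max (norm z) (norm w)) - ln (max (\<delta> / 2) (norm w))"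
          using c(2)
        proof
          assume "c = 0"
          have "max (\<delta> / 2) (norm w) \<le> max (norm z) (norm w)" "0 < max (\<delta> / 2) (norm w)"
            using 3 d by auto
          then have "ln (max (\<delta> / 2) (norm w)) \<le> ln (max (norm z) (norm w))"
            by (meson ln_le_cancel_iff order.strict_trans2)
          with \<open>c = 0\<close> show ?thesis by simp
        next
          assume w: "norm w \<le> \<delta> / 2"
          have "ln (3 / 2 * (\<delta> / 2)) \<le> ln (norm z)" using 3 d by (subst ln_le_cancel_iff) auto
          then have "ln (3 / 2) \<le> ln (norm z) - ln (\<delta> / 2)"
            using d by (subst (asm) ln_mult) auto
          moreover have "max (norm z) (norm w) = norm z" "max (\<delta> / 2) (norm w) = \<delta> / 2"
            using w 3 d by auto
          ultimately show ?thesis using c(1) by simp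
        qed
        then show ?thesis using 3 d by (simp add: kernel_def)
      next
        case 4
        then show ?thesis using d by (simp add: kernel_def)
      qed
    qed
  qed (rule int)
  moreover have "(\<integral>z. c * (indicator (ball 0 \<delta>) z - indicator (ball 0 (3 / 4 * \<delta>)) z) \<partial>(lborel ::
      complex measure)) = c * (7 / 16 * pi * \<delta>^2)"
  proof -
    have "(\<integral>z. indicator (ball 0 \<delta>) z - indicator (ball 0 (3 / 4 * \<delta>)) z \<partial>(lborel :: complex
        measure)) = pi * \<delta>^2 - pi * (3 / 4 * \<delta>)^2"
      using d by (subst Bochner_Integration.integral_diff)
        (auto simp: integrable_indicator_ball_complex measure_lborel_ball_complex)
    also have "\<dots> = 7 / 16 * pi * \<delta>^2" by (simp add: power2_eq_square field_simps)
    finally show ?thesis by simp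
  qed
  ultimately show ?thesis by linarith
qed

lemma bump_nonneg: "\<delta> > 0 \<Longrightarrow> bump \<delta> w \<ge> 0"
  using bump_ge[of \<delta> 0 w] by simp

lemma bump_le:
  assumes d: "\<delta> > 0"
  shows "bump \<delta> w \<le> 4 * (2 * \<delta> * (pi * \<delta>^2) + inv_norm_const) * indicator (ball 0 \<delta>) w"
proof (cases "norm w < \<delta>")
  case False then show ?thesis using bump_eq_0[OF d, of w] by simp
next
  case True
  have "ennreal (bump \<delta> w) \<le> (\<integral>\<^sup>+z. ennreal (norm (kernel \<delta> z * ln (norm (z - w)))) \<partial>lborel)"
    unfolding bump_def
    by (rule order_trans[OF ennreal_leI[OF abs_ge_self]])
      (use integral_norm_bound_ennreal[OF integrable_potential[OF kernel_measurable kernel_bound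
          kernel_eq_0[OF _ d]]] d in auto)
  also have "\<dots> \<le> ennreal (4 * ((\<delta> + norm w) * (pi * \<delta>^2) + inv_norm_const))"
    using nn_integral_potential_le[OF kernel_measurable kernel_bound kernel_eq_0[OF _ d], where w
        = w] d by simp
  also have "\<dots> \<le> ennreal (4 * (2 * \<delta> * (pi * \<delta>^2) + inv_norm_const))"
    using True d by (intro ennreal_leI mult_left_mono add_mono mult_right_mono) auto
  finally have "bump \<delta> w \<le> 4 * (2 * \<delta> * (pi * \<delta>^2) + inv_norm_const)"
    using d by (subst (asm) ennreal_le_iff) auto
  then show ?thesis using True by simp
qed

lemma integrable_bump:
  assumes d: "\<delta> > 0"
  shows "integrable lborel (bump \<delta>)"
proof (rule Bochner_Integration.integrable_bound)
  show "integrable lborel (\<lambda>w::complex. 4 * (2 * \<delta> * (pi * \<delta>^2) + inv_norm_const) * indicator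
      (ball 0 \<delta>) w)"
    by (intro integrable_mult_right integrable_indicator_ball_complex)
  show "AE w in lborel. norm (bump \<delta> w) \<le> norm (4 * (2 * \<delta> * (pi * \<delta>^2) + inv_norm_const)
      * indicator (ball 0 \<delta>) w)"
    using bump_le[OF d] bump_nonneg[OF d] by (auto intro: order_trans[OF _ abs_ge_self])
qed measurable

lemma integral_bump_pos:
  assumes d: "\<delta> > 0"
  shows "(\<integral>w. bump \<delta> w \<partial>lborel) > 0"
proof -
  define c where "c = ln (3 / 2) * (7 / 16 * pi * \<delta>^2)"
  have "c > 0" using d by (simp add: c_def)
  have "(\<integral>w. c * indicator (ball 0 (\<delta> / 2)) w \<partial>(lborel :: complex measure))
      \<le> (\<integral>w. bump \<delta> w \<partial>lborel)"
    using bump_ge[OF d, of "ln (3 / 2)"] bump_nonneg[OF d]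
    by (intro integral_mono integrable_mult_right integrable_indicator_ball_complex
        integrable_bump d)
      (auto simp: c_def indicator_def)
  moreover have "(\<integral>w. c * indicator (ball 0 (\<delta> / 2)) w \<partial>(lborel :: complex measure)) > 0"
    using d \<open>c > 0\<close> by (simp add: measure_lborel_ball_complex)
  ultimately show ?thesis by linarith
qed

text \<open>Normalised to mass 1, \<open>bump \<delta>\<close> is a nonnegative mollifier supported
  in the disc of radius \<open>\<delta>\<close>, so convolving \<open>\<phi>\<close> with it changes
  \<open>\<phi>\<close> by at most its oscillation at scale \<open>\<delta>\<close>. As
  \<open>bump \<delta>\<close> is the potential of \<open>kernel \<delta>\<close>, this convolution
  is the potential of the convolution of \<open>\<phi>\<close> with \<open>kernel \<delta>\<close>.
  No derivative of \<open>\<phi>\<close> is taken.\<close>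

lemma log_potential_approx:
  fixes \<phi> :: "complex \<Rightarrow> real"
  assumes cont: "continuous_on UNIV \<phi>" and R: "\<And>z. norm z \<ge> R \<Longrightarrow> \<phi> z = 0" and "R > 0" and "\<epsilon> > 0"
  obtains G R' B where "G \<in> borel_measurable borel" "R' \<ge> 0" "\<And>z. \<bar>G z\<bar> \<le> B"
    "\<And>z. norm z \<ge> R' \<Longrightarrow> G z = 0"
    "\<And>w. \<bar>\<phi> w - (\<integral>z. G z * ln (norm (z - w)) \<partial>lborel)\<bar> \<le> \<epsilon>"
proof -
  have [measurable]: "\<phi> \<in> borel_measurable borel"
    using cont by (rule borel_measurable_continuous_onI)
  have "uniformly_continuous_on (cball 0 (R + 1)) \<phi>"
    by (intro compact_uniformly_continuous continuous_on_subset[OF cont]) auto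
  then obtain \<delta>0 where \<delta>0: "\<delta>0 > 0"
    "\<And>a b. a \<in> cball 0 (R + 1) \<Longrightarrow> b \<in> cball 0 (R + 1) \<Longrightarrow> dist b a < \<delta>0 \<Longrightarrow> dist (\<phi> b) (\<phi> a) < \<epsilon>"
    unfolding uniformly_continuous_on_def using \<open>\<epsilon> > 0\<close> by metis
  \<comment> \<open>With \<open>\<delta> \<le> 1\<close>, if one of \<open>w\<close> and
    \<open>w - b\<close> leaves the disc of radius \<open>R + 1\<close>, then both have modulus at
    least \<open>R\<close>, where \<open>\<phi>\<close> vanishes; otherwise uniform continuity on
    that disc applies.\<close>
  define \<delta> where "\<delta> = min \<delta>0 1"
  have d: "\<delta> > 0" "\<delta> \<le> 1" "\<delta> \<le> \<delta>0" using \<delta>0 by (auto simp: \<delta>_def)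
  have uc: "\<bar>\<phi> w - \<phi> (w - b)\<bar> \<le> \<epsilon>" if "norm b < \<delta>" for w b
  proof (cases "w \<in> cball 0 (R + 1) \<and> w - b \<in> cball 0 (R + 1)")
    case True
    then have "dist (\<phi> w) (\<phi> (w - b)) < \<epsilon>"
      using that d by (intro \<delta>0(2)) (auto simp: dist_norm)
    then show ?thesis by (simp add: dist_real_def)
  next
    case False
    moreover have "norm w \<le> norm (w - b) + norm b" "norm (w - b) \<le> norm w + norm b"
      using norm_triangle_ineq[of "w - b" b] norm_triangle_ineq4[of w b] by auto
    ultimately have "norm w \<ge> R" "norm (w - b) \<ge> R" using that d by auto
    then show ?thesis using R \<open>\<epsilon> > 0\<close> by simp
  qed
  have "bounded (\<phi> ` cball 0 R)"
    by (intro compact_imp_bounded compact_continuous_image continuous_on_subset[OF cont]) auto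
  then obtain K where K0: "\<And>z. z \<in> cball 0 R \<Longrightarrow> \<bar>\<phi> z\<bar> \<le> K" unfolding bounded_iff by force
  have "K \<ge> 0" using K0[of 0] \<open>R > 0\<close> by (auto intro: order_trans[OF abs_ge_zero])
  have K: "\<bar>\<phi> z\<bar> \<le> K" for z
    using K0[of z] R[of z] \<open>K \<ge> 0\<close> by (cases "norm z \<le> R") auto
  define I where "I = (\<integral>w. bump \<delta> w \<partial>lborel)"
  have "I > 0" unfolding I_def by (rule integral_bump_pos[OF d(1)])
  \<comment> \<open>The share of the point \<open>a\<close> in the density: \<open>G\<close> is the
    integral of \<open>g a\<close> over \<open>a\<close>, divided by the mass \<open>I\<close> of
    the mollifier.\<close>
  define g where "g = (\<lambda>a z. \<phi> a * kernel \<delta> (z - a))"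
  have [measurable]: "(\<lambda>(a, z). g a z) \<in> borel_measurable (borel \<Otimes>\<^sub>M borel)"
    unfolding g_def by measurable
  have [measurable]: "g a \<in> borel_measurable borel" for a unfolding g_def by measurable
  have gK: "\<bar>g a z\<bar> \<le> 4 * K * indicator (ball 0 R) a" for a z
    using mult_mono[OF K[of a] kernel_bound[of \<delta> "z - a"] \<open>K \<ge> 0\<close>] R[of a]
    by (auto simp: g_def abs_mult indicator_def)
  have gR: "g a z = 0" if "norm z \<ge> R + 1" for a z
  proof (cases "norm a \<ge> R")
    case True then show ?thesis using R by (simp add: g_def)
  next
    case False
    then have "norm (z - a) \<ge> \<delta>" using that norm_triangle_ineq2[of z a] d by linarith
    then show ?thesis using kernel_eq_0 d by (simp add: g_def)
  qed
  have int_ga: "integrable lborel (\<lambda>a. g a z)" for z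
  proof (rule Bochner_Integration.integrable_bound)
    show "integrable lborel (\<lambda>a::complex. 4 * K * indicator (ball 0 R) a :: real)"
      by (intro integrable_mult_right integrable_indicator_ball_complex)
    show "AE a in lborel. norm (g a z) \<le> norm (4 * K * indicator (ball 0 R) a :: real)"
      using gK \<open>K \<ge> 0\<close> by simp
  qed measurable
  define G where "G = (\<lambda>z. (\<integral>a. g a z \<partial>lborel) / I)"
  define B where "B = 4 * K * (pi * R^2) / I"
  have GB: "\<bar>G z\<bar> \<le> B" for z
  proof -
    have "\<bar>\<integral>a. g a z \<partial>lborel\<bar> \<le> (\<integral>a. \<bar>g a z\<bar> \<partial>lborel)" by (rule integral_abs_bound)
    also have "\<dots> \<le> (\<integral>a. 4 * K * indicator (ball 0 R) a \<partial>(lborel :: complex measure))"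
      by (intro integral_mono gK integrable_abs int_ga integrable_mult_right
          integrable_indicator_ball_complex)
    also have "\<dots> = 4 * K * (pi * R^2)" using \<open>R > 0\<close> by (simp add: measure_lborel_ball_complex)
    finally show ?thesis using \<open>I > 0\<close> by (simp add: G_def B_def divide_right_mono)
  qed
  have pot: "\<bar>\<phi> w - (\<integral>z. G z * ln (norm (z - w)) \<partial>lborel)\<bar> \<le> \<epsilon>" for w
  proof -
    define F where "F = (\<lambda>(a, z). g a z * ln (norm (z - w)))"
    define C where "C = 4 * K * ((R + 1 + norm w) * (pi * (R + 1)^2) + inv_norm_const)"
    have [measurable]: "F \<in> borel_measurable (lborel \<Otimes>\<^sub>M lborel)"
      unfolding F_def by measurable
    have le: "(\<integral>\<^sup>+z. ennreal (norm (F (a, z))) \<partial>lborel) \<le> ennreal C * indicator (ball 0 R) a" for a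
    proof (cases "a \<in> ball 0 R")
      case True
      have "(\<integral>\<^sup>+z. ennreal (norm (g a z * ln (norm (z - w)))) \<partial>lborel) \<le> ennreal C"
        unfolding C_def
        by (rule nn_integral_potential_le[OF _ _ gR])
          (use gK[of a] True \<open>R > 0\<close> in auto)
      then show ?thesis using True by (simp add: F_def)
    next
      case False
      then show ?thesis using R[of a] by (simp add: F_def g_def)
    qed
    have int: "integrable (lborel \<Otimes>\<^sub>M lborel) F"
    proof (rule integrableI_bounded)
      have "(\<integral>\<^sup>+x. ennreal (norm (F x)) \<partial>(lborel \<Otimes>\<^sub>M lborel))
          = (\<integral>\<^sup>+a. \<integral>\<^sup>+z. ennreal (norm (F (a, z))) \<partial>lborel \<partial>lborel)"
        by (rule lborel.nn_integral_fst[symmetric]) measurable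
      also have "\<dots> \<le> (\<integral>\<^sup>+a. ennreal C * indicator (ball 0 R) a \<partial>(lborel :: complex measure))"
        by (intro nn_integral_mono le)
      also have "\<dots> = ennreal (C * (pi * R^2))"
        using \<open>R > 0\<close> by (simp add: nn_integral_cmult_indicator emeasure_lborel_ball_complex
            ennreal_mult'')
      finally show "(\<integral>\<^sup>+x. ennreal (norm (F x)) \<partial>(lborel \<Otimes>\<^sub>M lborel)) < \<infinity>"
        unfolding infinity_ennreal_def using ennreal_less_top by (rule order.strict_trans1)
    qed measurable
    have inner: "(\<integral>z. F (a, z) \<partial>lborel) = \<phi> a * bump \<delta> (w - a)" for a
    proof -
      have "(\<integral>z. F (a, z) \<partial>lborel) = \<phi> a * (\<integral>z. kernel \<delta> (- a + z) * ln (norm ((- a + z) - (w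
          - a))) \<partial>lborel)"
        by (simp add: F_def g_def mult.assoc)
      also have "(\<integral>z. kernel \<delta> (- a + z) * ln (norm ((- a + z) - (w - a))) \<partial>lborel)
          = bump \<delta> (w - a)"
        unfolding bump_def by (rule integral_lborel_translate) measurable
      finally show ?thesis .
    qed
    have int_b: "integrable lborel (\<lambda>b. \<phi> (w - b) * bump \<delta> b)"
    proof (rule Bochner_Integration.integrable_bound)
      show "integrable lborel (\<lambda>b. K * bump \<delta> b)"
        by (intro integrable_mult_right integrable_bump d)
      show "AE b in lborel. norm (\<phi> (w - b) * bump \<delta> b) \<le> norm (K * bump \<delta> b)"
        using K \<open>K \<ge> 0\<close> by (auto simp: abs_mult intro!: mult_right_mono)
    qed measurable
    have "(\<integral>z. G z * ln (norm (z - w)) \<partial>lborel) = (\<integral>z. (\<integral>a. F (a, z) \<partial>lborel) \<partial>lborel) / I"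
      by (simp add: G_def F_def)
    also have "(\<integral>z. (\<integral>a. F (a, z) \<partial>lborel) \<partial>lborel) = (\<integral>a. (\<integral>z. F (a, z) \<partial>lborel) \<partial>lborel)"
      using lborel_pair.Fubini_integral[of "\<lambda>a z. F (a, z)"] int by simp
    also have "\<dots> = (\<integral>a. \<phi> (w - (w - a)) * bump \<delta> (w - a) \<partial>lborel)" by (simp add: inner)
    also have "\<dots> = (\<integral>b. \<phi> (w - b) * bump \<delta> b \<partial>lborel)"
      by (rule integral_lborel_reflect) measurable
    finally have "\<phi> w - (\<integral>z. G z * ln (norm (z - w)) \<partial>lborel)
        = (\<phi> w * I - (\<integral>b. \<phi> (w - b) * bump \<delta> b \<partial>lborel)) / I"
      using \<open>I > 0\<close> by (simp add: field_simps)
    also have "\<phi> w * I - (\<integral>b. \<phi> (w - b) * bump \<delta> b \<partial>lborel) = (\<integral>b. (\<phi> w - \<phi> (w - b)) * bump \<delta> b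
        \<partial>lborel)"
      unfolding I_def left_diff_distrib
      by (subst Bochner_Integration.integral_diff)
        (auto intro!: integrable_bump d int_b integrable_mult_right)
    finally have eq: "\<phi> w - (\<integral>z. G z * ln (norm (z - w)) \<partial>lborel)
        = (\<integral>b. (\<phi> w - \<phi> (w - b)) * bump \<delta> b \<partial>lborel) / I" .
    have "\<bar>\<integral>b. (\<phi> w - \<phi> (w - b)) * bump \<delta> b \<partial>lborel\<bar> \<le> (\<integral>b. \<bar>(\<phi> w - \<phi> (w - b)) * bump \<delta> b\<bar> \<partial>lborel)"
      by (rule integral_abs_bound)
    also have "\<dots> \<le> (\<integral>b. \<epsilon> * bump \<delta> b \<partial>lborel)"
    proof (rule integral_mono)
      show "integrable lborel (\<lambda>b. \<bar>(\<phi> w - \<phi> (w - b)) * bump \<delta> b\<bar>)"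
        unfolding left_diff_distrib
        by (intro integrable_abs Bochner_Integration.integrable_diff integrable_mult_right
            integrable_bump d int_b)
      show "\<bar>(\<phi> w - \<phi> (w - b)) * bump \<delta> b\<bar> \<le> \<epsilon> * bump \<delta> b" for b
        using uc[of b w] bump_nonneg[OF d(1), of b] bump_eq_0[OF d(1), of b]
        by (cases "norm b < \<delta>") (auto simp: abs_mult intro!: mult_right_mono)
    qed (intro integrable_mult_right integrable_bump d)
    also have "\<dots> = \<epsilon> * I" by (simp add: I_def)
    finally show ?thesis unfolding eq using \<open>I > 0\<close> by (simp add: field_simps)
  qed
  show thesis
  proof (rule that[of G "R + 1" B])
    show "G \<in> borel_measurable borel" unfolding G_def by measurable
    show "G z = 0" if "norm z \<ge> R + 1" for z using gR[OF that] by (simp add: G_def)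
  qed (use \<open>R > 0\<close> GB pot in auto)
qed

section \<open>Continuity of the roots\<close>

lemma sum_mset_image_eq_sum_count:
  fixes f :: "'a \<Rightarrow> 'b::semiring_1"
  shows "(\<Sum>x\<in>#A. f x) = (\<Sum>x\<in>set_mset A. of_nat (count A x) * f x)"
proof -
  have "(\<Sum>x\<in>#A. f x) = (\<Sum>x\<in>S. of_nat (count A x) * f x)" if "finite S" "set_mset A \<subseteq> S" for S
    using that(2)
  proof (induction A)
    case (add a A)
    have "(\<Sum>x\<in>S. of_nat (count (add_mset a A) x) * f x)
        = (\<Sum>x\<in>S. (if x = a then f x else 0) + of_nat (count A x) * f x)"
      by (intro sum.cong) (auto simp: distrib_right)
    also have "\<dots> = f a + (\<Sum>x\<in>S. of_nat (count A x) * f x)"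
      using add.prems \<open>finite S\<close> by (simp add: sum.distrib)
    finally show ?case using add by simp
  qed simp
  then show ?thesis by simp
qed

lemma integral_uniform_mset:
  fixes f :: "'a::topological_space \<Rightarrow> real"
  assumes "A \<noteq> {#}" and [measurable]: "f \<in> borel_measurable borel"
  shows "(\<integral>x. f x \<partial>uniform_mset A) = (\<Sum>x\<in>#A. f x) / size A"
proof -
  have "(\<integral>x. f x \<partial>uniform_mset A) = (\<integral>x. f x \<partial>measure_pmf (pmf_of_multiset A))"
    unfolding uniform_mset_def by (subst integral_distr) auto
  also have "\<dots> = (\<Sum>x\<in>set_mset A. pmf (pmf_of_multiset A) x * f x)"
    using assms(1) by (subst integral_measure_pmf[of "set_mset A"]) auto
  also have "\<dots> = (\<Sum>x\<in>#A. f x) / size A"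
    using assms(1) by (simp add: sum_mset_image_eq_sum_count sum_divide_distrib)
  finally show ?thesis .
qed

lemma power_size_le_prod_mset:
  fixes c :: real
  assumes "\<And>x. x \<in># A \<Longrightarrow> c \<le> f x" "0 \<le> c"
  shows "c ^ size A \<le> (\<Prod>x\<in>#A. f x)"
  using assms(1)
proof (induction A)
  case (add a A)
  then have "c * c ^ size A \<le> f a * (\<Prod>x\<in>#A. f x)"
    using \<open>0 \<le> c\<close> by (intro mult_mono) (auto intro: order_trans)
  then show ?case by simp
qed simp

lemma poly_eq_prod_proots:
  fixes p :: "complex poly"
  shows "poly p w = lead_coeff p * (\<Prod>x\<in>#proots p. w - x)"
  by (subst complex_poly_decompose_multiset[symmetric]) (simp add: poly_prod_mset
      image_mset.compositionality o_def)

lemma norm_prod_mset_image: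
  fixes f :: "'a \<Rightarrow> 'b::{real_normed_div_algebra, comm_monoid_mult}"
  shows "(\<Prod>x\<in>#A. norm (f x)) = norm (\<Prod>x\<in>#A. f x)"
  by (induction A) (simp_all add: norm_mult)

text \<open>The root nearest to \<open>w\<close> works: in the factorisation of
  \<open>poly p w\<close> every other factor has at least its modulus. So a small value at
  \<open>w\<close> forces a root near \<open>w\<close>, as long as the leading coefficient stays
  away from 0.\<close>

lemma exists_close_root:
  fixes p :: "complex poly"
  assumes "degree p > 0"
  shows "\<exists>u. poly p u = 0 \<and> norm (lead_coeff p) * norm (w - u) ^ degree p \<le> norm (poly p w)"
proof -
  have p: "p \<noteq> 0" using assms by auto
  have "proots p \<noteq> {#}" using assms size_proots_complex[of p] by auto
  then have ne: "set_mset (proots p) \<noteq> {}" by simp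
  define u where "u = arg_min_on (\<lambda>u. norm (w - u)) (set_mset (proots p))"
  have u: "u \<in># proots p" "\<And>x. x \<in># proots p \<Longrightarrow> norm (w - u) \<le> norm (w - x)"
    using arg_min_if_finite(1)[OF _ ne] arg_min_least[OF _ ne] unfolding u_def by auto
  have "norm (w - u) ^ degree p \<le> (\<Prod>x\<in>#proots p. norm (w - x))"
    unfolding size_proots_complex[symmetric] by (rule power_size_le_prod_mset) (use u in auto)
  also have "\<dots> = norm (\<Prod>x\<in>#proots p. w - x)"
    by (rule norm_prod_mset_image)
  finally have "norm (lead_coeff p) * norm (w - u) ^ degree p \<le> norm (poly p w)"
    unfolding poly_eq_prod_proots norm_mult by (rule mult_left_mono) simp
  with u(1) p show ?thesis by auto
qed

lemma tendsto_poly_coeffwise: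
  fixes p :: "'b \<Rightarrow> complex poly"
  assumes "\<And>i. ((\<lambda>x. coeff (p x) i) \<longlongrightarrow> coeff q i) F" "\<And>x. degree (p x) = d" "degree q = d"
  shows "((\<lambda>x. poly (p x) w) \<longlongrightarrow> poly q w) F"
  unfolding poly_altdef assms(2,3) by (intro tendsto_intros assms(1))

text \<open>Continuity of the roots, by induction on the degree: the root of \<open>p x\<close> nearest to a root
  of the limit converges to it, and it is split off by synthetic division.\<close>

lemma tendsto_sum_proots:
  fixes p :: "'b \<Rightarrow> complex poly" and f :: "complex \<Rightarrow> real"
  assumes "\<And>i. ((\<lambda>x. coeff (p x) i) \<longlongrightarrow> coeff q i) F" "\<And>x. degree (p x) = d" "degree q = d"
    and f: "continuous_on UNIV f"
  shows "((\<lambda>x. \<Sum>w\<in>#proots (p x). f w) \<longlongrightarrow> (\<Sum>w\<in>#proots q. f w)) F"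
  using assms(1-3)
proof (induction d arbitrary: p q)
  case 0
  then have "proots (p x) = {#}" "proots q = {#}" for x
    using size_proots_complex[of "p x"] size_proots_complex[of q] by auto
  then show ?case by simp
next
  case (Suc d)
  have q0: "q \<noteq> 0" and p0: "p x \<noteq> 0" for x using Suc.prems(2)[of x] Suc.prems(3) by auto
  obtain w where w: "poly q w = 0"
    using exists_close_root[of q] Suc.prems(3) by auto
  have "\<forall>x. \<exists>u. poly (p x) u = 0 \<and> norm (coeff (p x) (Suc d)) * norm (w - u) ^ Suc d
      \<le> norm (poly (p x) w)"
    using exists_close_root[of "p _" w] Suc.prems(2) by force
  then obtain u where u: "\<And>x. poly (p x) (u x) = 0"
    "\<And>x. norm (coeff (p x) (Suc d)) * norm (w - u x) ^ Suc d \<le> norm (poly (p x) w)"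
    by metis
  have ulim: "(u \<longlongrightarrow> w) F"
  proof (rule tendstoI)
    fix e :: real assume "e > 0"
    define c where "c = norm (coeff q (Suc d))"
    have "c > 0" using q0 Suc.prems(3) unfolding c_def
        by (metis leading_coeff_0_iff zero_less_norm_iff)
    have "((\<lambda>x. norm (coeff (p x) (Suc d))) \<longlongrightarrow> c) F"
      unfolding c_def by (intro tendsto_norm Suc.prems)
    then have "\<forall>\<^sub>F x in F. norm (coeff (p x) (Suc d)) > c / 2"
      by (rule order_tendstoD) (use \<open>c > 0\<close> in auto)
    moreover have "((\<lambda>x. norm (poly (p x) w)) \<longlongrightarrow> norm (poly q w)) F"
      by (intro tendsto_norm tendsto_poly_coeffwise[of _ _ _ "Suc d"] Suc.prems)
    then have "\<forall>\<^sub>F x in F. norm (poly (p x) w) < c / 2 * e ^ Suc d"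
      by (rule order_tendstoD) (use \<open>c > 0\<close> \<open>e > 0\<close> w in auto)
    ultimately show "\<forall>\<^sub>F x in F. dist (u x) w < e"
    proof eventually_elim
      case (elim x)
      have "c / 2 * norm (w - u x) ^ Suc d \<le> norm (coeff (p x) (Suc d)) * norm (w - u x) ^ Suc d"
        using elim by (intro mult_right_mono) auto
      also have "\<dots> < c / 2 * e ^ Suc d" using u(2)[of x] elim by linarith
      finally have "norm (w - u x) ^ Suc d < e ^ Suc d"
        using \<open>c > 0\<close> by (subst (asm) mult_less_cancel_left_pos) auto
      then have "norm (w - u x) < e" by (rule power_less_imp_less_base) (use \<open>e > 0\<close> in auto)
      then show ?case by (simp add: dist_norm norm_minus_commute)
    qed
  qed
  define p' where "p' = (\<lambda>x. synthetic_div (p x) (u x))"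
  define q' where "q' = synthetic_div q w"
  have deg: "degree (p' x) = d" "degree q' = d" for x
    using Suc.prems by (simp_all add: p'_def q'_def degree_synthetic_div)
  have pe: "p x = [:- u x, 1:] * p' x" and qe: "q = [:- w, 1:] * q'" for x
    using synthetic_div_correct'[of "u x" "p x"] synthetic_div_correct'[of w q] u(1) w
    by (simp_all add: p'_def q'_def)
  have nz: "p' x \<noteq> 0" "q' \<noteq> 0" for x using pe[of x] qe p0[of x] q0 by auto
  have recp: "coeff (p' x) i = coeff (p x) (Suc i) + u x * coeff (p' x) (Suc i)" for x i
    by (subst pe) simp
  have recq: "coeff q' i = coeff q (Suc i) + w * coeff q' (Suc i)" for i
    by (subst qe) simp
  \<comment> \<open>Synthetic division yields the coefficients of the quotient from the top down, so
    the induction descends in \<open>i\<close>; above the degree \<open>d\<close> both coefficients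
    are 0.\<close>
  have "((\<lambda>x. coeff (p' x) i) \<longlongrightarrow> coeff q' i) F" if "i + j > d" for i j
    using that
  proof (induction j arbitrary: i)
    case 0
    then have "coeff (p' x) i = 0" "coeff q' i = 0" for x
      using deg by (auto intro: coeff_eq_0)
    then show ?case by simp
  next
    case (Suc j)
    have "((\<lambda>x. coeff (p x) (Suc i) + u x * coeff (p' x) (Suc i))
        \<longlongrightarrow> coeff q (Suc i) + w * coeff q' (Suc i)) F"
      by (intro tendsto_intros ulim \<open>\<And>i. ((\<lambda>x. coeff (p x) i)
          \<longlongrightarrow> coeff q i) F\<close> Suc.IH) (use Suc.prems in simp)
    then show ?case unfolding recp[symmetric] recq[symmetric] .
  qed
  from this[of _ "Suc d"] have lim': "((\<lambda>x. coeff (p' x) i) \<longlongrightarrow> coeff q' i) F" for i by simp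
  have "((\<lambda>x. f (u x) + (\<Sum>w\<in>#proots (p' x). f w)) \<longlongrightarrow> f w + (\<Sum>w\<in>#proots q'. f w)) F"
    by (intro tendsto_add Suc.IH lim' deg continuous_on_tendsto_compose[OF f ulim]) auto
  moreover have "proots (p x) = add_mset (u x) (proots (p' x))" "proots q
      = add_mset w (proots q')" for x
    using proots_mult[of "[:- u x, 1:]" "p' x"] proots_mult[of "[:- w, 1:]" q'] nz
    unfolding pe[of x, symmetric] qe[symmetric] by simp_all
  ultimately show ?case by simp
qed

section \<open>Measurability of the events, by continuity in the random roots\<close>

lemma tendsto_coeff_mult_prod_linear:
  fixes x :: "'b \<Rightarrow> 'c \<Rightarrow> complex"
  assumes "\<And>j. j \<in> J \<Longrightarrow> ((\<lambda>m. x m j) \<longlongrightarrow> y j) F"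
  shows "((\<lambda>m. coeff (A * (\<Prod>j\<in>J. [:- x m j, 1:])) i) \<longlongrightarrow> coeff (A * (\<Prod>j\<in>J. [:- y j, 1:])) i) F"
  using assms
proof (induction J arbitrary: i rule: infinite_finite_induct)
  case (insert j J)
  define H where "H = (\<lambda>m. A * (\<Prod>j\<in>J. [:- x m j, 1:]))"
  define K where "K = A * (\<Prod>j\<in>J. [:- y j, 1:])"
  have eq: "A * (\<Prod>j\<in>insert j J. [:- x m j, 1:]) = smult (- x m j) (H m) + pCons 0 (H m)"
    "A * (\<Prod>j\<in>insert j J. [:- y j, 1:]) = smult (- y j) K + pCons 0 K" for m
    using insert.hyps by (simp_all add: H_def K_def algebra_simps)
  have lim: "((\<lambda>m. coeff (H m) i) \<longlongrightarrow> coeff K i) F" for i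
    unfolding H_def K_def by (rule insert.IH) (use insert.prems in auto)
  have "((\<lambda>m. coeff (pCons 0 (H m)) i) \<longlongrightarrow> coeff (pCons 0 K) i) F"
    using lim by (cases i) auto
  then show ?case
    unfolding eq coeff_add coeff_smult by (intro tendsto_intros lim insert.prems) auto
qed auto

lemma degree_mult_prod_linear:
  fixes A :: "complex poly" and x :: "'b \<Rightarrow> complex"
  assumes "A \<noteq> 0"
  shows "degree (A * (\<Prod>j\<in>J. [:- x j, 1:])) = degree A + card J"
proof -
  have nz: "(\<Prod>j\<in>J. [:- x j, 1:]) \<noteq> 0" for J :: "'b set"
    by (cases "finite J") (auto simp: prod_zero_iff)
  have "degree (\<Prod>j\<in>J. [:- x j, 1:]) = card J" for J :: "'b set"
  proof (induction J rule: infinite_finite_induct)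
    case (insert j J)
    then show ?case using degree_mult_eq[OF _ nz, of "[:- x j, 1:]" J] by simp
  qed auto
  then show ?thesis using degree_mult_eq[OF assms nz[of J]] by simp
qed

text \<open>Arbitrary unions of subbasic sets preserve openness but not measurability, so the
  induction over the generated topology is run for open preimages; measurability is deduced from
  openness afterwards.\<close>

lemma open_vimage_weak_topology:
  fixes N :: "'x::topological_space \<Rightarrow> 'a::topological_space measure"
  assumes N: "\<And>x. N x \<in> borel_prob_measures"
    and cont: "\<And>f :: 'a \<Rightarrow> real. continuous_on UNIV f \<Longrightarrow> bounded (range f)
        \<Longrightarrow> continuous_on UNIV (\<lambda>x. \<integral>y. f y \<partial>N x)"
    and U: "openin weak_topology U"
  shows "open {x. N x \<in> U}"
  using U[unfolded weak_topology_def openin_topology_generated_by_iff]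
proof (induction rule: generate_topology_on.induct)
  case (Int a b)
  then show ?case by (simp add: Collect_conj_eq open_Int)
next
  case (UN K)
  have "{x. N x \<in> \<Union> K} = (\<Union>k\<in>K. {x. N x \<in> k})" by auto
  then show ?case using UN by auto
next
  case (Basis S)
  then obtain f :: "'a \<Rightarrow> real" and V where
    S: "S = {N \<in> borel_prob_measures. (\<integral>x. f x \<partial>N) \<in> V}"
    and f: "continuous_on UNIV f" "bounded (range f)" and V: "open V" by blast
  have "{x. N x \<in> S} = (\<lambda>x. \<integral>y. f y \<partial>N x) -` V" using N by (auto simp: S)
  then show ?case using cont[OF f] V by (simp add: continuous_on_open_vimage)
qed simp

lemma continuous_on_integral_zeros_measure:
  fixes A :: "complex poly" and f :: "complex \<Rightarrow> real"
  assumes A: "A \<noteq> 0" and l: "l < degree A + card J" and f: "continuous_on UNIV f"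
  shows "continuous_on UNIV (\<lambda>x :: 'c \<Rightarrow> complex. \<integral>y. f y \<partial>zeros_measure ((pderiv ^^ l) (A
      * (\<Prod>j\<in>J. [:- x j, 1:]))))"
proof -
  define Q where "Q = (\<lambda>x :: 'c \<Rightarrow> complex. (pderiv ^^ l) (A * (\<Prod>j\<in>J. [:- x j, 1:])))"
  have deg: "degree (Q x) = degree A + card J - l" for x
    unfolding Q_def by (simp add: degree_higher_pderiv degree_mult_prod_linear[OF A])
  have [measurable]: "f \<in> borel_measurable borel" using f by (rule borel_measurable_continuous_onI)
  have int: "(\<integral>y. f y \<partial>zeros_measure (Q x)) = (\<Sum>w\<in>#proots (Q x). f w) / real (degree A + card J
      - l)" for x
  proof -
    have sz: "size (proots (Q x)) = degree A + card J - l" by (simp add: size_proots_complex deg)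
    then have "proots (Q x) \<noteq> {#}" using l by auto
    then show ?thesis unfolding zeros_measure_def by (subst integral_uniform_mset) (auto simp: sz)
  qed
  have "((\<lambda>x. \<Sum>w\<in>#proots (Q x). f w) \<longlongrightarrow> (\<Sum>w\<in>#proots (Q y). f w)) (at y)" for y
  proof (rule tendsto_sum_proots[OF _ deg deg f])
    fix i
    have "((\<lambda>x. x j) \<longlongrightarrow> y j) (at y)" for j :: 'c
      using continuous_on_product_coordinates[of j] by (auto simp: continuous_on_def)
    then show "((\<lambda>x. coeff (Q x) i) \<longlongrightarrow> coeff (Q y) i) (at y)"
      unfolding Q_def coeff_higher_pderiv by (intro tendsto_intros tendsto_coeff_mult_prod_linear)
  qed
  then have "continuous_on UNIV (\<lambda>x. \<Sum>w\<in>#proots (Q x). f w)" by (simp add: continuous_on_def)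
  then have "continuous_on UNIV (\<lambda>x. \<integral>y. f y \<partial>zeros_measure (Q x))"
    unfolding int by (intro continuous_on_divide continuous_on_const) (use l in auto)
  then show ?thesis unfolding Q_def .
qed

lemma sets_zeros_measure_in:
  fixes X :: "nat \<Rightarrow> 'w \<Rightarrow> complex"
  assumes X: "\<And>j. j \<in> J \<Longrightarrow> X j \<in> borel_measurable M"
    and A: "A \<noteq> 0" and l: "l < degree A + card J" and U: "openin weak_topology U"
  shows "{\<omega> \<in> space M. zeros_measure ((pderiv ^^ l) (A * (\<Prod>j\<in>J. [:- X j \<omega>, 1:]))) \<in> U} \<in> sets M"
proof -
  \<comment> \<open>Setting the other coordinates to 0 makes the random roots a measurable map into
    the space of all sequences, where the preimage of an open set is an event.\<close>
  define Y where "Y = (\<lambda>\<omega> j. if j \<in> J then X j \<omega> else 0)"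
  have Y: "Y \<in> borel_measurable M"
  proof (rule measurable_coordinatewise_then_product)
    fix j show "(\<lambda>\<omega>. Y \<omega> j) \<in> borel_measurable M"
      using X[of j] by (cases "j \<in> J") (simp_all add: Y_def)
  qed
  define W where "W = {x :: nat \<Rightarrow> complex. zeros_measure ((pderiv ^^ l) (A * (\<Prod>j\<in>J. [:- x j,
      1:]))) \<in> U}"
  have "open W"
    unfolding W_def
    by (rule open_vimage_weak_topology[OF _ continuous_on_integral_zeros_measure[OF A l] U])
      (auto simp: zeros_measure_def uniform_mset_in_borel_prob_measures)
  then have "Y -` W \<inter> space M \<in> sets M" using Y by (auto intro: measurable_sets)
  also have "Y -` W \<inter> space M = {\<omega> \<in> space M. zeros_measure ((pderiv ^^ l) (A * (\<Prod>j\<in>J. [:- X j \<omega>,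
      1:]))) \<in> U}"
  proof -
    have "(\<Prod>j\<in>J. [:- Y \<omega> j, 1:]) = (\<Prod>j\<in>J. [:- X j \<omega>, 1:])" for \<omega>
      by (rule prod.cong) (auto simp: Y_def)
    then show ?thesis by (auto simp: W_def)
  qed
  finally show ?thesis .
qed

section \<open>Logarithms of derivatives of polynomials\<close>

text \<open>Away from the roots this is the logarithm of the modulus of \<open>P\<close> divided by
  its leading coefficient: the potential of the roots, free of normalisation.\<close>

definition log_norm_roots :: "complex poly \<Rightarrow> complex \<Rightarrow> real" where
  "log_norm_roots P z = (\<Sum>w\<in>#proots P. ln (norm (z - w)))"

lemma ln_norm_prod_mset:
  assumes "z \<notin># A"
  shows "ln (norm (\<Prod>w\<in>#A. z - w)) = (\<Sum>w\<in>#A. ln (norm (z - w)))" and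
      "(\<Prod>w\<in>#A. z - w) \<noteq> (0 :: complex)"
proof -
  show nz: "(\<Prod>w\<in>#A. z - w) \<noteq> 0" using assms by (induction A) auto
  show "ln (norm (\<Prod>w\<in>#A. z - w)) = (\<Sum>w\<in>#A. ln (norm (z - w)))"
    using assms
  proof (induction A)
    case (add a A)
    then have "(\<Prod>w\<in>#A. z - w) \<noteq> 0" by (induction A) auto
    then show ?case using add by (simp add: norm_mult ln_mult)
  qed simp
qed

lemma ln_norm_poly:
  assumes "poly P z \<noteq> 0"
  shows "ln (norm (poly P z)) = ln (norm (lead_coeff P)) + log_norm_roots P z"
proof -
  have P: "P \<noteq> 0" using assms by auto
  then have nz: "z \<notin># proots P" using assms by simp
  have "norm (poly P z) = norm (lead_coeff P) * norm (\<Prod>x\<in>#proots P. z - x)"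
    by (subst poly_eq_prod_proots) (simp add: norm_mult)
  then show ?thesis
    using P ln_norm_prod_mset[OF nz] by (simp add: log_norm_roots_def ln_mult)
qed

section \<open>Upper bound by logarithmic derivatives\<close>

lemma poly_pderiv_prod_linear:
  fixes z :: complex
  assumes "z \<notin># A"
  shows "poly (pderiv (\<Prod>w\<in>#A. [:- w, 1:])) z = poly (\<Prod>w\<in>#A. [:- w, 1:]) z * (\<Sum>w\<in>#A. 1 / (z - w))"
  using assms
proof (induction A)
  case (add a A)
  define p where "p = (\<Prod>w\<in>#A. [:- w, 1:])"
  have "poly (pderiv ([:- a, 1:] * p)) z = poly p z + (z - a) * poly (pderiv p) z"
    by (simp add: pderiv_mult pderiv_pCons del: mult_pCons_left)
  also have "\<dots> = (z - a) * poly p z * (1 / (z - a) + (\<Sum>w\<in>#A. 1 / (z - w)))"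
    using add by (simp add: p_def field_simps)
  finally show ?case by (simp add: p_def algebra_simps)
qed simp

lemma poly_pderiv_eq_sum_proots:
  fixes P :: "complex poly"
  assumes "poly P z \<noteq> 0"
  shows "poly (pderiv P) z = poly P z * (\<Sum>w\<in>#proots P. 1 / (z - w))"
proof -
  have "P \<noteq> 0" using assms by auto
  then have nz: "z \<notin># proots P" using assms by simp
  show ?thesis
    using poly_pderiv_prod_linear[OF nz]
    by (subst (1 2) complex_poly_decompose_multiset[of P, symmetric]) (simp add: pderiv_smult)
qed

lemma norm_sum_mset_le: "norm (\<Sum>w\<in>#A. f w) \<le> (\<Sum>w\<in>#A. norm (f w :: 'b::real_normed_vector))"
  by (induction A) (auto intro: order_trans[OF norm_triangle_ineq])

text \<open>The logarithmic derivative is the sum of \<open>1 / (z - w)\<close>, and differentiation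
  multiplies the leading coefficient by the degree. Working with monic normalisations therefore
  turns the sum into an average, and \<open>ln s \<le> s\<close> removes the logarithm.\<close>

lemma log_norm_roots_pderiv_le:
  assumes z: "poly P z \<noteq> 0" "poly (pderiv P) z \<noteq> 0"
  shows "log_norm_roots (pderiv P) z - log_norm_roots P z \<le> (\<Sum>w\<in>#proots P. inverse (norm (z
      - w))) / degree P"
proof -
  have N: "degree P > 0" using z(2) by (auto simp: pderiv_eq_0_iff[symmetric] intro!: Nat.gr0I)
  then have P: "P \<noteq> 0" by auto
  define S where "S = (\<Sum>w\<in>#proots P. 1 / (z - w))"
  have eq: "poly (pderiv P) z = poly P z * S" unfolding S_def
      by (rule poly_pderiv_eq_sum_proots[OF z(1)])
  then have "S \<noteq> 0" using z by auto
  have lead: "lead_coeff (pderiv P) = of_nat (degree P) * lead_coeff P"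
    using N by (simp add: coeff_pderiv degree_pderiv)
  have "ln (norm (lead_coeff (pderiv P))) + log_norm_roots (pderiv P) z
      = ln (norm (lead_coeff P)) + log_norm_roots P z + ln (norm S)"
    using ln_norm_poly[OF z(1)] ln_norm_poly[OF z(2)] z(1) \<open>S \<noteq> 0\<close>
        by (simp add: eq norm_mult ln_mult)
  then have "log_norm_roots (pderiv P) z - log_norm_roots P z = ln (norm S) - ln (degree P)"
    unfolding lead using N P by (simp add: norm_mult ln_mult)
  also have "\<dots> = ln (norm S / degree P)" using N \<open>S \<noteq> 0\<close> by (simp add: ln_div)
  also have "\<dots> \<le> norm S / degree P"
    using ln_le_minus_one[of "norm S / degree P"] N \<open>S \<noteq> 0\<close> by simp
  also have "norm S \<le> (\<Sum>w\<in>#proots P. inverse (norm (z - w)))"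
    unfolding S_def using norm_sum_mset_le[of "\<lambda>w. 1 / (z - w)" "proots P"]
    by (simp add: norm_divide inverse_eq_divide)
  finally show ?thesis by (simp add: divide_right_mono)
qed

lemma log_norm_roots_higher_pderiv_le:
  assumes "\<And>j. j \<le> l \<Longrightarrow> poly ((pderiv ^^ j) P) z \<noteq> 0"
  shows "log_norm_roots ((pderiv ^^ l) P) z - log_norm_roots P z
    \<le> (\<Sum>j<l. (\<Sum>w\<in>#proots ((pderiv ^^ j) P). inverse (norm (z - w))) / degree ((pderiv ^^ j) P))"
  using assms
proof (induction l)
  case (Suc l)
  have "log_norm_roots ((pderiv ^^ Suc l) P) z - log_norm_roots ((pderiv ^^ l) P) z
      \<le> (\<Sum>w\<in>#proots ((pderiv ^^ l) P). inverse (norm (z - w))) / degree ((pderiv ^^ l) P)"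
    using log_norm_roots_pderiv_le[of "(pderiv ^^ l) P" z] Suc.prems[of l] Suc.prems[of "Suc l"]
        by simp
  then show ?case using Suc.IH Suc.prems by simp
qed simp

text \<open>The anticoncentration of \<open>1 / (z - x) + c\<close> as a function of \<open>x\<close>: it can only be small if
  \<open>x\<close> is close to its zero \<open>z + 1 / c\<close>, or if \<open>x\<close> is far away.\<close>

lemma neg_ln_norm_inverse_add_le:
  fixes x z c :: complex
  assumes "z \<noteq> x" and nz: "1 / (z - x) + c \<noteq> 0"
  shows "- ln (norm (1 / (z - x) + c)) \<le> log_minus (x - (z + 1 / c)) + 4 * norm (z - x)"
proof -
  define s where "s = norm (z - x)"
  have s: "s > 0" using assms by (simp add: s_def)
  have ln2s: "ln (2 * s) \<le> 2 * s" using ln_le_minus_one[of "2 * s"] s by simp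
  show ?thesis
  \<comment> \<open>If \<open>\<bar>c\<bar> \<le> 1 / (2 * s)\<close>, the term
    \<open>1 / (z - x)\<close> dominates and the sum has modulus at least
    \<open>1 / (2 * s)\<close>. Otherwise the distance from \<open>x\<close> to the zero
    \<open>z + 1 / c\<close> can be factored out, with coefficient \<open>c / (z - x)\<close>. The 4
    arises from adding \<open>ln (2 * s) \<le> 2 * s\<close> and
    \<open>ln s \<le> 2 * s\<close>.\<close>
  proof (cases "norm c * s \<le> 1 / 2")
    case True
    have "norm (1 / (z - x)) - norm (- c) \<le> norm (1 / (z - x) - (- c))"
        by (rule norm_triangle_ineq2)
    then have "1 / s - norm c \<le> norm (1 / (z - x) + c)" by (simp add: norm_divide s_def)
    moreover have "norm c \<le> 1 / (2 * s)" using True s by (simp add: field_simps)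
    then have "1 / (2 * s) \<le> 1 / s - norm c" by (simp add: field_simps)
    ultimately have "1 / (2 * s) \<le> norm (1 / (z - x) + c)" by linarith
    then have "ln (1 / (2 * s)) \<le> ln (norm (1 / (z - x) + c))"
      using s by (subst ln_le_cancel_iff) (use nz in auto)
    then have "- ln (norm (1 / (z - x) + c)) \<le> ln (2 * s)" using s by (simp add: ln_div)
    also have "\<dots> \<le> 4 * s" using ln2s s by linarith
    finally show ?thesis using log_minus_nonneg[of "x - (z + 1 / c)"] unfolding s_def by linarith
  next
    case False
    then have c: "c \<noteq> 0" by auto
    have cs: "norm c > 1 / (2 * s)" using False s by (simp add: field_simps)
    have eq: "1 / (z - x) + c = - (c * (x - (z + 1 / c)) / (z - x))"
      using c assms(1) by (simp add: field_simps)
    then have xp: "x - (z + 1 / c) \<noteq> 0" using nz by auto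
    have "norm (1 / (z - x) + c) = norm c * norm (x - (z + 1 / c)) / s"
      unfolding eq by (simp add: norm_mult norm_divide s_def)
    then have "ln (norm (1 / (z - x) + c)) = ln (norm c) + ln (norm (x - (z + 1 / c))) - ln s"
      using c xp s by (simp add: ln_mult ln_div)
    moreover have "ln (1 / (2 * s)) \<le> ln (norm c)" using cs s c by (subst ln_le_cancel_iff) auto
    then have "- ln (norm c) \<le> ln (2 * s)" using s by (simp add: ln_div)
    moreover have "ln s \<le> 2 * s" using ln_le_minus_one[of s] s by simp
    moreover have "- ln (norm (x - (z + 1 / c))) \<le> log_minus (x - (z + 1 / c))"
        by (simp add: log_minus_def)
    ultimately show ?thesis using ln2s unfolding s_def by linarith
  qed
qed

section \<open>Lower bound by splitting off the random roots\<close>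

lemma poly_higher_pderiv_linear_mult:
  "poly ((pderiv ^^ m) ([:- a, 1:] * H)) z
    = (z - a) * poly ((pderiv ^^ m) H) z + of_nat m * poly ((pderiv ^^ (m - 1)) (H :: 'a::idom
        poly)) z"
\<comment> \<open>At \<open>m = 0\<close> the truncated \<open>m - 1\<close> does no harm, since its
  term is multiplied by 0.\<close>
proof (cases m)
  case (Suc n)
  have rec: "(pderiv ^^ Suc n) ([:- a, 1:] * H) = [:- a, 1:] * (pderiv ^^ Suc n) H + smult (of_nat
      (Suc n)) ((pderiv ^^ n) H)" for n
  proof (induction n)
    case 0
    then show ?case by (simp add: pderiv_mult pderiv_pCons del: mult_pCons_left)
  next
    case (Suc n)
    have "(pderiv ^^ Suc (Suc n)) ([:- a, 1:] * H) = pderiv ([:- a, 1:] * (pderiv ^^ Suc n) H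
        + smult (of_nat (Suc n)) ((pderiv ^^ n) H))"
      using Suc by simp
    also have "\<dots> = [:- a, 1:] * (pderiv ^^ Suc (Suc n)) H + (pderiv ^^ Suc n) H + smult (of_nat
        (Suc n)) ((pderiv ^^ Suc n) H)"
      by (simp add: pderiv_add pderiv_mult pderiv_smult pderiv_pCons del: mult_pCons_left)
    also have "\<dots> = [:- a, 1:] * (pderiv ^^ Suc (Suc n)) H + smult (of_nat (Suc (Suc n))) ((pderiv
        ^^ Suc n) H)"
      by (simp only: of_nat_Suc[of "Suc n"] smult_add_left smult_1_left add.assoc)
    finally show ?case .
  qed
  show ?thesis unfolding Suc rec by (simp add: algebra_simps)
qed (simp add: algebra_simps)

text \<open>Factors are removed from the front, so the random root removed last is absent from
  everything that remains.\<close>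

definition tail_poly :: "complex poly \<Rightarrow> nat \<Rightarrow> (nat \<Rightarrow> complex) \<Rightarrow> nat \<Rightarrow> complex poly" where
  "tail_poly A k x j = A * (\<Prod>i\<in>{j<..k}. [:- x i, 1:])"

lemma tail_poly_rec:
  assumes "j < k"
  shows "tail_poly A k x j = [:- x (Suc j), 1:] * tail_poly A k x (Suc j)"
proof -
  have "{j<..k} = insert (Suc j) {Suc j<..k}" using assms by auto
  then show ?thesis by (simp add: tail_poly_def algebra_simps)
qed

lemma tail_poly_0: "tail_poly A k x 0 = A * (\<Prod>i=1..k. [:- x i, 1:])"
proof -
  have "{0<..k} = {1..k}" by auto
  then show ?thesis by (simp add: tail_poly_def)
qed

text \<open>As a function of \<open>x j\<close>, the \<open>m\<close>-th derivative of \<open>tail_poly A k x (j - 1)\<close> at \<open>z\<close> is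
  affine with zero \<open>pivot A k x j m z\<close>, which depends on \<open>x i\<close> for \<open>i > j\<close> only.\<close>

definition pivot :: "complex poly \<Rightarrow> nat \<Rightarrow> (nat \<Rightarrow> complex) \<Rightarrow> nat \<Rightarrow> nat \<Rightarrow> complex \<Rightarrow> complex" where
  "pivot A k x j m z = z + of_nat m * poly ((pderiv ^^ (m - 1)) (tail_poly A k x j)) z / poly
      ((pderiv ^^ m) (tail_poly A k x j)) z"

text \<open>Removing one root lowers the order of the derivative by one, so the \<open>t\<close>-th
  removed root meets order \<open>m + 1 - t\<close>, and after \<open>m\<close> roots the ratio is
  1. Each removal contributes an integer factor and a term \<open>1 / (z - x) + c\<close>; the
  integers are at least 1 and only help.\<close>

lemma neg_ln_tail_poly_ratio_le:
  assumes "j + m \<le> k"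
    and nz: "\<And>i n. i \<le> k \<Longrightarrow> n \<le> m \<Longrightarrow> poly ((pderiv ^^ n) (tail_poly A k x i)) z \<noteq> 0"
  shows "- ln (norm (poly ((pderiv ^^ m) (tail_poly A k x j)) z / poly (tail_poly A k x j) z))
    \<le> (\<Sum>t=1..m. log_minus (x (j + t) - pivot A k x (j + t) (m + 1 - t) z) + 4 * norm (z - x (j
        + t)))"
  using assms
proof (induction m arbitrary: j)
  case 0
  have "poly (tail_poly A k x j) z \<noteq> 0" using "0.prems"(2)[of j 0] "0.prems"(1) by simp
  then show ?case by simp
next
  case (Suc m)
  define H where "H = tail_poly A k x (Suc j)"
  define y where "y = 1 / (z - x (Suc j))"
  have j: "j < k" using Suc.prems(1) by simp
  have nz0: "poly (tail_poly A k x j) z \<noteq> 0" "poly H z \<noteq> 0" "poly ((pderiv ^^ m) H) z \<noteq> 0"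
    "poly ((pderiv ^^ Suc m) (tail_poly A k x j)) z \<noteq> 0"
    using Suc.prems(2)[of j 0] Suc.prems(2)[of "Suc j" 0] Suc.prems(2)[of
        "Suc j" m] Suc.prems(2)[of j "Suc m"] j
    by (auto simp: H_def)
  have rec: "tail_poly A k x j = [:- x (Suc j), 1:] * H" unfolding H_def
      by (rule tail_poly_rec[OF j])
  have zx: "z \<noteq> x (Suc j)" using nz0(1) unfolding rec by auto
  define c where "c = poly ((pderiv ^^ Suc m) H) z / (of_nat (Suc m) * poly ((pderiv ^^ m) H) z)"
  have ratio: "poly ((pderiv ^^ Suc m) (tail_poly A k x j)) z / poly (tail_poly A k x j) z
      = of_nat (Suc m) * (poly ((pderiv ^^ m) H) z / poly H z) * (y + c)"
  proof -
    have "poly ((pderiv ^^ Suc m) (tail_poly A k x j)) z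
        = (z - x (Suc j)) * poly ((pderiv ^^ Suc m) H) z + of_nat (Suc m) * poly ((pderiv ^^ m) H)
            z"
      unfolding rec poly_higher_pderiv_linear_mult by simp
    moreover have "poly (tail_poly A k x j) z = (z - x (Suc j)) * poly H z"
      unfolding rec by (simp add: algebra_simps)
    moreover have "(w * P1 + M * P0) / (w * H0) = M * (P0 / H0) * (1 / w + P1 / (M * P0))"
      if "w \<noteq> 0" "M \<noteq> 0" "P0 \<noteq> 0" "H0 \<noteq> 0" for w P1 M P0 H0 :: complex
      using that by (simp add: field_simps)
    ultimately show ?thesis
      using zx nz0(2,3) of_nat_neq_0[of m, where 'a = complex]
      by (simp only: y_def c_def right_minus_eq not_False_eq_True)
  qed
  have yc: "y + c \<noteq> 0" using ratio nz0 by auto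
  have pv: "pivot A k x (Suc j) (Suc m) z = z + 1 / c"
    by (simp add: pivot_def H_def c_def del: of_nat_Suc funpow.simps)
  have "- ln (norm (poly ((pderiv ^^ Suc m) (tail_poly A k x j)) z / poly (tail_poly A k x j) z))
      = - ln (real (Suc m)) - ln (norm (poly ((pderiv ^^ m) H) z / poly H z)) - ln (norm (y + c))"
    unfolding ratio norm_mult using yc nz0
    by (subst ln_mult ln_mult, simp_all add: ln_mult del: of_nat_Suc funpow.simps)
  also have "\<dots> \<le> - ln (norm (poly ((pderiv ^^ m) H) z / poly H z)) - ln (norm (y + c))"
    by simp
  also have "\<dots> \<le> (\<Sum>t=1..m. log_minus (x (Suc j + t) - pivot A k x (Suc j + t) (m + 1 - t) z) + 4
      * norm (z - x (Suc j + t)))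
      + (log_minus (x (Suc j) - pivot A k x (Suc j) (Suc m) z) + 4 * norm (z - x (Suc j)))"
  proof -
    have "- ln (norm (y + c)) \<le> log_minus (x (Suc j) - (z + 1 / c)) + 4 * norm (z - x (Suc j))"
      using neg_ln_norm_inverse_add_le[OF zx, of c] yc unfolding y_def by blast
    moreover have "- ln (norm (poly ((pderiv ^^ m) H) z / poly H z))
      \<le> (\<Sum>t=1..m. log_minus (x (Suc j + t) - pivot A k x (Suc j + t) (m + 1 - t) z) + 4 * norm (z
          - x (Suc j + t)))"
      unfolding H_def by (rule Suc.IH) (use Suc.prems in auto)
    ultimately show ?thesis unfolding pv by linarith
  qed
  also have "\<dots> = (\<Sum>t=1..Suc m. log_minus (x (j + t) - pivot A k x (j + t) (Suc m + 1 - t) z) + 4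
      * norm (z - x (j + t)))"
  proof -
    have "(\<Sum>t=1..Suc m. log_minus (x (j + t) - pivot A k x (j + t) (Suc m + 1 - t) z) + 4
        * norm (z - x (j + t)))
       = (log_minus (x (j + 1) - pivot A k x (j + 1) (Suc m + 1 - 1) z) + 4 * norm (z - x (j + 1)))
       + (\<Sum>t=Suc 1..Suc m. log_minus (x (j + t) - pivot A k x (j + t) (Suc m + 1 - t) z) + 4
           * norm (z - x (j + t)))"
      by (rule sum.atLeast_Suc_atMost) simp
    also have "(\<Sum>t=Suc 1..Suc m. log_minus (x (j + t) - pivot A k x (j + t) (Suc m + 1 - t) z) + 4
        * norm (z - x (j + t)))
      = (\<Sum>t=1..m. log_minus (x (j + Suc t) - pivot A k x (j + Suc t) (Suc m + 1 - Suc t) z) + 4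
          * norm (z - x (j + Suc t)))"
      by (rule sum.shift_bounds_cl_Suc_ivl)
    finally show ?thesis by simp
  qed
  finally show ?case .
qed

section \<open>Comparison of the potentials for a fixed outcome\<close>

lemma borel_measurable_sum_mset [measurable (raw)]:
  fixes f :: "'c \<Rightarrow> 'a \<Rightarrow> real"
  assumes "\<And>w. f w \<in> borel_measurable M"
  shows "(\<lambda>z. \<Sum>w\<in>#A. f w z) \<in> borel_measurable M"
  by (induction A) (auto intro!: borel_measurable_add assms)

lemma sum_mset_nonneg_real: "(\<And>w. 0 \<le> f w) \<Longrightarrow> 0 \<le> (\<Sum>w\<in>#A. f w :: real)"
  by (induction A) (auto intro: add_nonneg_nonneg)

lemma nn_integral_sum_mset_le:
  fixes f :: "'c \<Rightarrow> 'a \<Rightarrow> real"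
  assumes [measurable]: "\<And>w. f w \<in> borel_measurable M" "D \<in> sets M"
    and nn: "\<And>w z. 0 \<le> f w z"
    and le: "\<And>w. (\<integral>\<^sup>+z. ennreal (f w z) * indicator D z \<partial>M) \<le> c"
  shows "(\<integral>\<^sup>+z. ennreal (\<Sum>w\<in>#A. f w z) * indicator D z \<partial>M) \<le> of_nat (size A) * c"
proof (induction A)
  case (add a A)
  have "(\<integral>\<^sup>+z. ennreal (\<Sum>w\<in>#add_mset a A. f w z) * indicator D z \<partial>M)
     = (\<integral>\<^sup>+z. ennreal (f a z) * indicator D z + ennreal (\<Sum>w\<in>#A. f w z) * indicator D z \<partial>M)"
    by (intro nn_integral_cong) (simp add: nn sum_mset_nonneg_real distrib_right)
  also have "\<dots> = (\<integral>\<^sup>+z. ennreal (f a z) * indicator D z \<partial>M) + (\<integral>\<^sup>+z. ennreal (\<Sum>w\<in>#A. f w z)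
      * indicator D z \<partial>M)"
    by (rule nn_integral_add) measurable
  also have "\<dots> \<le> c + of_nat (size A) * c"
    by (intro add_mono le add.IH)
  finally show ?case by (simp add: distrib_right)
qed simp

lemma sum_mset_potential:
  fixes G :: "complex \<Rightarrow> real"
  assumes G: "G \<in> borel_measurable borel" "\<And>z. \<bar>G z\<bar> \<le> B" "\<And>z. norm z \<ge> R \<Longrightarrow> G z = 0" "R \<ge> 0"
  shows "integrable lborel (\<lambda>z. G z * log_norm_roots P z)"
    and "(\<Sum>w\<in>#proots P. \<integral>z. G z * ln (norm (z - w)) \<partial>lborel) = (\<integral>z. G z * log_norm_roots P z
        \<partial>lborel)"
proof -
  have int: "integrable lborel (\<lambda>z. G z * (\<Sum>w\<in>#S. ln (norm (z - w))))" for S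
    using integrable_potential[OF G] by (induction S) (auto simp: distrib_left)
  then show "integrable lborel (\<lambda>z. G z * log_norm_roots P z)" by (simp add: log_norm_roots_def)
  have "(\<Sum>w\<in>#S. \<integral>z. G z * ln (norm (z - w)) \<partial>lborel) = (\<integral>z. G z * (\<Sum>w\<in>#S. ln (norm (z - w)))
      \<partial>lborel)" for S
    using integrable_potential[OF G] int by (induction S) (auto simp: distrib_left)
  then show "(\<Sum>w\<in>#proots P. \<integral>z. G z * ln (norm (z - w)) \<partial>lborel) = (\<integral>z. G z * log_norm_roots P z
      \<partial>lborel)"
    by (simp add: log_norm_roots_def)
qed

lemma degree_tail_poly: "A \<noteq> 0 \<Longrightarrow> degree (tail_poly A k x j) = degree A + (k - j)"
  unfolding tail_poly_def by (simp add: degree_mult_prod_linear)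

lemma finite_roots_higher_pderiv:
  fixes P :: "complex poly"
  assumes "P \<noteq> 0" "n \<le> degree P"
  shows "finite {z. poly ((pderiv ^^ n) P) z = 0}"
proof -
  have "coeff ((pderiv ^^ n) P) (degree P - n) \<noteq> 0"
    unfolding coeff_higher_pderiv pochhammer_of_nat mult_eq_0_iff of_nat_eq_0_iff
    using assms pochhammer_pos[of "Suc (degree P - n)" n] by simp
  then have "(pderiv ^^ n) P \<noteq> 0" by auto
  then show ?thesis by (rule poly_roots_finite)
qed

text \<open>Differentiating \<open>l\<close> times brings in a falling factorial of the degree with
  \<open>l\<close> factors. Its logarithm is the price of passing from the ratio of the polynomials
  to that of their monic versions in the lower bound.\<close>

lemma lead_coeff_higher_pderiv_norm_le:
  fixes P :: "complex poly"
  assumes "l \<le> degree P"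
  shows "norm (lead_coeff ((pderiv ^^ l) P)) \<le> real (degree P) ^ l * norm (lead_coeff P)"
proof -
  have "pochhammer (Suc (degree P - l)) l \<le> degree P ^ l"
  proof -
    have "pochhammer (Suc (degree P - l)) l = (\<Prod>i = 0..<l. Suc (degree P - l) + i)"
      by (simp add: pochhammer_prod)
    also have "\<dots> \<le> (\<Prod>i = 0..<l. degree P)" using assms by (intro prod_mono) auto
    finally show ?thesis by simp
  qed
  then have "real (pochhammer (Suc (degree P - l)) l) \<le> real (degree P ^ l)"
      by (simp only: of_nat_le_iff)
  moreover have "norm (pochhammer (of_nat (Suc (degree P - l)) :: complex) l)
      = real (pochhammer (Suc (degree P - l)) l)"
    unfolding pochhammer_of_nat norm_of_nat ..
  ultimately show ?thesis
    using assms unfolding degree_higher_pderiv coeff_higher_pderiv norm_mult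
    by (intro mult_mono) auto
qed

lemma nn_integral_cmult_add3:
  assumes "f \<in> borel_measurable M" "g \<in> borel_measurable M" "h \<in> borel_measurable M"
  shows "(\<integral>\<^sup>+z. b * (f z + g z + h z) \<partial>M) = b * ((\<integral>\<^sup>+z. f z \<partial>M) + (\<integral>\<^sup>+z. g z \<partial>M) + (\<integral>\<^sup>+z. h z \<partial>M))"
  using assms by (simp add: nn_integral_cmult nn_integral_add)

text \<open>A deterministic statement with three sources of error. The first summand comes from
  averages of \<open>1 / \<bar>z - w\<bar>\<close>, the second from the leading coefficients and
  from the size of the \<open>x t\<close>, the third from the nearness of \<open>x t\<close> to its
  pivot. Only the third needs the joint law of the random roots.\<close>

lemma potential_difference_le:
  fixes A :: "complex poly" and x :: "nat \<Rightarrow> complex" and G :: "complex \<Rightarrow> real"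
  assumes A: "A \<noteq> 0" and l: "l \<le> k" "l \<le> degree A" "1 \<le> degree A"
    and G: "G \<in> borel_measurable borel" "\<And>z. \<bar>G z\<bar> \<le> B" "\<And>z. norm z \<ge> R \<Longrightarrow> G z = 0" "R \<ge> 0"
  defines "\<psi> \<equiv> \<lambda>w. \<integral>z. G z * ln (norm (z - w)) \<partial>lborel"
    and "P \<equiv> A * (\<Prod>j=1..k. [:- x j, 1:])"
  shows "ennreal \<bar>(\<Sum>w\<in>#proots ((pderiv ^^ l) P). \<psi> w) - (\<Sum>w\<in>#proots P. \<psi> w)\<bar>
    \<le> ennreal B * (ennreal (l * (inv_norm_const + pi * R^2))
        + ennreal (pi * R^2 * (l * ln (real (degree A + k)) + 4 * (\<Sum>t=1..l. R + norm (x t))))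
        + (\<Sum>t=1..l. \<integral>\<^sup>+z. ennreal (log_minus (x t - pivot A k x t (l + 1 - t) z)) * indicator
            (ball 0 R) z \<partial>lborel))"
proof -
  define N where "N = degree A + k"
  have N1: "N \<ge> 1" using l by (simp add: N_def)
  have B0: "B \<ge> 0" using G(2)[of 0] by linarith
  have P: "P = tail_poly A k x 0" by (simp add: P_def tail_poly_0)
  have degP: "degree P = N" by (simp add: P degree_tail_poly[OF A] N_def)
  have tp0: "tail_poly A k x i \<noteq> 0" for i
  proof -
    have "degree (tail_poly A k x i) \<ge> 1" using degree_tail_poly[OF A, of k x i] l by simp
    then show ?thesis by auto
  qed
  define Q where "Q = (pderiv ^^ l) P"
  define U where "U = (\<lambda>z. \<Sum>j<l. (\<Sum>w\<in>#proots ((pderiv ^^ j) P). inverse (norm (z - w))) / degree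
      ((pderiv ^^ j) P))"
  define K where "K = l * ln N + 4 * (\<Sum>t=1..l. R + norm (x t))"
  define L where "L = (\<lambda>t z. log_minus (x t - pivot A k x t (l + 1 - t) z))"
  have K0: "K \<ge> 0" using N1 G(4) by (auto simp: K_def intro!: add_nonneg_nonneg sum_nonneg)
  have U0: "U z \<ge> 0" for z by (auto simp: U_def intro!: sum_nonneg divide_nonneg_nonneg
      sum_mset_nonneg_real)
  have L0: "L t z \<ge> 0" for t z by (simp add: L_def)
  have [measurable]: "poly p \<in> borel_measurable borel" for p :: "complex poly"
    by (intro borel_measurable_continuous_onI continuous_intros)
  have [measurable]: "L t \<in> borel_measurable borel" for t
    unfolding L_def pivot_def by measurable
  have [measurable]: "U \<in> borel_measurable borel" unfolding U_def by measurable
  \<comment> \<open>The estimates of logarithms require that these derivatives do not vanish at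
    \<open>z\<close>; the exceptional set is finite, hence null.\<close>
  have fin: "finite (\<Union>i\<in>{..k}. \<Union>n\<in>{..l}. {z. poly ((pderiv ^^ n) (tail_poly A k x i)) z = 0})"
    by (intro finite_UN_I finite_roots_higher_pderiv tp0) (use l degree_tail_poly[OF A] in auto)
  have AE: "AE z in lborel. norm (G z * (log_norm_roots Q z - log_norm_roots P z))
      \<le> B * ((U z + K + (\<Sum>t=1..l. L t z)) * indicator (ball 0 R) z)"
    using AE_not_in[OF finite_imp_null_set_lborel[OF fin]]
  proof eventually_elim
    case (elim z)
    then have nz: "\<And>i n. i \<le> k \<Longrightarrow> n \<le> l \<Longrightarrow> poly ((pderiv ^^ n) (tail_poly A k x i)) z \<noteq> 0" by auto
    show ?case
    proof (cases "norm z < R")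
      case True
      have up: "log_norm_roots Q z - log_norm_roots P z \<le> U z"
        unfolding Q_def U_def by (rule log_norm_roots_higher_pderiv_le) (use nz[of 0] in \<open>auto
            simp: P\<close>)
      have QP: "poly Q z \<noteq> 0" "poly P z \<noteq> 0" using nz[of 0 l] nz[of 0 0] by (auto simp: P Q_def)
      then have lead: "lead_coeff Q \<noteq> 0" "lead_coeff P \<noteq> 0" by auto
      have "ln (norm (lead_coeff Q)) \<le> ln (real N ^ l * norm (lead_coeff P))"
        using lead_coeff_higher_pderiv_norm_le[of l P] lead l N1 unfolding Q_def[symmetric] degP
        by (subst ln_le_cancel_iff) (auto simp: N_def)
      also have "\<dots> = l * ln N + ln (norm (lead_coeff P))"
        using lead N1 by (simp add: ln_mult ln_realpow)
      finally have leadle: "ln (norm (lead_coeff Q)) \<le> l * ln N + ln (norm (lead_coeff P))" .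
      have "- ln (norm (poly Q z / poly P z)) \<le> (\<Sum>t=1..l. log_minus (x (0 + t) - pivot A k x (0
          + t) (l + 1 - t) z) + 4 * norm (z - x (0 + t)))"
        unfolding Q_def P by (rule neg_ln_tail_poly_ratio_le) (use l nz in auto)
      also have "\<dots> \<le> (\<Sum>t=1..l. L t z + 4 * (R + norm (x t)))"
      proof (rule sum_mono)
        fix t
        show "log_minus (x (0 + t) - pivot A k x (0 + t) (l + 1 - t) z) + 4 * norm (z - x (0 + t))
            \<le> L t z + 4 * (R + norm (x t))"
          using norm_triangle_ineq4[of z "x t"] True by (simp add: L_def)
      qed
      also have "\<dots> = (\<Sum>t=1..l. L t z) + 4 * (\<Sum>t=1..l. R + norm (x t))"
        by (simp only: sum.distrib[of "\<lambda>t. L t z"] sum_distrib_left)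
      finally have "- ln (norm (poly Q z / poly P z)) \<le> (\<Sum>t=1..l. L t z) + 4 * (\<Sum>t=1..l. R
          + norm (x t))" .
      moreover have "ln (norm (poly Q z / poly P z)) = ln (norm (lead_coeff Q)) + log_norm_roots Q
          z - (ln (norm (lead_coeff P)) + log_norm_roots P z)"
        using ln_norm_poly[OF QP(1)] ln_norm_poly[OF QP(2)] QP by (simp add: norm_divide ln_div)
      ultimately have "log_norm_roots P z - log_norm_roots Q z \<le> K + (\<Sum>t=1..l. L t z)"
        using leadle unfolding K_def by linarith
      then have "\<bar>log_norm_roots Q z - log_norm_roots P z\<bar> \<le> U z + K + (\<Sum>t=1..l. L t z)"
        using up U0[of z] K0 sum_nonneg[of "{1..l}" "\<lambda>t. L t z", OF L0] by linarith
      then show ?thesis using True G(2)[of z] B0 by (auto simp: abs_mult intro!: mult_mono)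
    next
      case False
      then show ?thesis using G(3)[of z] by simp
    qed
  qed
  define c where "c = inv_norm_const + pi * R^2"
  have c0: "c \<ge> 0" by (simp add: c_def)
  have em: "emeasure lborel (ball (0::complex) R) = ennreal (pi * R^2)"
    by (rule emeasure_lborel_ball_complex[OF G(4)])
  have IU: "(\<integral>\<^sup>+z. ennreal (U z) * indicator (ball 0 R) z \<partial>lborel) \<le> ennreal (l * c)"
  proof -
    define S where "S = (\<lambda>j z. \<Sum>w\<in>#proots ((pderiv ^^ j) P). inverse (norm (z - w)))"
    define d where "d = (\<lambda>j. degree ((pderiv ^^ j) P))"
    have [measurable]: "S j \<in> borel_measurable borel" for j unfolding S_def by measurable
    have S0: "S j z \<ge> 0" for j z by (auto simp: S_def intro!: sum_mset_nonneg_real)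
    have "(\<integral>\<^sup>+z. ennreal (U z) * indicator (ball 0 R) z \<partial>lborel)
        = (\<integral>\<^sup>+z. (\<Sum>j<l. ennreal (1 / d j) * (ennreal (S j z) * indicator (ball 0 R) z)) \<partial>lborel)"
    proof (rule nn_integral_cong)
      fix z
      have "ennreal (U z) = (\<Sum>j<l. ennreal (S j z / d j))"
      proof -
        have "U z = (\<Sum>j<l. S j z / d j)" by (simp add: U_def S_def d_def)
        moreover have "(\<Sum>j<l. ennreal (S j z / d j)) = ennreal (\<Sum>j<l. S j z / d j)"
          by (rule sum_ennreal) (simp add: S0)
        ultimately show ?thesis by simp
      qed
      also have "\<dots> = (\<Sum>j<l. ennreal (1 / d j) * ennreal (S j z))"
      proof (rule sum.cong[OF refl])
        fix j
        have "S j z / d j = 1 / d j * S j z" by simp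
        then show "ennreal (S j z / d j) = ennreal (1 / d j) * ennreal (S j z)"
          using S0[of j z] by (simp only: ennreal_mult'' )
      qed
      finally show "ennreal (U z) * indicator (ball 0 R) z
          = (\<Sum>j<l. ennreal (1 / d j) * (ennreal (S j z) * indicator (ball 0 R) z))"
        by (simp add: sum_distrib_right mult.assoc)
    qed
    also have "\<dots> = (\<Sum>j<l. ennreal (1 / d j) * (\<integral>\<^sup>+z. ennreal (S j z) * indicator (ball 0 R) z
        \<partial>lborel))"
    proof -
      have "(\<integral>\<^sup>+z. (\<Sum>j<l. ennreal (1 / d j) * (ennreal (S j z) * indicator (ball 0 R) z)) \<partial>lborel)
          = (\<Sum>j<l. \<integral>\<^sup>+z. ennreal (1 / d j) * (ennreal (S j z) * indicator (ball 0 R) z) \<partial>lborel)"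
        by (rule nn_integral_sum) measurable
      also have "\<dots> = (\<Sum>j<l. ennreal (1 / d j) * (\<integral>\<^sup>+z. ennreal (S j z) * indicator (ball 0 R) z
          \<partial>lborel))"
        by (rule sum.cong[OF refl], rule nn_integral_cmult) measurable
      finally show ?thesis .
    qed
    \<comment> \<open>The \<open>j\<close>-th derivative has \<open>d j\<close> zeros and each
      contributes at most \<open>c\<close>, wherever it lies, so the division by \<open>d j\<close>
      leaves \<open>c\<close>.\<close>
    also have "\<dots> \<le> (\<Sum>j<l. ennreal c)"
    proof (rule sum_mono)
      fix j assume "j \<in> {..<l}"
      then have d: "d j > 0" using l by (simp add: d_def degree_higher_pderiv degP N_def)
      have "(\<integral>\<^sup>+z. ennreal (S j z) * indicator (ball 0 R) z \<partial>lborel)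
          \<le> of_nat (size (proots ((pderiv ^^ j) P))) * ennreal c"
        unfolding S_def
      proof (rule nn_integral_sum_mset_le)
        fix w :: complex
        show "(\<integral>\<^sup>+z. ennreal (inverse (norm (z - w))) * indicator (ball 0 R) z \<partial>lborel) \<le> ennreal c"
          using nn_integral_inverse_norm_le[of "ball 0 R" w] unfolding em by (simp add: c_def)
      qed auto
      also have "\<dots> = ennreal (d j * c)"
        using c0 by (simp add: size_proots_complex d_def ennreal_mult ennreal_of_nat_eq_real_of_nat)
      finally have "ennreal (1 / d j) * (\<integral>\<^sup>+z. ennreal (S j z) * indicator (ball 0 R) z \<partial>lborel)
          \<le> ennreal (1 / d j) * ennreal (d j * c)"
        by (rule mult_left_mono) simp
      also have "\<dots> = ennreal c" using d c0 by (simp add: ennreal_mult'[symmetric])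
      finally show "ennreal (1 / d j) * (\<integral>\<^sup>+z. ennreal (S j z) * indicator (ball 0 R) z \<partial>lborel)
          \<le> ennreal c" .
    qed
    also have "\<dots> = ennreal (l * c)" using c0
        by (simp add: ennreal_mult ennreal_of_nat_eq_real_of_nat)
    finally show ?thesis .
  qed
  have "(\<Sum>w\<in>#proots Q. \<psi> w) - (\<Sum>w\<in>#proots P. \<psi> w) = (\<integral>z. G z * (log_norm_roots Q z
      - log_norm_roots P z) \<partial>lborel)"
    unfolding \<psi>_def right_diff_distrib
    using sum_mset_potential(2)[OF G, of Q] sum_mset_potential(2)[OF G, of P]
    by (simp add: Bochner_Integration.integral_diff sum_mset_potential(1)[OF G])
  also have "ennreal \<bar>\<dots>\<bar> \<le> (\<integral>\<^sup>+z. ennreal (norm (G z * (log_norm_roots Q z - log_norm_roots P z)))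
      \<partial>lborel)"
    unfolding real_norm_def[symmetric]
    by (rule integral_norm_bound_ennreal) (simp add: right_diff_distrib sum_mset_potential(1)[OF G])
  also have "\<dots> \<le> (\<integral>\<^sup>+z. ennreal B * (ennreal (U z) * indicator (ball 0 R) z + ennreal K
      * indicator (ball 0 R) z
      + (\<Sum>t=1..l. ennreal (L t z) * indicator (ball 0 R) z)) \<partial>lborel)"
  proof (rule nn_integral_mono_AE, use AE in eventually_elim)
    case (elim z)
    have "ennreal (norm (G z * (log_norm_roots Q z - log_norm_roots P z)))
        \<le> ennreal (B * ((U z + K + (\<Sum>t=1..l. L t z)) * indicator (ball 0 R) z))"
      by (rule ennreal_leI[OF elim])
    also have "\<dots> = ennreal B * (ennreal (U z + K + (\<Sum>t=1..l. L t z)) * indicator (ball 0 R) z)"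
      using B0 U0 K0 L0 by (simp add: ennreal_mult sum_nonneg ennreal_indicator del: ennreal_plus)
    also have "ennreal (U z + K + (\<Sum>t=1..l. L t z)) = ennreal (U z) + ennreal K + (\<Sum>t=1..l.
        ennreal (L t z))"
      using U0 K0 L0 by (simp add: sum_nonneg sum_ennreal)
    finally show ?case by (simp add: distrib_right sum_distrib_right)
  qed
  also have "\<dots> = ennreal B * ((\<integral>\<^sup>+z. ennreal (U z) * indicator (ball 0 R) z \<partial>lborel) + ennreal K
      * ennreal (pi * R^2)
      + (\<Sum>t=1..l. \<integral>\<^sup>+z. ennreal (L t z) * indicator (ball 0 R) z \<partial>lborel))"
  proof -
    have "(\<integral>\<^sup>+z. (\<Sum>t=1..l. ennreal (L t z) * indicator (ball 0 R) z) \<partial>lborel)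
        = (\<Sum>t=1..l. \<integral>\<^sup>+z. ennreal (L t z) * indicator (ball 0 R) z \<partial>lborel)"
      by (rule nn_integral_sum) measurable
    moreover have "(\<integral>\<^sup>+z. ennreal K * indicator (ball 0 R) z \<partial>(lborel :: complex measure))
        = ennreal K * ennreal (pi * R^2)"
      by (simp add: nn_integral_cmult_indicator em)
    moreover have "(\<integral>\<^sup>+z. ennreal B * (ennreal (U z) * indicator (ball 0 R) z + ennreal K
        * indicator (ball 0 R) z
      + (\<Sum>t=1..l. ennreal (L t z) * indicator (ball 0 R) z)) \<partial>lborel)
      = ennreal B * ((\<integral>\<^sup>+z. ennreal (U z) * indicator (ball 0 R) z \<partial>lborel)
        + (\<integral>\<^sup>+z. ennreal K * indicator (ball 0 R) z \<partial>(lborel :: complex measure))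
        + (\<integral>\<^sup>+z. (\<Sum>t=1..l. ennreal (L t z) * indicator (ball 0 R) z) \<partial>lborel))"
      by (rule nn_integral_cmult_add3) measurable
    ultimately show ?thesis by (simp only:)
  qed
  also have "ennreal K * ennreal (pi * R^2) = ennreal (pi * R^2 * K)"
    unfolding ennreal_mult'[OF K0, symmetric] by (rule arg_cong[OF mult.commute])
  also have "ennreal B * ((\<integral>\<^sup>+z. ennreal (U z) * indicator (ball 0 R) z \<partial>lborel) + ennreal (pi
      * R^2 * K)
      + (\<Sum>t=1..l. \<integral>\<^sup>+z. ennreal (L t z) * indicator (ball 0 R) z \<partial>lborel))
    \<le> ennreal B * (ennreal (l * c) + ennreal (pi * R^2 * K)
      + (\<Sum>t=1..l. \<integral>\<^sup>+z. ennreal (L t z) * indicator (ball 0 R) z \<partial>lborel))"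
    by (intro mult_left_mono add_mono IU order_refl zero_le)
  finally show ?thesis unfolding Q_def K_def L_def c_def N_def .
qed

section \<open>Anticoncentration\<close>

text \<open>For a fixed value \<open>y\<close> of \<open>Y\<close>, the law of \<open>X\<close> is
  at most \<open>b\<close> times Lebesgue measure, and the Lebesgue integral of the negative part of
  the logarithm is bounded independently of the centre \<open>y\<close>. So the law of
  \<open>Y\<close> may be arbitrary.\<close>

lemma (in prob_space) nn_integral_log_minus_indep_le:
  fixes X Y :: "'a \<Rightarrow> complex"
  assumes indep: "indep_var borel X borel Y"
    and X: "distributed M lborel X (\<lambda>x. ennreal (\<nu> x))" and b: "\<And>x. \<nu> x \<le> b"
  shows "(\<integral>\<^sup>+\<omega>. ennreal (log_minus (X \<omega> - Y \<omega>)) \<partial>M) \<le> ennreal b * ennreal inv_norm_const"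
proof -
  have [measurable]: "X \<in> borel_measurable M" "Y \<in> borel_measurable M"
    using indep by (auto dest: indep_var_rv1 indep_var_rv2)
  have [measurable]: "(\<lambda>x. ennreal (\<nu> x)) \<in> borel_measurable lborel"
    using X by (rule distributed_borel_measurable)
  interpret X: prob_space "distr M borel X" by (rule prob_space_distr) simp
  interpret Y: prob_space "distr M borel Y" by (rule prob_space_distr) simp
  interpret XY: pair_prob_space "distr M borel X" "distr M borel Y" ..
  have dX: "distr M borel X = density lborel (\<lambda>x. ennreal (\<nu> x))"
    using distributed_distr_eq_density[OF X] by (simp cong: distr_cong)
  have "(\<integral>\<^sup>+\<omega>. ennreal (log_minus (X \<omega> - Y \<omega>)) \<partial>M)
      = (\<integral>\<^sup>+p. ennreal (log_minus (fst p - snd p)) \<partial>distr M (borel \<Otimes>\<^sub>M borel) (\<lambda>\<omega>. (X \<omega>, Y \<omega>)))"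
    by (subst nn_integral_distr) auto
  also have "\<dots> = (\<integral>\<^sup>+p. ennreal (log_minus (fst p - snd p)) \<partial>(distr M borel X \<Otimes>\<^sub>M distr M borel Y))"
    using indep unfolding indep_var_distribution_eq by simp
  also have "\<dots> = (\<integral>\<^sup>+y. \<integral>\<^sup>+x. ennreal (log_minus (x - y)) \<partial>distr M borel X \<partial>distr M borel Y)"
    by (subst XY.nn_integral_snd[symmetric]) auto
  also have "\<dots> \<le> (\<integral>\<^sup>+y. ennreal b * ennreal inv_norm_const \<partial>distr M borel Y)"
  proof (rule nn_integral_mono)
    fix y
    have "(\<integral>\<^sup>+x. ennreal (log_minus (x - y)) \<partial>distr M borel X)
        = (\<integral>\<^sup>+x. ennreal (\<nu> x) * ennreal (log_minus (x - y)) \<partial>lborel)"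
      unfolding dX by (rule nn_integral_density) measurable
    also have "\<dots> \<le> (\<integral>\<^sup>+x. ennreal b * ennreal (log_minus (x - y)) \<partial>lborel)"
      by (intro nn_integral_mono mult_right_mono ennreal_leI b) simp
    also have "\<dots> = ennreal b * (\<integral>\<^sup>+x. ennreal (log_minus (x - y)) \<partial>lborel)"
      by (rule nn_integral_cmult) measurable
    also have "\<dots> \<le> ennreal b * ennreal inv_norm_const"
      by (intro mult_left_mono nn_integral_log_minus_le) simp
    finally show "(\<integral>\<^sup>+x. ennreal (log_minus (x - y)) \<partial>distr M borel X)
        \<le> ennreal b * ennreal inv_norm_const" .
  qed
  also have "\<dots> = ennreal b * ennreal inv_norm_const"
    using Y.emeasure_space_1 by simp
  finally show ?thesis .
qed

text \<open>The point of evaluation may vary with \<open>\<omega>\<close>, so that joint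
  measurability in the outcome and \<open>z\<close>, required by Tonelli's theorem, is covered
  too.\<close>

lemma measurable_poly_higher_pderiv_mult_prod:
  fixes A :: "complex poly"
  assumes "finite J" and x: "\<And>i. i \<in> J \<Longrightarrow> (\<lambda>\<omega>. x \<omega> i) \<in> borel_measurable N"
    and Z: "Z \<in> borel_measurable N"
  shows "(\<lambda>\<omega>. poly ((pderiv ^^ m) (A * (\<Prod>i\<in>J. [:- x \<omega> i, 1:]))) (Z \<omega>)) \<in> borel_measurable N"
  using assms(1,2)
proof (induction J arbitrary: m)
  case empty
  have "poly p \<in> borel_measurable borel" for p :: "complex poly"
    by (intro borel_measurable_continuous_onI continuous_intros)
  from measurable_compose[OF Z this] show ?case by simp
next
  case (insert j J)
  have [measurable]: "(\<lambda>\<omega>. poly ((pderiv ^^ m) (A * (\<Prod>i\<in>J. [:- x \<omega> i, 1:]))) (Z \<omega>))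
      \<in> borel_measurable N" for m
    using insert by auto
  have [measurable]: "(\<lambda>\<omega>. x \<omega> j) \<in> borel_measurable N" using insert.prems by simp
  note Z [measurable]
  have "A * (\<Prod>i\<in>insert j J. [:- x \<omega> i, 1:]) = [:- x \<omega> j, 1:] * (A * (\<Prod>i\<in>J. [:- x \<omega> i, 1:]))" for \<omega>
    using insert.hyps by (simp add: algebra_simps)
  then show ?case by (simp only: poly_higher_pderiv_linear_mult) measurable
qed

lemma measurable_pivot:
  assumes "\<And>i. i \<in> {t<..k} \<Longrightarrow> (\<lambda>\<omega>. x \<omega> i) \<in> borel_measurable N" and [measurable]: "Z
      \<in> borel_measurable N"
  shows "(\<lambda>\<omega>. pivot A k (x \<omega>) t m (Z \<omega>)) \<in> borel_measurable N"
proof -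
  have [measurable]: "(\<lambda>\<omega>. poly ((pderiv ^^ n) (tail_poly A k (x \<omega>) t)) (Z \<omega>))
      \<in> borel_measurable N" for n
    unfolding tail_poly_def by (intro measurable_poly_higher_pderiv_mult_prod) (use assms in auto)
  show ?thesis unfolding pivot_def by measurable
qed

lemma pivot_cong: "(\<And>i. i \<in> {t<..k} \<Longrightarrow> x i = y i) \<Longrightarrow> pivot A k x t m z = pivot A k y t m z"
proof -
  assume "\<And>i. i \<in> {t<..k} \<Longrightarrow> x i = y i"
  then have "tail_poly A k x t = tail_poly A k y t"
    unfolding tail_poly_def by (intro arg_cong[of _ _ "(*) A"] prod.cong) auto
  then show ?thesis by (simp add: pivot_def)
qed

text \<open>Tonelli's theorem moves the expectation inside, where \<open>z\<close> is fixed. The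
  pivot is then a function of the \<open>X i\<close> with \<open>i > t\<close>, hence independent of
  \<open>X t\<close>, and the bounded density gives a bound uniform in \<open>z\<close> and in the
  polynomial \<open>A\<close>.\<close>

lemma (in prob_space) nn_integral_log_minus_pivot_le:
  fixes X :: "nat \<Rightarrow> 'a \<Rightarrow> complex"
  assumes indep: "indep_vars (\<lambda>_. borel) X {1..k}" and t: "t \<in> {1..k}"
    and dens: "distributed M lborel (X t) (\<lambda>x. ennreal (\<nu> x))" and b: "\<And>x. \<nu> x \<le> b" and R: "R \<ge> 0"
  shows "(\<integral>\<^sup>+\<omega>. (\<integral>\<^sup>+z. ennreal (log_minus (X t \<omega> - pivot A k (\<lambda>i. X i \<omega>) t m z)) * indicator (ball
      0 R) z \<partial>lborel) \<partial>M)
    \<le> ennreal b * ennreal inv_norm_const * ennreal (pi * R^2)" (is "?L \<le> _")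
    and "(\<lambda>\<omega>. \<integral>\<^sup>+z. ennreal (log_minus (X t \<omega> - pivot A k (\<lambda>i. X i \<omega>) t m z)) * indicator (ball 0
        R) z \<partial>lborel) \<in> borel_measurable M"
proof -
  have X: "X i \<in> borel_measurable M" if "i \<in> {1..k}" for i
    using indep that unfolding indep_vars_def by auto
  note X[OF t, measurable]
  have [measurable]: "(\<lambda>p. pivot A k (\<lambda>i. X i (fst p)) t m (snd p))
      \<in> borel_measurable (M \<Otimes>\<^sub>M lborel)"
  proof (rule measurable_pivot)
    fix i assume "i \<in> {t<..k}"
    then have "X i \<in> borel_measurable M" using t by (intro X) auto
    then show "(\<lambda>p. X i (fst p)) \<in> borel_measurable (M \<Otimes>\<^sub>M lborel)" by measurable
  qed measurable
  have meas: "(\<lambda>(\<omega>, z). ennreal (log_minus (X t \<omega> - pivot A k (\<lambda>i. X i \<omega>) t m z)) * indicator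
      (ball 0 R) z)
      \<in> borel_measurable (M \<Otimes>\<^sub>M lborel)"
    unfolding split_beta by measurable
  interpret pair_sigma_finite M "lborel :: complex measure" ..
  show "(\<lambda>\<omega>. \<integral>\<^sup>+z. ennreal (log_minus (X t \<omega> - pivot A k (\<lambda>i. X i \<omega>) t m z)) * indicator (ball 0
      R) z \<partial>lborel) \<in> borel_measurable M"
    using meas by measurable
  have "?L = (\<integral>\<^sup>+z. (\<integral>\<^sup>+\<omega>. ennreal (log_minus (X t \<omega> - pivot A k (\<lambda>i. X i \<omega>) t m z)) * indicator
      (ball 0 R) z \<partial>M) \<partial>lborel)"
    using Fubini'[OF meas] by simp
  also have "\<dots> \<le> (\<integral>\<^sup>+z. (ennreal b * ennreal inv_norm_const) * indicator (ball 0 R) z \<partial>(lborel ::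
      complex measure))"
  proof (rule nn_integral_mono)
    fix z :: complex
    have meas_pz: "(\<lambda>f. pivot A k f t m z) \<in> borel_measurable (PiM {t<..k} (\<lambda>_. borel))"
      by (rule measurable_pivot) measurable
    have "indep_var (PiM {t} (\<lambda>_. borel)) (\<lambda>\<omega>. restrict (\<lambda>i. X i \<omega>) {t})
        (PiM {t<..k} (\<lambda>_. borel)) (\<lambda>\<omega>. restrict (\<lambda>i. X i \<omega>) {t<..k})"
      by (rule indep_var_restrict[OF indep]) (use t in auto)
    then have "indep_var borel ((\<lambda>f. f t) \<circ> (\<lambda>\<omega>. restrict (\<lambda>i. X i \<omega>) {t}))
        borel ((\<lambda>f. pivot A k f t m z) \<circ> (\<lambda>\<omega>. restrict (\<lambda>i. X i \<omega>) {t<..k}))"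
      by (rule indep_var_compose) (use meas_pz in auto)
    moreover have "(\<lambda>f. f t) \<circ> (\<lambda>\<omega>. restrict (\<lambda>i. X i \<omega>) {t}) = X t" by (auto simp: fun_eq_iff)
    moreover have "(\<lambda>f. pivot A k f t m z) \<circ> (\<lambda>\<omega>. restrict (\<lambda>i. X i \<omega>) {t<..k})
        = (\<lambda>\<omega>. pivot A k (\<lambda>i. X i \<omega>) t m z)"
      by (auto simp: fun_eq_iff intro: pivot_cong)
    ultimately have iv: "indep_var borel (X t) borel (\<lambda>\<omega>. pivot A k (\<lambda>i. X i \<omega>) t m z)" by simp
    have [measurable]: "(\<lambda>\<omega>. pivot A k (\<lambda>i. X i \<omega>) t m z) \<in> borel_measurable M"
      by (rule indep_var_rv2[OF iv])
    have "(\<integral>\<^sup>+\<omega>. ennreal (log_minus (X t \<omega> - pivot A k (\<lambda>i. X i \<omega>) t m z)) * indicator (ball 0 R)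
        z \<partial>M)
        = (\<integral>\<^sup>+\<omega>. ennreal (log_minus (X t \<omega> - pivot A k (\<lambda>i. X i \<omega>) t m z)) \<partial>M) * indicator (ball 0
            R) z"
      by (rule nn_integral_multc) measurable
    also have "\<dots> \<le> (ennreal b * ennreal inv_norm_const) * indicator (ball 0 R) z"
      by (intro mult_right_mono nn_integral_log_minus_indep_le[OF iv dens b]) simp
    finally show "(\<integral>\<^sup>+\<omega>. ennreal (log_minus (X t \<omega> - pivot A k (\<lambda>i. X i \<omega>) t m z)) * indicator
        (ball 0 R) z \<partial>M)
        \<le> (ennreal b * ennreal inv_norm_const) * indicator (ball 0 R) z" .
  qed
  also have "\<dots> = ennreal b * ennreal inv_norm_const * ennreal (pi * R^2)"
    by (simp add: nn_integral_cmult_indicator emeasure_lborel_ball_complex[OF R])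
  finally show "?L \<le> ennreal b * ennreal inv_norm_const * ennreal (pi * R^2)" .
qed

section \<open>Convergence in probability\<close>

text \<open>The events \<open>E n\<close> spare us the measurability of \<open>P n\<close>.\<close>

definition whp :: "'w measure \<Rightarrow> (nat \<Rightarrow> 'w \<Rightarrow> bool) \<Rightarrow> bool" where
  "whp M P \<longleftrightarrow> (\<exists>E. (\<forall>n. E n \<in> sets M) \<and> (\<lambda>n. measure M (E n))
      \<longlonglongrightarrow> 1 \<and> (\<forall>\<^sub>F n in sequentially. \<forall>\<omega>\<in>E n. P n \<omega>))"

lemma whp_mono:
  assumes "whp M P" and PQ: "\<forall>\<^sub>F n in sequentially. \<forall>\<omega>\<in>space M. P n \<omega> \<longrightarrow> Q n \<omega>"
  shows "whp M Q"
proof -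
  obtain E where E: "\<And>n. E n \<in> sets M" "(\<lambda>n. measure M (E n)) \<longlonglongrightarrow> 1"
      "\<forall>\<^sub>F n in sequentially. \<forall>\<omega>\<in>E n. P n \<omega>"
    using assms(1) unfolding whp_def by auto
  have "\<forall>\<^sub>F n in sequentially. \<forall>\<omega>\<in>E n. Q n \<omega>"
    using E(3) PQ by eventually_elim (use sets.sets_into_space[OF E(1)] in blast)
  with E show ?thesis unfolding whp_def by blast
qed

lemma (in prob_space) tendsto_prob_Int:
  assumes "\<And>n. E n \<in> events" "\<And>n. F n \<in> events" "(\<lambda>n. prob (E n)) \<longlonglongrightarrow> 1" "(\<lambda>n. prob (F n)) \<longlonglongrightarrow> 1"
  shows "(\<lambda>n. prob (E n \<inter> F n)) \<longlonglongrightarrow> 1"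
proof (rule tendsto_sandwich[of "\<lambda>n. prob (E n) + prob (F n) - 1" _ _ "\<lambda>_. 1"])
  have "prob (E n) + prob (F n) - 1 \<le> prob (E n \<inter> F n)" for n
  proof -
    have "prob (E n \<union> F n) = prob (E n) + prob (F n) - prob (E n \<inter> F n)"
      using assms(1,2) by (intro measure_Un3) (auto simp: fmeasurable_eq_sets)
    moreover have "prob (E n \<union> F n) \<le> 1" by simp
    ultimately show ?thesis by linarith
  qed
  then show "\<forall>\<^sub>F n in sequentially. prob (E n) + prob (F n) - 1 \<le> prob (E n \<inter> F n)" by simp
  show "(\<lambda>n. prob (E n) + prob (F n) - 1) \<longlonglongrightarrow> 1"
    using tendsto_diff[OF tendsto_add[OF assms(3,4)] tendsto_const[of 1]] by simp
qed auto

lemma (in prob_space) whp_conj: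
  assumes "whp M P" "whp M Q"
  shows "whp M (\<lambda>n \<omega>. P n \<omega> \<and> Q n \<omega>)"
proof -
  obtain E F where E: "\<And>n. E n \<in> events" "(\<lambda>n. prob (E n)) \<longlonglongrightarrow> 1"
      "\<forall>\<^sub>F n in sequentially. \<forall>\<omega>\<in>E n. P n \<omega>"
    and F: "\<And>n. F n \<in> events" "(\<lambda>n. prob (F n)) \<longlonglongrightarrow> 1" "\<forall>\<^sub>F n in sequentially. \<forall>\<omega>\<in>F n. Q n \<omega>"
    using assms unfolding whp_def by auto
  have "\<forall>\<^sub>F n in sequentially. \<forall>\<omega>\<in>E n \<inter> F n. P n \<omega> \<and> Q n \<omega>"
    using E(3) F(3) by eventually_elim auto
  then show ?thesis unfolding whp_def
    using E F tendsto_prob_Int[OF E(1) F(1) E(2) F(2)] by (intro exI[of _ "\<lambda>n. E n \<inter> F n"]) auto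
qed

lemma (in prob_space) tendsto_prob_if_whp:
  assumes "whp M P" "\<forall>\<^sub>F n in sequentially. {\<omega> \<in> space M. P n \<omega>} \<in> events"
  shows "(\<lambda>n. prob {\<omega> \<in> space M. P n \<omega>}) \<longlonglongrightarrow> 1"
proof -
  obtain E where E: "\<And>n. E n \<in> events" "(\<lambda>n. prob (E n)) \<longlonglongrightarrow> 1" "\<forall>\<^sub>F n in sequentially. \<forall>\<omega>\<in>E n. P n \<omega>"
    using assms unfolding whp_def by auto
  show ?thesis
  proof (rule tendsto_sandwich[OF _ _ E(2) tendsto_const])
    show "\<forall>\<^sub>F n in sequentially. prob (E n) \<le> prob {\<omega> \<in> space M. P n \<omega>}"
      using E(3) assms(2)
    proof eventually_elim
      case (elim n)
      then show ?case using E(1)[of n] sets.sets_into_space[OF E(1)[of n]]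
        by (intro finite_measure_mono) auto
    qed
  qed auto
qed

text \<open>Markov's inequality. The threshold \<open>sqrt n\<close> tends to infinity and is still
  negligible against the number of zeros.\<close>

lemma (in prob_space) whp_le_sqrt:
  fixes S :: "nat \<Rightarrow> 'a \<Rightarrow> ennreal"
  assumes [measurable]: "\<And>n. S n \<in> borel_measurable M" and c: "\<And>n. (\<integral>\<^sup>+\<omega>. S n \<omega> \<partial>M) \<le> ennreal c"
  shows "whp M (\<lambda>n \<omega>. S n \<omega> \<le> ennreal (sqrt n))"
proof -
  define E where "E = (\<lambda>n. {\<omega> \<in> space M. S n \<omega> \<le> ennreal (sqrt n)})"
  define c' where "c' = max c 0"
  have E [measurable]: "E n \<in> events" for n unfolding E_def by measurable
  have "1 - c' / sqrt n \<le> prob (E n)" if n: "n > 0" for n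
  proof -
    have "emeasure M {\<omega> \<in> space M. 1 \<le> ennreal (1 / sqrt n) * S n \<omega>}
        \<le> ennreal (1 / sqrt n) * (\<integral>\<^sup>+\<omega>. S n \<omega> * indicator (space M) \<omega> \<partial>M)"
      by (rule nn_integral_Markov_inequality) auto
    also have "(\<integral>\<^sup>+\<omega>. S n \<omega> * indicator (space M) \<omega> \<partial>M) = (\<integral>\<^sup>+\<omega>. S n \<omega> \<partial>M)"
      by (intro nn_integral_cong) auto
    also have "ennreal (1 / sqrt n) * \<dots> \<le> ennreal (1 / sqrt n) * ennreal c'"
      by (intro mult_left_mono order_trans[OF c] ennreal_leI) (auto simp: c'_def)
    also have "\<dots> = ennreal (c' / sqrt n)" by (subst ennreal_mult'[symmetric]) (auto simp: c'_def)
    finally have mk: "emeasure M {\<omega> \<in> space M. 1 \<le> ennreal (1 / sqrt n) * S n \<omega>}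
        \<le> ennreal (c' / sqrt n)" .
    have "space M - E n \<subseteq> {\<omega> \<in> space M. 1 \<le> ennreal (1 / sqrt n) * S n \<omega>}"
    proof
      fix \<omega> assume "\<omega> \<in> space M - E n"
      then have w: "\<omega> \<in> space M" "ennreal (sqrt n) \<le> S n \<omega>" by (auto simp: E_def)
      have "1 = ennreal (1 / sqrt n) * ennreal (sqrt n)"
        using n by (subst ennreal_mult'[symmetric]) auto
      also have "\<dots> \<le> ennreal (1 / sqrt n) * S n \<omega>" by (intro mult_left_mono w) simp
      finally show "\<omega> \<in> {\<omega> \<in> space M. 1 \<le> ennreal (1 / sqrt n) * S n \<omega>}" using w by simp
    qed
    then have "emeasure M (space M - E n) \<le> ennreal (c' / sqrt n)"
      by (intro order_trans[OF emeasure_mono mk]) auto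
    then have "prob (space M - E n) \<le> c' / sqrt n"
      unfolding emeasure_eq_measure by (subst (asm) ennreal_le_iff) (auto simp: c'_def)
    then show ?thesis using prob_compl[OF E[of n]] by linarith
  qed
  then have "(\<lambda>n. prob (E n)) \<longlonglongrightarrow> 1"
  proof (intro tendsto_sandwich[of "\<lambda>n. 1 - c' / sqrt n" "\<lambda>n. prob (E n)" _ "\<lambda>_. 1"])
    show "(\<lambda>n. 1 - c' / sqrt (real n)) \<longlonglongrightarrow> 1" by real_asymp
  qed (auto intro: eventually_sequentiallyI[of 1])
  then show ?thesis unfolding whp_def by (intro exI[of _ E]) (auto simp: E_def)
qed

text \<open>A fixed real random variable is finite, so its sublevel sets exhaust the space. No
  moment is assumed, so Markov's inequality would not do for the norms of the random roots.\<close>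

lemma (in prob_space) whp_bounded_by_sqrt:
  fixes Z :: "'a \<Rightarrow> real"
  assumes [measurable]: "Z \<in> borel_measurable M"
  shows "whp M (\<lambda>n \<omega>. Z \<omega> \<le> sqrt n)"
proof -
  define E where "E = (\<lambda>n::nat. {\<omega> \<in> space M. Z \<omega> \<le> sqrt n})"
  have "(\<lambda>n. prob (E n)) \<longlonglongrightarrow> prob (\<Union>n. E n)"
  proof (rule finite_Lim_measure_incseq)
    show "range E \<subseteq> events" unfolding E_def by auto
    show "incseq E" unfolding E_def incseq_def by (auto intro: order_trans)
  qed
  also have "(\<Union>n. E n) = space M"
  proof -
    have "\<exists>n::nat. y \<le> sqrt n" for y :: real
    proof -
      obtain n :: nat where "y^2 \<le> n" using real_arch_simple by blast
      then have "sqrt (y^2) \<le> sqrt n" by (rule real_sqrt_le_mono)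
      then have "y \<le> sqrt n" by simp
      then show ?thesis ..
    qed
    then show ?thesis by (auto simp: E_def)
  qed
  finally show ?thesis unfolding whp_def E_def
    by (intro exI[of _ "\<lambda>n::nat. {\<omega> \<in> space M. Z \<omega> \<le> sqrt n}"]) (auto simp: prob_space)
qed

section \<open>Test functions of compact support\<close>

lemma sum_proots_mult_prod_linear:
  fixes A :: "complex poly" and f :: "complex \<Rightarrow> real"
  assumes "finite J" "A \<noteq> 0"
  shows "(\<Sum>w\<in>#proots (A * (\<Prod>j\<in>J. [:- x j, 1:])). f w) = (\<Sum>w\<in>#proots A. f w) + (\<Sum>j\<in>J. f (x j))"
proof -
  have nz: "(\<Prod>j\<in>J. [:- x j, 1:]) \<noteq> 0" using assms(1) by (simp add: prod_zero_iff)
  have "proots (\<Prod>j\<in>J. [:- x j, 1:]) = (\<Sum>j\<in>J. {#x j#})"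
    by (subst proots_prod) auto
  moreover have "(\<Sum>w\<in>#(\<Sum>j\<in>J. {#x j#}). f w) = (\<Sum>j\<in>J. f (x j))"
    using assms(1) by (induction J) auto
  ultimately show ?thesis using proots_mult[OF assms(2) nz] by simp
qed

lemma abs_sum_mset_diff_le:
  fixes f g :: "'b \<Rightarrow> real" and e :: real
  assumes "\<And>w. \<bar>f w - g w\<bar> \<le> e"
  shows "\<bar>(\<Sum>w\<in>#A. f w) - (\<Sum>w\<in>#A. g w)\<bar> \<le> size A * e"
proof (induction A)
  case (add a A)
  then show ?case using assms[of a] by (simp add: distrib_right)
qed simp

lemma (in prob_space) whp_integral_zeros_measure_compact_support:
  fixes z :: "nat \<Rightarrow> complex" and X :: "nat \<Rightarrow> 'a \<Rightarrow> complex" and \<phi> :: "complex \<Rightarrow> real"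
  assumes indep: "indep_vars (\<lambda>_. borel) X {1..k}"
    and dens: "\<And>j. j \<in> {1..k} \<Longrightarrow> distributed M lborel (X j) (\<lambda>x. ennreal (\<nu> j x))"
    and b: "\<And>j x. j \<in> {1..k} \<Longrightarrow> \<nu> j x \<le> b j"
    and l: "l \<le> k"
    and lim: "(\<lambda>n. (\<Sum>i=1..n. \<phi> (z i)) / n) \<longlonglongrightarrow> m"
    and \<phi>: "continuous_on UNIV \<phi>" "\<And>z. norm z \<ge> R \<Longrightarrow> \<phi> z = 0" "R > 0" and e: "\<epsilon> > 0"
  shows "whp M (\<lambda>n \<omega>. \<bar>(\<integral>w. \<phi> w \<partial>zeros_measure ((pderiv ^^ l) (random_poly z k X n \<omega>))) - m\<bar> < \<epsilon>)"
proof -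
  \<comment> \<open>The approximation is paid for twice, at the zeros of \<open>P\<close> and at
    those of \<open>Q\<close>; this leaves the limit \<open>\<epsilon> / 2\<close> for the total
    error \<open>a\<close>.\<close>
  have e4: "\<epsilon> / 4 > 0" using e by simp
  obtain G R' B where G': "G \<in> borel_measurable borel" "R' \<ge> 0" "\<And>z. \<bar>G z\<bar> \<le> B" "\<And>z. norm z \<ge> R'
      \<Longrightarrow> G z = 0"
    and approx: "\<And>w. \<bar>\<phi> w - (\<integral>z. G z * ln (norm (z - w)) \<partial>lborel)\<bar> \<le> \<epsilon> / 4"
  proof (rule log_potential_approx[of \<phi> R "\<epsilon> / 4"])
    show "\<phi> z = 0" if "norm z \<ge> R" for z by (rule \<phi>(2)[OF that])
  qed (use \<phi>(1,3) e4 that in blast)+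
  note G = G'(1,3,4,2)
  define \<psi> where "\<psi> = (\<lambda>w. \<integral>z. G z * ln (norm (z - w)) \<partial>lborel)"
  have B0: "B \<ge> 0" using G(2)[of 0] by linarith
  have [measurable]: "\<phi> \<in> borel_measurable borel" using \<phi>(1)
      by (rule borel_measurable_continuous_onI)
  have "bounded (\<phi> ` cball 0 R)"
    by (intro compact_imp_bounded compact_continuous_image continuous_on_subset[OF \<phi>(1)]) auto
  then obtain K where K0: "\<And>z. z \<in> cball 0 R \<Longrightarrow> \<bar>\<phi> z\<bar> \<le> K" unfolding bounded_iff by force
  have "0 \<le> \<bar>\<phi> 0\<bar>" by simp
  also have "\<dots> \<le> K" using K0[of 0] \<open>R > 0\<close> by simp
  finally have "K \<ge> 0" .
  then have K: "\<bar>\<phi> z\<bar> \<le> K" for z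
    using K0[of z] \<phi>(2)[of z] by (cases "norm z \<le> R") auto
  define A where "A = (\<lambda>n. \<Prod>i=1..n. [:- z i, 1:])"
  have A0: "A n \<noteq> 0" and degA: "degree (A n) = n" for n
    using degree_mult_prod_linear[where A = 1 and J = "{1..n}" and x = z]
        by (auto simp: A_def prod_zero_iff)
  have rp: "random_poly z k X n \<omega> = A n * (\<Prod>j=1..k. [:- X j \<omega>, 1:])" for n \<omega>
    by (simp add: random_poly_def A_def)
  define S where "S = (\<lambda>n \<omega>. \<Sum>t=1..l. \<integral>\<^sup>+w. ennreal (log_minus (X t \<omega> - pivot (A n) k (\<lambda>i. X i \<omega>)
      t (l + 1 - t) w)) * indicator (ball 0 R') w \<partial>lborel)"
  define Z where "Z = (\<lambda>\<omega>. \<Sum>t=1..l. R' + norm (X t \<omega>))"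
  have X: "X i \<in> borel_measurable M" if "i \<in> {1..k}" for i
    using indep that unfolding indep_vars_def by auto
  have tk: "t \<in> {1..k}" if "t \<in> {1..l}" for t using that l by auto
  have term_meas: "(\<lambda>\<omega>. \<integral>\<^sup>+w. ennreal (log_minus (X t \<omega> - pivot (A n) k (\<lambda>i. X i \<omega>) t (l + 1
      - t) w)) * indicator (ball 0 R') w \<partial>lborel) \<in> borel_measurable M"
    if "t \<in> {1..l}" for t n
    using nn_integral_log_minus_pivot_le(2)[OF indep tk[OF that] dens b G(4)] tk[OF that] by blast
  have whpS: "whp M (\<lambda>n \<omega>. S n \<omega> \<le> ennreal (sqrt n))"
  proof (rule whp_le_sqrt)
    define c where "c = (\<Sum>t=1..l. ennreal (b t) * ennreal inv_norm_const * ennreal (pi * R'^2))"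
    fix n
    show "S n \<in> borel_measurable M" unfolding S_def by (intro borel_measurable_sum term_meas)
    have "(\<integral>\<^sup>+\<omega>. S n \<omega> \<partial>M) = (\<Sum>t=1..l. \<integral>\<^sup>+\<omega>. (\<integral>\<^sup>+w. ennreal (log_minus (X t \<omega> - pivot (A n) k (\<lambda>i.
        X i \<omega>) t (l + 1 - t) w)) * indicator (ball 0 R') w \<partial>lborel) \<partial>M)"
      unfolding S_def by (rule nn_integral_sum) (rule term_meas)
    also have "\<dots> \<le> c"
      unfolding c_def
      by (intro sum_mono nn_integral_log_minus_pivot_le(1)[OF indep _ dens b G(4)]) (use tk in auto)
    also have "c = ennreal (enn2real c)"
    proof (rule ennreal_enn2real[symmetric])
      show "c < top" unfolding c_def by (auto simp: ennreal_mult_less_top)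
    qed
    finally show "(\<integral>\<^sup>+\<omega>. S n \<omega> \<partial>M) \<le> ennreal (enn2real c)" .
  qed
  have whpZ: "whp M (\<lambda>n \<omega>. Z \<omega> \<le> sqrt n)"
  proof (rule whp_bounded_by_sqrt)
    show "Z \<in> borel_measurable M" unfolding Z_def
    proof (rule borel_measurable_sum)
      fix t assume "t \<in> {1..l}"
      then have [measurable]: "X t \<in> borel_measurable M" by (intro X tk)
      show "(\<lambda>\<omega>. R' + norm (X t \<omega>)) \<in> borel_measurable M" by measurable
    qed
  qed
  define c0 where "c0 = inv_norm_const + pi * R'^2"
  \<comment> \<open>The bound on the difference of potentials, with both the sizes of the random
    roots and the anticoncentration term replaced by \<open>sqrt n\<close>.\<close>
  define err where "err = (\<lambda>n::nat. B * (l * c0 + pi * R'^2 * (l * ln (real (n + k)) + 4 * sqrt n)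
      + sqrt n))"
  define d where "d = k - l"
  define mn where "mn = (\<lambda>n. (\<Sum>i=1..n. \<phi> (z i)) / real n)"
  \<comment> \<open>The derivative has \<open>n + d\<close> zeros whereas the given average is over
    \<open>n\<close> points; the last summand accounts for this change of normalisation.\<close>
  define a where "a = (\<lambda>n. (2 * real (n + k) * (\<epsilon> / 4) + err n + k * K) / real (n + d) + \<bar>real n /
      real (n + d) * mn n - m\<bar>)"
  have "a \<longlonglongrightarrow> (\<epsilon> / 2 * 1 + (B * (l * c0 * 0 + pi * R'^2 * (real l * 0 + 4 * 0) + 0)) + k * K * 0)
      + \<bar>1 * m - m\<bar>"
  proof -
    have lims: "(\<lambda>n. 1 / real (n + d)) \<longlonglongrightarrow> 0" "(\<lambda>n. real n / real (n + d)) \<longlonglongrightarrow> 1"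
      "(\<lambda>n. real (n + k) / real (n + d)) \<longlonglongrightarrow> 1"
      "(\<lambda>n. ln (real (n + k)) / real (n + d)) \<longlonglongrightarrow> 0" "(\<lambda>n. sqrt (real n) / real (n + d)) \<longlonglongrightarrow> 0"
      unfolding of_nat_add by real_asymp+
    have a_eq: "a = (\<lambda>n. (\<epsilon> / 2 * (real (n + k) / real (n + d))
        + B * (l * c0 * (1 / real (n + d)) + pi * R'^2 * (l * (ln (real (n + k)) / real (n + d))
            + 4 * (sqrt (real n) / real (n + d))) + sqrt (real n) / real (n + d))
        + k * K * (1 / real (n + d))) + \<bar>real n / real (n + d) * mn n - m\<bar>)"
    proof -
      have "(2 * p * (\<epsilon> / 4) + B * (u + v * (real l * x + 4 * y) + y) + w) / D
          = \<epsilon> / 2 * (p / D) + B * (u * (1 / D) + v * (real l * (x / D) + 4 * (y / D)) + y / D) + w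
              * (1 / D)"
        for p u v w x y D :: real
        by (cases "D = 0") (simp_all add: field_simps)
      then show ?thesis unfolding a_def err_def by (simp only:)
    qed
    show ?thesis unfolding a_eq
      by (intro tendsto_add tendsto_mult tendsto_const lims tendsto_rabs tendsto_diff lim[folded
          mn_def])
  qed
  then have "a \<longlonglongrightarrow> \<epsilon> / 2" by simp
  then have ev_a: "\<forall>\<^sub>F n in sequentially. a n < \<epsilon>" by (rule order_tendstoD) (use e in auto)
  show ?thesis
  proof (rule whp_mono[OF whp_conj[OF whpS whpZ]])
    show "\<forall>\<^sub>F n in sequentially. \<forall>\<omega>\<in>space M. S n \<omega> \<le> ennreal (sqrt n) \<and> Z \<omega> \<le> sqrt n \<longrightarrow>
        \<bar>(\<integral>w. \<phi> w \<partial>zeros_measure ((pderiv ^^ l) (random_poly z k X n \<omega>))) - m\<bar> < \<epsilon>"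
      \<comment> \<open>The deterministic part has degree \<open>n\<close>, which must be at least 1
        and at least \<open>l\<close> for the comparison of potentials.\<close>
      using ev_a eventually_ge_at_top[of "max 1 l"]
    proof eventually_elim
      fix n :: nat
      assume an: "a n < \<epsilon>" and n: "n \<ge> max 1 l"
      show "\<forall>\<omega>\<in>space M. S n \<omega> \<le> ennreal (sqrt n) \<and> Z \<omega> \<le> sqrt n \<longrightarrow>
        \<bar>(\<integral>w. \<phi> w \<partial>zeros_measure ((pderiv ^^ l) (random_poly z k X n \<omega>))) - m\<bar> < \<epsilon>"
      proof (intro ballI impI)
        fix \<omega> assume \<omega>: "S n \<omega> \<le> ennreal (sqrt n) \<and> Z \<omega> \<le> sqrt n"
        define P where "P = A n * (\<Prod>j=1..k. [:- X j \<omega>, 1:])"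
        define Q where "Q = (pderiv ^^ l) P"
        have nd: "real (n + d) > 0" using n by simp
        have degP: "degree P = n + k" unfolding P_def by (simp add: degree_mult_prod_linear[OF A0]
            degA)
        have sP: "size (proots P) = n + k" by (simp add: size_proots_complex degP)
        have sQ: "size (proots Q) = n + d"
          using l by (simp add: size_proots_complex Q_def degree_higher_pderiv degP d_def)
        have err0: "err n \<ge> 0"
          using B0 n by (auto simp: err_def c0_def intro!: mult_nonneg_nonneg add_nonneg_nonneg)
        have "ennreal \<bar>(\<Sum>w\<in>#proots Q. \<psi> w) - (\<Sum>w\<in>#proots P. \<psi> w)\<bar>
            \<le> ennreal B * (ennreal (l * c0) + ennreal (pi * R'^2 * (l * ln (real (n + k)) + 4
                * Z \<omega>)) + S n \<omega>)"
          using potential_difference_le[OF A0 l _ _ G, of n "\<lambda>i. X i \<omega>"] n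
          unfolding Q_def P_def \<psi>_def c0_def Z_def S_def degA by simp
        also have "\<dots> \<le> ennreal B * (ennreal (l * c0) + ennreal (pi * R'^2 * (l * ln (real (n + k))
            + 4 * sqrt n)) + ennreal (sqrt n))"
          using \<omega> by (intro mult_left_mono add_mono order_refl ennreal_leI add_left_mono) auto
        also have "\<dots> = ennreal (err n)"
        proof -
          have nn: "0 \<le> l * c0" "0 \<le> pi * R'^2 * (l * ln (real (n + k)) + 4 * sqrt n)" "0 \<le> sqrt n"
            using n by (auto simp: c0_def intro!: mult_nonneg_nonneg add_nonneg_nonneg)
          show ?thesis unfolding err_def ennreal_plus[OF nn(1,2), symmetric]
              ennreal_plus[OF add_nonneg_nonneg[OF nn(1,2)] nn(3), symmetric]
            by (rule ennreal_mult'[OF B0, symmetric])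
        qed
        finally have d1: "\<bar>(\<Sum>w\<in>#proots Q. \<psi> w) - (\<Sum>w\<in>#proots P. \<psi> w)\<bar> \<le> err n"
          using err0 by (simp add: ennreal_le_iff)
        have d2: "\<bar>(\<Sum>w\<in>#proots Q. \<phi> w) - (\<Sum>w\<in>#proots Q. \<psi> w)\<bar> \<le> real (n + d) * (\<epsilon> / 4)"
          using abs_sum_mset_diff_le[of \<phi> \<psi> "\<epsilon> / 4" "proots Q"] approx sQ by (simp add: \<psi>_def)
        have d3: "\<bar>(\<Sum>w\<in>#proots P. \<phi> w) - (\<Sum>w\<in>#proots P. \<psi> w)\<bar> \<le> real (n + k) * (\<epsilon> / 4)"
          using abs_sum_mset_diff_le[of \<phi> \<psi> "\<epsilon> / 4" "proots P"] approx sP by (simp add: \<psi>_def)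
        have dk: "real (n + d) * (\<epsilon> / 4) \<le> real (n + k) * (\<epsilon> / 4)"
          using e by (intro mult_right_mono) (auto simp: d_def)
        have sumP: "(\<Sum>w\<in>#proots P. \<phi> w) = (\<Sum>i=1..n. \<phi> (z i)) + (\<Sum>j=1..k. \<phi> (X j \<omega>))"
        proof -
          have "(\<Sum>w\<in>#proots (A n). \<phi> w) = (\<Sum>i=1..n. \<phi> (z i))"
            using sum_proots_mult_prod_linear[where J = "{1..n}" and A = 1 and x = z and f = \<phi>]
                by (simp add: A_def)
          then show ?thesis unfolding P_def using sum_proots_mult_prod_linear[OF _ A0, where J
              = "{1..k}"] by simp
        qed
        have "\<bar>\<Sum>j=1..k. \<phi> (X j \<omega>)\<bar> \<le> (\<Sum>j=1..k. \<bar>\<phi> (X j \<omega>)\<bar>)" by (rule sum_abs)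
        also have "\<dots> \<le> (\<Sum>j=1..k. K)" by (intro sum_mono K)
        finally have d4: "\<bar>\<Sum>j=1..k. \<phi> (X j \<omega>)\<bar> \<le> k * K" by simp
        have nm: "(\<Sum>i=1..n. \<phi> (z i)) = real n * mn n" using n by (simp add: mn_def)
        define D where "D = (\<Sum>w\<in>#proots Q. \<phi> w) - real n * mn n"
        have D: "\<bar>D\<bar> \<le> 2 * real (n + k) * (\<epsilon> / 4) + err n + k * K"
          using d1 d2 d3 d4 dk unfolding D_def nm[symmetric] sumP by linarith
        have "proots Q \<noteq> {#}" using sQ n by auto
        then have "(\<integral>w. \<phi> w \<partial>zeros_measure Q) = (\<Sum>w\<in>#proots Q. \<phi> w) / real (n + d)"
          unfolding zeros_measure_def by (subst integral_uniform_mset) (auto simp: sQ)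
        also have "\<dots> = D / real (n + d) + real n / real (n + d) * mn n"
          by (simp add: D_def diff_divide_distrib)
        finally have "\<bar>(\<integral>w. \<phi> w \<partial>zeros_measure Q) - m\<bar> \<le> \<bar>D / real (n + d)\<bar> + \<bar>real n / real (n
            + d) * mn n - m\<bar>"
          by linarith
        also have "\<bar>D / real (n + d)\<bar> \<le> (2 * real (n + k) * (\<epsilon> / 4) + err n + k * K) / real (n + d)"
          using D nd by (simp add: abs_divide divide_right_mono)
        finally have "\<bar>(\<integral>w. \<phi> w \<partial>zeros_measure Q) - m\<bar> < \<epsilon>" using an unfolding a_def by linarith
        then show "\<bar>(\<integral>w. \<phi> w \<partial>zeros_measure ((pderiv ^^ l) (random_poly z k X n \<omega>))) - m\<bar> < \<epsilon>"
          unfolding rp Q_def P_def .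
      qed
    qed
  qed
qed

section \<open>From compactly supported to bounded continuous test functions\<close>

definition cutoff :: "real \<Rightarrow> complex \<Rightarrow> real" where
  "cutoff r z = max 0 (min 1 (r + 1 - norm z))"

lemma cutoff_bounds: "0 \<le> cutoff r z" "cutoff r z \<le> 1"
  by (auto simp: cutoff_def)

lemma continuous_on_cutoff: "continuous_on UNIV (cutoff r)"
  unfolding cutoff_def by (intro continuous_intros)

lemma cutoff_measurable [measurable]: "cutoff r \<in> borel_measurable borel"
  by (rule borel_measurable_continuous_onI[OF continuous_on_cutoff])

lemma cutoff_eq_0: "norm z \<ge> r + 1 \<Longrightarrow> cutoff r z = 0"
  by (auto simp: cutoff_def)

text \<open>The loss is expressed by the integral of \<open>cutoff r\<close>, itself a compactly
  supported test function, so a bound for the limit measure passes to the random measures.\<close>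

lemma abs_integral_cutoff_diff_le:
  fixes f :: "complex \<Rightarrow> real"
  assumes "N \<in> borel_prob_measures" and f [measurable]: "f \<in> borel_measurable borel" and K:
      "\<And>x. \<bar>f x\<bar> \<le> K"
  shows "\<bar>(\<integral>x. f x \<partial>N) - (\<integral>x. f x * cutoff r x \<partial>N)\<bar> \<le> K * (1 - (\<integral>x. cutoff r x \<partial>N))"
proof -
  interpret N: prob_space N using assms(1) by (simp add: borel_prob_measures_def)
  have [measurable_cong]: "sets N = sets borel" using assms(1)
      by (simp add: borel_prob_measures_def)
  have int: "integrable N f" "integrable N (cutoff r)" "integrable N (\<lambda>x. f x * cutoff r x)"
  proof -
    show "integrable N f" by (rule N.integrable_const_bound[of _ K]) (use K in auto)
    show "integrable N (cutoff r)" by (rule N.integrable_const_bound[of _ 1]) (use cutoff_bounds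
        in auto)
    show "integrable N (\<lambda>x. f x * cutoff r x)"
    proof (rule N.integrable_const_bound[of _ K])
      have "\<bar>f x\<bar> * \<bar>cutoff r x\<bar> \<le> K * 1" for x
        using cutoff_bounds[of r x] K[of x] by (intro mult_mono) auto
      then show "AE x in N. norm (f x * cutoff r x) \<le> K" by (simp add: abs_mult)
    qed measurable
  qed
  have "(\<integral>x. f x \<partial>N) - (\<integral>x. f x * cutoff r x \<partial>N) = (\<integral>x. f x * (1 - cutoff r x) \<partial>N)"
    using int by (simp add: right_diff_distrib)
  also have "\<bar>\<dots>\<bar> \<le> (\<integral>x. \<bar>f x * (1 - cutoff r x)\<bar> \<partial>N)" by (rule integral_abs_bound)
  also have "\<dots> \<le> (\<integral>x. K * (1 - cutoff r x) \<partial>N)"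
  proof (rule integral_mono)
    show "integrable N (\<lambda>x. \<bar>f x * (1 - cutoff r x)\<bar>)" using int by (simp add: right_diff_distrib)
    show "integrable N (\<lambda>x. K * (1 - cutoff r x))" using int by simp
    show "\<bar>f x * (1 - cutoff r x)\<bar> \<le> K * (1 - cutoff r x)" for x
      using cutoff_bounds(2)[of r x] K[of x] by (simp add: abs_mult mult_right_mono)
  qed
  also have "\<dots> = K * (1 - (\<integral>x. cutoff r x \<partial>N))" using int by (simp add: N.prob_space)
  finally show ?thesis .
qed

lemma exists_cutoff_integral_gt:
  fixes \<mu> :: "complex measure"
  assumes "\<mu> \<in> borel_prob_measures" "c < 1"
  shows "\<exists>r>0. (\<integral>x. cutoff r x \<partial>\<mu>) > c"
proof -
  interpret N: prob_space \<mu> using assms(1) by (simp add: borel_prob_measures_def)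
  have [measurable_cong]: "sets \<mu> = sets borel" using assms(1)
      by (simp add: borel_prob_measures_def)
  have "(\<lambda>n::nat. \<integral>x. cutoff (real n) x \<partial>\<mu>) \<longlonglongrightarrow> (\<integral>x. 1 \<partial>\<mu>)"
  proof (rule integral_dominated_convergence[where w = "\<lambda>_. 1"])
    show "AE x in \<mu>. (\<lambda>n. cutoff (real n) x) \<longlonglongrightarrow> 1"
    proof (rule AE_I2)
      fix x :: complex
      obtain n0 :: nat where n0: "norm x \<le> n0" using real_arch_simple by blast
      have "\<forall>\<^sub>F n in sequentially. cutoff (real n) x = 1"
        using eventually_ge_at_top[of n0] by eventually_elim (use n0 in \<open>auto simp: cutoff_def\<close>)
      then show "(\<lambda>n. cutoff (real n) x) \<longlonglongrightarrow> 1" by (rule tendsto_eventually)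
    qed
    show "AE x in \<mu>. norm (cutoff (real n) x) \<le> 1" for n
      using cutoff_bounds by auto
  qed auto
  then have "\<forall>\<^sub>F n in sequentially. (\<integral>x. cutoff (real n) x \<partial>\<mu>) > c"
    by (rule order_tendstoD) (use assms(2) in \<open>simp add: N.prob_space\<close>)
  then have "\<forall>\<^sub>F n in sequentially. (\<integral>x. cutoff (real n) x \<partial>\<mu>) > c \<and> n > 0"
    using eventually_gt_at_top[of 0] by eventually_elim auto
  from eventually_happens'[OF sequentially_bot this]
  obtain n :: nat where "(\<integral>x. cutoff (real n) x \<partial>\<mu>) > c" "n > 0" by blast
  then show ?thesis by (intro exI[of _ "real n"]) auto
qed

text \<open>Testing with \<open>cutoff r\<close> shows that, with high probability, the random
  measures keep almost all their mass in one fixed disc, because the limit does. This tightness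
  upgrades vague to weak convergence.\<close>

lemma (in prob_space) tendsto_in_prob_weak_topology_if_vague:
  fixes Y :: "nat \<Rightarrow> 'a \<Rightarrow> complex measure"
  assumes \<mu>: "\<mu> \<in> borel_prob_measures" and Y: "\<And>n \<omega>. Y n \<omega> \<in> borel_prob_measures"
    and meas: "\<And>U. openin weak_topology U \<Longrightarrow> \<forall>\<^sub>F n in sequentially. {\<omega> \<in> space M. Y n \<omega> \<in> U}
        \<in> events"
    and vague: "\<And>(\<phi> :: complex \<Rightarrow> real) R \<epsilon>. continuous_on UNIV \<phi> \<Longrightarrow> (\<And>z. norm z \<ge> R \<Longrightarrow> \<phi> z = 0)
        \<Longrightarrow> R > 0 \<Longrightarrow> \<epsilon> > 0 \<Longrightarrow>
      whp M (\<lambda>n \<omega>. \<bar>(\<integral>w. \<phi> w \<partial>Y n \<omega>) - (\<integral>w. \<phi> w \<partial>\<mu>)\<bar> < \<epsilon>)"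
  shows "tendsto_in_prob M weak_topology Y \<mu>"
proof -
  have weak: "whp M (\<lambda>n \<omega>. \<bar>(\<integral>w. f w \<partial>Y n \<omega>) - (\<integral>w. f w \<partial>\<mu>)\<bar> < \<epsilon>)"
    if f: "continuous_on UNIV f" "bounded (range f)" and e: "\<epsilon> > 0" for f :: "complex \<Rightarrow> real" and \<epsilon>
  proof -
    obtain K where K: "K > 0" "\<And>x. \<bar>f x\<bar> \<le> K"
      using f(2) unfolding bounded_pos by auto
    have [measurable]: "f \<in> borel_measurable borel" using f(1)
        by (rule borel_measurable_continuous_onI)
    \<comment> \<open>Cutting off costs \<open>\<epsilon> / 6\<close> for \<open>\<mu>\<close> and
      \<open>\<epsilon> / 3\<close> for \<open>Y n \<omega>\<close>, whose mass outside may be up to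
      \<open>2 * \<eta>\<close>; with \<open>\<epsilon> / 3\<close> for the product with the cutoff
      the total stays below \<open>\<epsilon>\<close>.\<close>
    define \<eta> where "\<eta> = \<epsilon> / (6 * K)"
    have \<eta>: "\<eta> > 0" "K * \<eta> = \<epsilon> / 6" using e K by (auto simp: \<eta>_def)
    obtain r where r: "r > 0" "(\<integral>x. cutoff r x \<partial>\<mu>) > 1 - \<eta>"
      using exists_cutoff_integral_gt[OF \<mu>, of "1 - \<eta>"] \<eta> by auto
    have w1: "whp M (\<lambda>n \<omega>. \<bar>(\<integral>w. cutoff r w \<partial>Y n \<omega>) - (\<integral>w. cutoff r w \<partial>\<mu>)\<bar> < \<eta>)"
      by (rule vague[of "cutoff r" "r + 1"]) (use r \<eta> continuous_on_cutoff cutoff_eq_0 in auto)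
    have w2: "whp M (\<lambda>n \<omega>. \<bar>(\<integral>w. f w * cutoff r w \<partial>Y n \<omega>) - (\<integral>w. f w * cutoff r w \<partial>\<mu>)\<bar> < \<epsilon> / 3)"
    proof (rule vague[of "\<lambda>w. f w * cutoff r w" "r + 1"])
      show "continuous_on UNIV (\<lambda>w. f w * cutoff r w)"
          by (intro continuous_intros f continuous_on_cutoff)
      show "f w * cutoff r w = 0" if "norm w \<ge> r + 1" for w using cutoff_eq_0[OF that] by simp
    qed (use r e in auto)
    show ?thesis
    proof (rule whp_mono[OF whp_conj[OF w1 w2]], intro always_eventually allI ballI impI)
      fix n \<omega>
      assume \<omega>: "\<bar>(\<integral>w. cutoff r w \<partial>Y n \<omega>) - (\<integral>w. cutoff r w \<partial>\<mu>)\<bar>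
          < \<eta> \<and> \<bar>(\<integral>w. f w * cutoff r w \<partial>Y n \<omega>) - (\<integral>w. f w * cutoff r w \<partial>\<mu>)\<bar> < \<epsilon> / 3"
      have "K * (1 - (\<integral>x. cutoff r x \<partial>\<mu>)) \<le> K * \<eta>" using r K by (intro mult_left_mono) auto
      then have t1: "\<bar>(\<integral>x. f x \<partial>\<mu>) - (\<integral>x. f x * cutoff r x \<partial>\<mu>)\<bar> \<le> \<epsilon> / 6"
        using abs_integral_cutoff_diff_le[where f = f and r = r, OF \<mu> _ K(2)] \<eta>(2) by simp
      have "1 - (\<integral>x. cutoff r x \<partial>Y n \<omega>) \<le> 2 * \<eta>" using \<omega> r by linarith
      then have "K * (1 - (\<integral>x. cutoff r x \<partial>Y n \<omega>)) \<le> K * (2 * \<eta>)" using K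
          by (intro mult_left_mono) auto
      then have t2: "\<bar>(\<integral>x. f x \<partial>Y n \<omega>) - (\<integral>x. f x * cutoff r x \<partial>Y n \<omega>)\<bar> \<le> \<epsilon> / 3"
        using abs_integral_cutoff_diff_le[where f = f and r = r, OF Y[of n \<omega>] _ K(2)] \<eta>(2) by simp
      show "\<bar>(\<integral>w. f w \<partial>Y n \<omega>) - (\<integral>w. f w \<partial>\<mu>)\<bar> < \<epsilon>" using t1 t2 \<omega> e by linarith
    qed
  qed
  have whpU: "\<mu> \<in> U \<Longrightarrow> whp M (\<lambda>n \<omega>. Y n \<omega> \<in> U)" if "openin weak_topology U" for U
    using that[unfolded weak_topology_def openin_topology_generated_by_iff]
  proof (induction rule: generate_topology_on.induct)
    case (Int a b)
    then show ?case using whp_conj[of "\<lambda>n \<omega>. Y n \<omega> \<in> a" "\<lambda>n \<omega>. Y n \<omega> \<in> b"] by simp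
  next
    \<comment> \<open>A single member containing \<open>\<mu>\<close> suffices, so the union may be
      uncountable.\<close>
    case (UN K)
    then obtain k where k: "k \<in> K" "\<mu> \<in> k" by blast
    then have "whp M (\<lambda>n \<omega>. Y n \<omega> \<in> k)" using UN.IH by blast
    then show ?case by (rule whp_mono) (use k in \<open>auto intro!: always_eventually\<close>)
  next
    case (Basis S)
    then obtain f :: "complex \<Rightarrow> real" and V where
      S: "S = {N \<in> borel_prob_measures. (\<integral>x. f x \<partial>N) \<in> V}"
      and f: "continuous_on UNIV f" "bounded (range f)" and V: "open V" by blast
    obtain \<epsilon> where \<epsilon>: "\<epsilon> > 0" "\<And>y. dist y (\<integral>x. f x \<partial>\<mu>) < \<epsilon> \<Longrightarrow> y \<in> V"
      using V Basis.prems unfolding S open_dist by auto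
    show ?case
      by (rule whp_mono[OF weak[OF f \<epsilon>(1)]]) (auto simp: S Y dist_real_def intro!: \<epsilon>(2)
          always_eventually)
  qed auto
  show ?thesis unfolding tendsto_in_prob_def
    using \<mu> tendsto_prob_if_whp[OF whpU meas] by auto
qed

theorem corollary1p7:
  fixes \<mu> :: "complex measure" and z :: "nat \<Rightarrow> complex"
    and M :: "'w measure" and k :: nat
    and X :: "nat \<Rightarrow> 'w \<Rightarrow> complex" and \<nu> :: "nat \<Rightarrow> complex \<Rightarrow> real"
  assumes "prob_space \<mu>" and "sets \<mu> = sets borel"
    and "log_Cesaro_bounded z" and "mu_distributed \<mu> z"
    and "prob_space M"
    and "prob_space.indep_vars M (\<lambda>_. borel) X {1..k}"
    and "\<And>j. j \<in> {1..k} \<Longrightarrow> distributed M lborel (X j) (\<lambda>x. ennreal (\<nu> j x))"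
    and "\<And>j x. j \<in> {1..k} \<Longrightarrow> 0 \<le> \<nu> j x"
    and "\<And>j. j \<in> {1..k} \<Longrightarrow> bounded (range (\<nu> j))"
  shows "tendsto_in_prob M weak_topology (\<lambda>n \<omega>. zeros_measure (random_poly z k X n \<omega>)) \<mu>
    \<and> (\<forall>l\<in>{1..k}. tendsto_in_prob M weak_topology
          (\<lambda>n \<omega>. zeros_measure ((pderiv ^^ l) (random_poly z k X n \<omega>))) \<mu>)"
proof -
  interpret prob_space M by fact
  have \<mu>: "\<mu> \<in> borel_prob_measures" using assms(1,2) by (simp add: borel_prob_measures_def)
  have "\<forall>j\<in>{1..k}. \<exists>b. \<forall>x. \<nu> j x \<le> b"
  proof
    fix j assume "j \<in> {1..k}"
    then obtain b where b: "\<forall>y\<in>range (\<nu> j). norm y \<le> b"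
      using assms(9) unfolding bounded_iff by blast
    have "\<nu> j x \<le> b" for x using bspec[OF b rangeI, of x] by (simp add: abs_le_iff)
    then show "\<exists>b. \<forall>x. \<nu> j x \<le> b" by blast
  qed
  from bchoice[OF this] obtain b where b: "\<And>j x. j \<in> {1..k} \<Longrightarrow> \<nu> j x \<le> b j" by blast
  have X: "X i \<in> borel_measurable M" if "i \<in> {1..k}" for i
    using assms(6) that unfolding indep_vars_def by auto
  have lim: "(\<lambda>n. (\<Sum>i=1..n. \<phi> (z i)) / real n) \<longlonglongrightarrow> (\<integral>x. \<phi> x \<partial>\<mu>)"
    if \<phi>: "continuous_on UNIV \<phi>" "bounded (range \<phi>)" for \<phi> :: "complex \<Rightarrow> real"
  proof -
    have "(\<lambda>n. \<integral>x. \<phi> x \<partial>uniform_mset (image_mset z (mset_set {1..n}))) \<longlonglongrightarrow> (\<integral>x. \<phi> x \<partial>\<mu>)"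
      using assms(4) \<phi> unfolding mu_distributed_def
      by (subst (asm) limitin_weak_topology_iff) (auto simp: \<mu> uniform_mset_in_borel_prob_measures)
    moreover have "\<forall>\<^sub>F n in sequentially. (\<integral>x. \<phi> x \<partial>uniform_mset (image_mset z (mset_set {1..n})))
        = (\<Sum>i=1..n. \<phi> (z i)) / real n"
      using eventually_ge_at_top[of 1]
    proof eventually_elim
      case (elim n)
      then have "image_mset z (mset_set {1..n}) \<noteq> {#}" by (simp add: mset_set_empty_iff)
      then show ?case
        using \<phi>(1) by (subst integral_uniform_mset)
          (auto simp: image_mset.compositionality o_def sum_unfold_sum_mset intro:
              borel_measurable_continuous_onI)
    qed
    ultimately show ?thesis by (rule Lim_transform_eventually)
  qed
  \<comment> \<open>Including \<open>l = 0\<close> covers the polynomial itself together with its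
    derivatives.\<close>
  have main: "tendsto_in_prob M weak_topology (\<lambda>n \<omega>. zeros_measure ((pderiv ^^ l) (random_poly z k
      X n \<omega>))) \<mu>"
    if l: "l \<le> k" for l
  proof (rule tendsto_in_prob_weak_topology_if_vague[OF \<mu>])
    show "zeros_measure ((pderiv ^^ l) (random_poly z k X n \<omega>)) \<in> borel_prob_measures" for n \<omega>
      by (simp add: zeros_measure_def uniform_mset_in_borel_prob_measures)
  next
    fix U :: "complex measure set" assume U: "openin weak_topology U"
    show "\<forall>\<^sub>F n in sequentially. {\<omega> \<in> space M. zeros_measure ((pderiv ^^ l) (random_poly z k X n
        \<omega>)) \<in> U} \<in> events"
      \<comment> \<open>For \<open>n = 0\<close> and \<open>l = k\<close> the derivative is constant
        and its \<open>zeros_measure\<close> is unspecified.\<close>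
      using eventually_ge_at_top[of 1]
    proof eventually_elim
      case (elim n)
      have "(\<Prod>i=1..n. [:- z i, 1:]) \<noteq> 0" "degree (\<Prod>i=1..n. [:- z i, 1:]) = n"
        using degree_mult_prod_linear[where A = 1 and J = "{1..n}" and x = z]
            by (auto simp: prod_zero_iff)
      then show ?case
        unfolding random_poly_def using elim l by (intro sets_zeros_measure_in X U) auto
    qed
  next
    fix \<phi> :: "complex \<Rightarrow> real" and R \<epsilon> :: real
    assume \<phi>: "continuous_on UNIV \<phi>" "\<And>z. norm z \<ge> R \<Longrightarrow> \<phi> z = 0" "R > 0" and e: "\<epsilon> > 0"
    have "range \<phi> \<subseteq> insert 0 (\<phi> ` cball 0 R)"
    proof
      fix y assume "y \<in> range \<phi>"
      then obtain w where "y = \<phi> w" by auto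
      then show "y \<in> insert 0 (\<phi> ` cball 0 R)" using \<phi>(2)[of w] by (cases "norm w \<le> R") auto
    qed
    moreover have "bounded (\<phi> ` cball 0 R)"
      by (intro compact_imp_bounded compact_continuous_image continuous_on_subset[OF \<phi>(1)]) auto
    ultimately have "bounded (range \<phi>)" by (meson bounded_insert bounded_subset)
    from lim[OF \<phi>(1) this]
    show "whp M (\<lambda>n \<omega>. \<bar>(\<integral>w. \<phi> w \<partial>zeros_measure ((pderiv ^^ l) (random_poly z k X n \<omega>)))
        - (\<integral>w. \<phi> w \<partial>\<mu>)\<bar> < \<epsilon>)"
      by (intro whp_integral_zeros_measure_compact_support[OF assms(6,7) b l _ \<phi> e])
  qed
  from main[of 0] main show ?thesis by simp
qed

end
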